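(* Assume that $\mathcal{D}(A)\subset\mathcal{D}(Q^{-1/2})$, $|(-A)^{1/2}Q^{1/2}|_{\mathcal{L}_2(H)}<\infty$ and $|Q^{-1/2}(-A)^{-1}|_{\mathcal{L}(H)}<\infty$. Assume that $F\colon H\to H$ is Fréchet differentiable and that there exist $L_F,L>0$ such that $|F(u)-F(v)|\le L_F|u-v|$ for $u,v\in H$, $|F(u)|_{\dot H^1}\le L(1+|u|_{\dot H^1})$ for $u\in\dot H^1$, and $|F'(u)v|_{\dot H^2}\le L(1+|u|_{\dot H^2}^2)|v|_{\dot H^2}$ for $u,v\in\dot H^2$. Let $T>0$ and $x\in H$. Then the fully discrete accelerated exponential Euler method weakly asymptotically preserves the large deviations principle of $\{X_x^\varepsilon\}_{\varepsilon>0}$, that is: for any $\kappa>0$ and any $z\in W_{2,Q}^{1,2}(T)$ with $z(0)=x$, there exist $n\in\mathbb{N}^+$, $\tau>0$ and $z_{n,\tau}\in\mathcal{H}_1^{n,y}(T)$, where $y=P_nx$, such that $$|z-z_{n,\tau}|_{C([0,T];H)}<\kappa,\qquad |I_{0,T}^x(z)-I_{0,T}^{n,\tau,y}(z_{n,\tau})|<\kappa.$$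
   Context: $H:=L^2((0,1);\mathbb{R})$ with inner product $\langle\cdot,\cdot\rangle$ and norm $|\cdot|$; $\mathcal{L}(H)$ and $\mathcal{L}_2(H)$ are the bounded and the Hilbert–Schmidt operators on $H$. $A$ is the Dirichlet Laplacian on $(0,1)$, $\mathcal{D}(A)=H_0^1\cap H^2$; $e_i(\xi)=\sqrt2\sin(i\pi\xi)$ is an orthonormal basis of $H$ with $-Ae_i=\lambda_ie_i$, $\lambda_i=\pi^2i^2$. For $\gamma\in\mathbb{R}$, $\dot H^\gamma:=\mathcal{D}((-A)^{\gamma/2})$ with norm $|u|_{\dot H^\gamma}=|(-A)^{\gamma/2}u|$. $Q$ is a self-adjoint, positive definite bounded linear operator on $H$ with $Qe_i=q_ie_i$, $q_i>0$; $Q^{-1/2}\colon Q^{1/2}(H)\to H$ is the inverse of $Q^{1/2}$ and $\mathcal{D}(Q^{-1/2})=Q^{1/2}(H)$. $X_x^\varepsilon$ denotes the mild solution of $dX=(AX+F(X))dt+\varepsilon Q^{1/2}dW$, $X(0)=x$ ($W$ a cylindrical Wiener process on $H$). Its sample path rate function on $C([0,T];H)$ is $$I_{0,T}^x(z)=\tfrac12\inf\{|\varphi|_{L^2(0,T;H)}^2:\varphi\in L^2(0,T;H),\ z_{0,x}^\varphi=z\}\quad(\inf\emptyset=+\infty),$$ where $z_{0,x}^\varphi$ is the mild solution of $\frac{dz}{dt}=Az+F(z)+Q^{1/2}\varphi$ on $(0,T]$, $z(0)=x$. $W_2^{1,2}(T)$ is the closure of $C^\infty([0,T]\times[0,1];\mathbb{R})$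 in the norm $\big(\int_0^T\int_0^1|z|^2+|\partial_tz|^2+|\partial_\xi z|^2+|\partial_\xi^2z|^2\,d\xi dt\big)^{1/2}$, and $W_{2,Q}^{1,2}(T)$ is the set of $z\in W_2^{1,2}(T)$ such that $\frac{dz(t)}{dt}-Az(t)-F(z(t))\in Q^{1/2}(H)$ for almost all $t\in[0,T]$ (so implicitly $z(t)\in\mathcal{D}(A)$ for almost all $t$) and $\int_0^T|Q^{-1/2}(\frac{dz(t)}{dt}-Az(t)-F(z(t)))|^2dt<\infty$. For $n\in\mathbb{N}^+$: $H_n:=\mathrm{span}\{e_1,\dots,e_n\}$, $P_n$ is the orthogonal projection of $H$ onto $H_n$, $A_n:=P_nA$ (on $H_n$), $F_n:=P_nF$, $Q_n^{1/2}:=P_nQ^{1/2}$ (a bijection of $H_n$). The fully discrete method with stepsize $\tau>0$ (in continuous-time form) is $dY^{\varepsilon,n}_y(t)=(A_nY^{\varepsilon,n}_y(t)+F_n(Y^{\varepsilon,n}_y(\tau\lfloor t/\tau\rfloor)))dt+\varepsilon Q_n^{1/2}d(P_nW)(t)$, $Y^{\varepsilon,n}_y(0)=y=P_nx$. Its sample path rate function on $C([0,T];H_n)$ is $$I_{0,T}^{n,\tau,y}(z)=\tfrac12\inf\{|\phi|_{L^2(0,T;H)}^2:\phi\in L^2(0,T;H_n),\ z_{0,y}^{n,\tau,\phi}=z\},$$ where $z_{0,y}^{n,\tau,\phi}$ is the mild solution of $\frac{dz(t)}{dt}=A_nz(t)+F_n(z(\tau\lfloor t/\tau\rfloor))+Q_n^{1/2}\phi(t)$,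 $z(0)=y$. Its effective domain is $$\mathcal{H}_1^{n,y}(T):=\Big\{z\in C([0,T];H_n): z(\cdot)=y+\int_0^\cdot\upsilon(s)ds,\ \upsilon\in L^2(0,T;H_n)\Big\}.$$ *)

theory Defs
  imports "HOL-Analysis.Analysis"
begin

section \<open>The Hilbert space of square integrable functions on the unit interval\<close>

abbreviation leb01 :: "real measure" where
  "leb01 \<equiv> lebesgue_on {0<..<1}"

definition sq_int :: "(real \<Rightarrow> real) \<Rightarrow> bool" where
  "sq_int f \<longleftrightarrow> f \<in> borel_measurable leb01 \<and> integrable leb01 (\<lambda>\<xi>. (f \<xi>)\<^sup>2)"

definition L2_eq :: "(real \<Rightarrow> real) \<Rightarrow> (real \<Rightarrow> real) \<Rightarrow> bool" where
  "L2_eq f g \<longleftrightarrow> sq_int f \<and> sq_int g \<and> (AE \<xi> in leb01. f \<xi> = g \<xi>)"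

lemma sq_int_measurable [measurable_dest]: "sq_int f \<Longrightarrow> f \<in> borel_measurable leb01"
  by (simp add: sq_int_def)

lemma sq_int_mult:
  assumes "sq_int f" "sq_int g"
  shows "integrable leb01 (\<lambda>\<xi>. f \<xi> * g \<xi>)"
proof (rule Bochner_Integration.integrable_bound)
  show "integrable leb01 (\<lambda>\<xi>. (f \<xi>)\<^sup>2 + (g \<xi>)\<^sup>2)"
    using assms by (auto simp: sq_int_def)
  show "(\<lambda>\<xi>. f \<xi> * g \<xi>) \<in> borel_measurable leb01"
    using assms by (auto simp: sq_int_def)
  have "\<bar>a * b\<bar> \<le> a\<^sup>2 + b\<^sup>2" for a b :: real
  proof -
    have "0 \<le> (\<bar>a\<bar> - \<bar>b\<bar>)\<^sup>2" by simp
    then have "2 * \<bar>a * b\<bar> \<le> a\<^sup>2 + b\<^sup>2"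
      by (simp add: power2_diff abs_mult)
    then show ?thesis by (smt (verit) abs_ge_zero)
  qed
  then show "AE \<xi> in leb01. norm (f \<xi> * g \<xi>) \<le> norm ((f \<xi>)\<^sup>2 + (g \<xi>)\<^sup>2)"
    by auto
qed

lemma sq_int_add: "sq_int f \<Longrightarrow> sq_int g \<Longrightarrow> sq_int (\<lambda>\<xi>. f \<xi> + g \<xi>)"
  using sq_int_mult[of f g] by (auto simp: sq_int_def power2_sum mult.assoc)

lemma sq_int_cmult: "sq_int f \<Longrightarrow> sq_int (\<lambda>\<xi>. c * f \<xi>)"
  by (auto simp: sq_int_def power_mult_distrib)

lemma sq_int_minus: "sq_int f \<Longrightarrow> sq_int (\<lambda>\<xi>. - f \<xi>)"
  by (auto simp: sq_int_def)

lemma sq_int_diff: "sq_int f \<Longrightarrow> sq_int g \<Longrightarrow> sq_int (\<lambda>\<xi>. f \<xi> - g \<xi>)"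
  using sq_int_add[OF _ sq_int_minus, of f g] by simp

lemma sq_int_abs: "sq_int f \<Longrightarrow> sq_int (\<lambda>\<xi>. \<bar>f \<xi>\<bar>)"
  by (auto simp: sq_int_def)

lemma finite_measure_leb01: "finite_measure leb01"
  by (rule finite_measure_lebesgue_on) auto

lemma sq_int_const: "sq_int (\<lambda>_. c)"
proof -
  interpret finite_measure leb01 by (rule finite_measure_leb01)
  show ?thesis by (auto simp: sq_int_def)
qed

lemma sq_int_bound:
  assumes f: "f \<in> borel_measurable leb01" and w: "sq_int w"
    and le: "AE \<xi> in leb01. \<bar>f \<xi>\<bar> \<le> \<bar>w \<xi>\<bar>"
  shows "sq_int f"
  unfolding sq_int_def
proof (intro conjI f, rule Bochner_Integration.integrable_bound)
  show "integrable leb01 (\<lambda>\<xi>. (w \<xi>)\<^sup>2)"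
    using w by (simp add: sq_int_def)
  show "(\<lambda>\<xi>. (f \<xi>)\<^sup>2) \<in> borel_measurable leb01"
    using f by auto
  show "AE \<xi> in leb01. norm ((f \<xi>)\<^sup>2) \<le> norm ((w \<xi>)\<^sup>2)"
    using le by eventually_elim (simp add: abs_le_square_iff)
qed

quotient_type L2 = "real \<Rightarrow> real" / partial: L2_eq
  morphisms rep_L2 mk_L2
proof (rule part_equivpI)
  show "\<exists>f. L2_eq f f"
    using sq_int_const by (auto simp: L2_eq_def)
  show "symp L2_eq"
    by (auto simp: symp_def L2_eq_def)
  show "transp L2_eq"
    unfolding transp_def L2_eq_def by (auto elim: eventually_elim2)
qed

instantiation L2 :: real_inner
begin

lift_definition zero_L2 :: L2 is "\<lambda>_. 0"
  using sq_int_const by (auto simp: L2_eq_def)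

lift_definition plus_L2 :: "L2 \<Rightarrow> L2 \<Rightarrow> L2" is "\<lambda>f g \<xi>. f \<xi> + g \<xi>"
  unfolding L2_eq_def by (auto intro: sq_int_add elim: eventually_elim2)

lift_definition uminus_L2 :: "L2 \<Rightarrow> L2" is "\<lambda>f \<xi>. - f \<xi>"
  unfolding L2_eq_def by (auto intro: sq_int_minus elim: eventually_mono)

lift_definition minus_L2 :: "L2 \<Rightarrow> L2 \<Rightarrow> L2" is "\<lambda>f g \<xi>. f \<xi> - g \<xi>"
  unfolding L2_eq_def by (auto intro: sq_int_diff elim: eventually_elim2)

lift_definition scaleR_L2 :: "real \<Rightarrow> L2 \<Rightarrow> L2" is "\<lambda>c f \<xi>. c * f \<xi>"
  unfolding L2_eq_def by (auto intro: sq_int_cmult elim: eventually_mono)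

lift_definition inner_L2 :: "L2 \<Rightarrow> L2 \<Rightarrow> real" is "\<lambda>f g. \<integral>\<xi>. f \<xi> * g \<xi> \<partial>leb01"
  unfolding L2_eq_def
  by (rule integral_cong_AE) (auto intro: sq_int_measurable elim: eventually_elim2)

definition norm_L2 :: "L2 \<Rightarrow> real" where
  "norm_L2 u = sqrt (u \<bullet> u)"

definition dist_L2 :: "L2 \<Rightarrow> L2 \<Rightarrow> real" where
  "dist_L2 u v = norm (u - v)"

definition sgn_L2 :: "L2 \<Rightarrow> L2" where
  "sgn_L2 u = inverse (norm u) *\<^sub>R u"

definition uniformity_L2 :: "(L2 \<times> L2) filter" where
  "uniformity_L2 = (INF e\<in>{0 <..}. principal {(x, y). dist x y < e})"

definition open_L2 :: "L2 set \<Rightarrow> bool" where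
  "open_L2 U \<longleftrightarrow> (\<forall>x\<in>U. eventually (\<lambda>(x', y). x' = x \<longrightarrow> y \<in> U) uniformity)"

instance
proof
  fix u v w :: L2 and a b :: real
  show "u + v + w = u + (v + w)"
    by transfer (auto simp: L2_eq_def add.assoc intro: sq_int_add)
  show "u + v = v + u"
    by transfer (auto simp: L2_eq_def add.commute intro: sq_int_add)
  show "0 + u = u"
    by transfer (auto simp: L2_eq_def)
  show "- u + u = 0"
    by transfer (auto simp: L2_eq_def intro: sq_int_const)
  show "u - v = u + - v"
    by transfer (auto simp: L2_eq_def intro: sq_int_diff)
  show "a *\<^sub>R (u + v) = a *\<^sub>R u + a *\<^sub>R v"
    by transfer (auto simp: L2_eq_def distrib_left intro!: sq_int_add sq_int_cmult)
  show "(a + b) *\<^sub>R u = a *\<^sub>R u + b *\<^sub>R u"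
    by transfer (auto simp: L2_eq_def distrib_right intro!: sq_int_add sq_int_cmult)
  show "a *\<^sub>R b *\<^sub>R u = (a * b) *\<^sub>R u"
    by transfer (auto simp: L2_eq_def mult.assoc intro!: sq_int_cmult)
  show "1 *\<^sub>R u = u"
    by transfer (auto simp: L2_eq_def)
  show "u \<bullet> v = v \<bullet> u"
    by transfer (simp add: mult.commute)
  show "(u + v) \<bullet> w = u \<bullet> w + v \<bullet> w"
    by transfer (auto simp: L2_eq_def distrib_right sq_int_mult)
  show "(a *\<^sub>R u) \<bullet> v = a * (u \<bullet> v)"
    by transfer (auto simp: mult.assoc)
  show "0 \<le> u \<bullet> u"
    by transfer auto
  show "(u \<bullet> u = 0) = (u = 0)"
  proof (transfer, goal_cases)
    case (1 f)
    then have "sq_int f" by (simp add: L2_eq_def)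
    then have "(\<integral>\<xi>. f \<xi> * f \<xi> \<partial>leb01) = 0 \<longleftrightarrow> (AE \<xi> in leb01. f \<xi> * f \<xi> = 0)"
      by (intro integral_nonneg_eq_0_iff_AE) (auto simp: sq_int_mult)
    with \<open>sq_int f\<close> show ?case
      by (simp add: L2_eq_def sq_int_const)
  qed
qed (simp_all add: norm_L2_def dist_L2_def sgn_L2_def uniformity_L2_def open_L2_def)

end

lemma sq_int_rep_L2: "sq_int (rep_L2 u)"
  by (metis L2_eq_def Quotient_L2 Quotient_rep_reflp)

lemma mk_rep_L2 [simp]: "mk_L2 (rep_L2 u) = u"
  by (metis Quotient_L2 Quotient_abs_rep)

lemma mk_L2_eqI: "sq_int f \<Longrightarrow> sq_int g \<Longrightarrow> AE \<xi> in leb01. f \<xi> = g \<xi> \<Longrightarrow> mk_L2 f = mk_L2 g"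
  by (metis L2_eq_def Quotient_L2 Quotient_rel_abs)

lemma mk_L2_cases: obtains f where "sq_int f" "u = mk_L2 f"
  using sq_int_rep_L2 mk_rep_L2 by metis

lemma mk_L2_add: "sq_int f \<Longrightarrow> sq_int g \<Longrightarrow> mk_L2 f + mk_L2 g = mk_L2 (\<lambda>\<xi>. f \<xi> + g \<xi>)"
  by (rule plus_L2.abs_eq) (auto simp: L2_eq_def)

lemma mk_L2_diff: "sq_int f \<Longrightarrow> sq_int g \<Longrightarrow> mk_L2 f - mk_L2 g = mk_L2 (\<lambda>\<xi>. f \<xi> - g \<xi>)"
  by (rule minus_L2.abs_eq) (auto simp: L2_eq_def)

lemma mk_L2_scaleR: "sq_int f \<Longrightarrow> c *\<^sub>R mk_L2 f = mk_L2 (\<lambda>\<xi>. c * f \<xi>)"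
  by (rule scaleR_L2.abs_eq) (auto simp: L2_eq_def)

lemma inner_mk_L2: "sq_int f \<Longrightarrow> sq_int g \<Longrightarrow> mk_L2 f \<bullet> mk_L2 g = (\<integral>\<xi>. f \<xi> * g \<xi> \<partial>leb01)"
  by (rule inner_L2.abs_eq) (auto simp: L2_eq_def)

lemma norm_mk_L2: "sq_int f \<Longrightarrow> (norm (mk_L2 f))\<^sup>2 = (\<integral>\<xi>. (f \<xi>)\<^sup>2 \<partial>leb01)"
  unfolding power2_norm_eq_inner by (simp add: inner_mk_L2 power2_eq_square)

lemma nn_integral_sq_mk_L2:
  assumes "sq_int f"
  shows "(\<integral>\<^sup>+\<xi>. ennreal ((f \<xi>)\<^sup>2) \<partial>leb01) = ennreal ((norm (mk_L2 f))\<^sup>2)"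
  using assms nn_integral_eq_integral[of leb01 "\<lambda>\<xi>. (f \<xi>)\<^sup>2"]
  by (simp add: norm_mk_L2) (simp add: sq_int_def)

lemma nn_integral_abs_mk_L2:
  assumes f: "sq_int f"
  shows "(\<integral>\<^sup>+\<xi>. ennreal \<bar>f \<xi>\<bar> \<partial>leb01) \<le> ennreal (norm (mk_L2 f))"
proof -
  have i: "integrable leb01 (\<lambda>\<xi>. \<bar>f \<xi>\<bar>)"
    using sq_int_mult[OF sq_int_abs[OF f] sq_int_const[of 1]] by simp
  have "norm (mk_L2 (\<lambda>_. 1)) = 1"
  proof -
    have "measure lebesgue {0<..<1::real} = 1"
      by simp
    then have "(norm (mk_L2 (\<lambda>_. 1)))\<^sup>2 = 1"
      by (simp add: norm_mk_L2 sq_int_const measure_restrict_space)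
    then show ?thesis
      by (metis abs_norm_cancel real_sqrt_abs real_sqrt_one)
  qed
  moreover have "(norm (mk_L2 (\<lambda>\<xi>. \<bar>f \<xi>\<bar>)))\<^sup>2 = (norm (mk_L2 f))\<^sup>2"
    using f by (simp add: norm_mk_L2 sq_int_abs)
  then have "norm (mk_L2 (\<lambda>\<xi>. \<bar>f \<xi>\<bar>)) = norm (mk_L2 f)"
    by simp
  ultimately have "mk_L2 (\<lambda>\<xi>. \<bar>f \<xi>\<bar>) \<bullet> mk_L2 (\<lambda>_. 1) \<le> norm (mk_L2 f)"
    using norm_cauchy_schwarz[of "mk_L2 (\<lambda>\<xi>. \<bar>f \<xi>\<bar>)" "mk_L2 (\<lambda>_. 1)"] by simp
  then have "(\<integral>\<xi>. \<bar>f \<xi>\<bar> \<partial>leb01) \<le> norm (mk_L2 f)"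
    using f by (simp add: inner_mk_L2 sq_int_abs sq_int_const)
  then show ?thesis
    using nn_integral_eq_integral[OF i] by (simp add: ennreal_leI)
qed

instance L2 :: complete_space
proof
  fix X :: "nat \<Rightarrow> L2"
  assume "Cauchy X"
  then have "\<exists>M. \<forall>i\<ge>M. \<forall>j\<ge>M. norm (X i - X j) < (1/2)^n" for n
    by (metis Cauchy_iff dist_norm zero_less_power half_gt_zero zero_less_one)
  then obtain M where M: "\<And>n i j. i \<ge> M n \<Longrightarrow> j \<ge> M n \<Longrightarrow> norm (X i - X j) < (1/2)^n"
    by metis
  define r where "r n = (\<Sum>k\<le>n. M k)" for n
  have rM: "M n \<le> r m" if "n \<le> m" for n m
    unfolding r_def using that by (intro member_le_sum) auto
  define f where "f n = rep_L2 (X (r n))" for n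
  have f: "sq_int (f n)" "mk_L2 (f n) = X (r n)" for n
    by (auto simp: f_def sq_int_rep_L2)
  have [measurable]: "f n \<in> borel_measurable leb01" for n
    using f by (auto intro: sq_int_measurable)
  have nf: "norm (mk_L2 (\<lambda>\<xi>. f m \<xi> - f n \<xi>)) \<le> (1/2)^n" if "n \<le> m" for n m
    using M[of n "r m" "r n"] rM that f by (simp add: mk_L2_diff[symmetric] less_imp_le)
  have "(\<integral>\<^sup>+\<xi>. (\<Sum>n. ennreal \<bar>f (Suc n) \<xi> - f n \<xi>\<bar>) \<partial>leb01)
      = (\<Sum>n. \<integral>\<^sup>+\<xi>. ennreal \<bar>f (Suc n) \<xi> - f n \<xi>\<bar> \<partial>leb01)"
    by (rule nn_integral_suminf) auto
  also have "\<dots> \<le> (\<Sum>n. ennreal ((1/2)^n))"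
  proof (rule suminf_le)
    fix n
    have "(\<integral>\<^sup>+\<xi>. ennreal \<bar>f (Suc n) \<xi> - f n \<xi>\<bar> \<partial>leb01)
        \<le> ennreal (norm (mk_L2 (\<lambda>\<xi>. f (Suc n) \<xi> - f n \<xi>)))"
      by (intro nn_integral_abs_mk_L2 sq_int_diff f)
    also have "\<dots> \<le> ennreal ((1/2)^n)"
      by (intro ennreal_leI nf) auto
    finally show "(\<integral>\<^sup>+\<xi>. ennreal \<bar>f (Suc n) \<xi> - f n \<xi>\<bar> \<partial>leb01) \<le> ennreal ((1/2)^n)" .
  qed auto
  also have "\<dots> = ennreal (\<Sum>n. (1/2)^n)"
    by (rule suminf_ennreal2) (auto intro: summable_geometric)
  also have "\<dots> < \<infinity>" by simp
  finally have "AE \<xi> in leb01. (\<Sum>n. ennreal \<bar>f (Suc n) \<xi> - f n \<xi>\<bar>) \<noteq> \<infinity>"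
    by (intro nn_integral_noteq_infinite) auto
  then have conv: "AE \<xi> in leb01. convergent (\<lambda>n. f n \<xi>)"
  proof eventually_elim
    case (elim \<xi>)
    then have "summable (\<lambda>n. \<bar>f (Suc n) \<xi> - f n \<xi>\<bar>)"
      by (intro summable_suminf_not_top) auto
    then have "summable (\<lambda>n. f (Suc n) \<xi> - f n \<xi>)"
      by (rule summable_rabs_cancel)
    then have "convergent (\<lambda>n. \<Sum>k<n. f (Suc k) \<xi> - f k \<xi>)"
      by (simp add: summable_iff_convergent)
    then have "convergent (\<lambda>n. f n \<xi> - f 0 \<xi>)"
      using sum_lessThan_telescope[of "\<lambda>n. f n \<xi>"] by simp
    then have "convergent (\<lambda>n. (f n \<xi> - f 0 \<xi>) + f 0 \<xi>)"
      by (intro convergent_add convergent_const)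
    then show ?case by simp
  qed
  define h where "h \<xi> = lim (\<lambda>n. f n \<xi>)" for \<xi>
  have h [measurable]: "h \<in> borel_measurable leb01"
    unfolding h_def by measurable
  have est: "(\<integral>\<^sup>+\<xi>. ennreal ((h \<xi> - f n \<xi>)\<^sup>2) \<partial>leb01) \<le> ennreal (((1/2)^n)\<^sup>2)" for n
  proof -
    have "AE \<xi> in leb01. ennreal ((h \<xi> - f n \<xi>)\<^sup>2)
        = liminf (\<lambda>m. ennreal ((f m \<xi> - f n \<xi>)\<^sup>2))"
      using conv
    proof eventually_elim
      case (elim \<xi>)
      then have "(\<lambda>m. f m \<xi>) \<longlonglongrightarrow> h \<xi>"
        by (simp add: h_def convergent_LIMSEQ_iff)
      then have "(\<lambda>m. ennreal ((f m \<xi> - f n \<xi>)\<^sup>2)) \<longlonglongrightarrow> ennreal ((h \<xi> - f n \<xi>)\<^sup>2)"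
        by (intro tendsto_intros tendsto_ennrealI)
      then show ?case
        by (metis lim_imp_Liminf sequentially_bot)
    qed
    then have "(\<integral>\<^sup>+\<xi>. ennreal ((h \<xi> - f n \<xi>)\<^sup>2) \<partial>leb01)
        = (\<integral>\<^sup>+\<xi>. liminf (\<lambda>m. ennreal ((f m \<xi> - f n \<xi>)\<^sup>2)) \<partial>leb01)"
      by (rule nn_integral_cong_AE)
    also have "\<dots> \<le> liminf (\<lambda>m. \<integral>\<^sup>+\<xi>. ennreal ((f m \<xi> - f n \<xi>)\<^sup>2) \<partial>leb01)"
      by (intro nn_integral_liminf) auto
    also have "\<dots> \<le> ennreal (((1/2)^n)\<^sup>2)"
    proof (rule Liminf_le)
      show "\<forall>\<^sub>F m in sequentially. (\<integral>\<^sup>+\<xi>. ennreal ((f m \<xi> - f n \<xi>)\<^sup>2) \<partial>leb01) \<le> ennreal (((1/2)^n)\<^sup>2)"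
        using eventually_ge_at_top[of n]
      proof eventually_elim
        case (elim m)
        have "(\<integral>\<^sup>+\<xi>. ennreal ((f m \<xi> - f n \<xi>)\<^sup>2) \<partial>leb01)
            = ennreal ((norm (mk_L2 (\<lambda>\<xi>. f m \<xi> - f n \<xi>)))\<^sup>2)"
          by (intro nn_integral_sq_mk_L2 sq_int_diff f)
        also have "\<dots> \<le> ennreal (((1/2)^n)\<^sup>2)"
          using elim by (intro ennreal_leI power_mono nf) auto
        finally show ?case .
      qed
    qed auto
    finally show ?thesis .
  qed
  have hf: "sq_int (\<lambda>\<xi>. h \<xi> - f n \<xi>)" for n
    unfolding sq_int_def
  proof (intro conjI integrableI_bounded)
    show "(\<integral>\<^sup>+\<xi>. ennreal (norm ((h \<xi> - f n \<xi>)\<^sup>2)) \<partial>leb01) < \<infinity>"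
      using est[of n] by (simp add: le_less_trans[OF _ ennreal_less_top])
  qed auto
  have sh: "sq_int h"
    using sq_int_add[OF hf[of 0] f(1)[of 0]] by simp
  have lim: "norm (mk_L2 h - X (r n)) \<le> (1/2)^n" for n
  proof -
    have "ennreal ((norm (mk_L2 h - X (r n)))\<^sup>2) \<le> ennreal (((1/2)^n)\<^sup>2)"
      using est[of n] nn_integral_sq_mk_L2[OF hf, of n] f sh by (simp add: mk_L2_diff[symmetric])
    then have "(norm (mk_L2 h - X (r n)))\<^sup>2 \<le> ((1/2)^n)\<^sup>2"
      by (subst (asm) ennreal_le_iff) auto
    then show ?thesis
      by (rule power2_le_imp_le) auto
  qed
  have "X \<longlonglongrightarrow> mk_L2 h"
  proof (rule metric_LIMSEQ_I)
    fix e :: real assume "0 < e"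
    then obtain n where n: "(1/2)^n < e / 2"
      using real_arch_pow_inv[of "e/2" "1/2"] by auto
    have "dist (X i) (mk_L2 h) < e" if "i \<ge> M n" for i
    proof -
      have "norm (X i - mk_L2 h) \<le> norm (X i - X (r n)) + norm (X (r n) - mk_L2 h)"
        using norm_triangle_ineq[of "X i - X (r n)" "X (r n) - mk_L2 h"] by simp
      also have "\<dots> < (1/2)^n + (1/2)^n"
        using M[of n i "r n"] rM[of n n] lim[of n] that by (simp add: norm_minus_commute)
      finally show ?thesis using n by (simp add: dist_norm)
    qed
    then show "\<exists>N. \<forall>i\<ge>N. dist (X i) (mk_L2 h) < e" by blast
  qed
  then show "convergent X" by (auto simp: convergent_def)
qed

instance L2 :: banach ..


lemma mk_L2_dominated_convergence:
  assumes f: "f \<in> borel_measurable leb01" and s: "\<And>n. s n \<in> borel_measurable leb01"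
    and w: "sq_int w"
    and le: "\<And>n. AE \<xi> in leb01. \<bar>s n \<xi>\<bar> \<le> w \<xi>"
    and lim: "AE \<xi> in leb01. (\<lambda>n. s n \<xi>) \<longlonglongrightarrow> f \<xi>"
  shows "(\<lambda>n. mk_L2 (s n)) \<longlonglongrightarrow> mk_L2 f"
proof -
  have [measurable]: "f \<in> borel_measurable leb01" "s n \<in> borel_measurable leb01" for n
    by fact+
  have all: "AE \<xi> in leb01. \<forall>n. \<bar>s n \<xi>\<bar> \<le> w \<xi>"
    using le by (simp add: AE_all_countable)
  have lef: "AE \<xi> in leb01. \<bar>f \<xi>\<bar> \<le> w \<xi>"
    using all lim
  proof eventually_elim
    case (elim \<xi>)
    then show ?case
      by (intro LIMSEQ_le_const2[OF tendsto_rabs]) auto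
  qed
  have sf: "sq_int f"
    by (rule sq_int_bound[OF f w]) (use lef in eventually_elim, simp)
  have ss: "sq_int (s n)" for n
    by (rule sq_int_bound[OF s w]) (use le[of n] in eventually_elim, simp)
  have "(\<lambda>n. \<integral>\<xi>. (s n \<xi> - f \<xi>)\<^sup>2 \<partial>leb01) \<longlonglongrightarrow> (\<integral>\<xi>. 0 \<partial>leb01)"
  proof (rule integral_dominated_convergence)
    show "integrable leb01 (\<lambda>\<xi>. (2 * w \<xi>)\<^sup>2)"
      using sq_int_cmult[OF w, of 2] by (simp add: sq_int_def)
    show "AE \<xi> in leb01. (\<lambda>n. (s n \<xi> - f \<xi>)\<^sup>2) \<longlonglongrightarrow> 0"
      using lim
    proof eventually_elim
      case (elim \<xi>)
      then have "(\<lambda>n. (s n \<xi> - f \<xi>)\<^sup>2) \<longlonglongrightarrow> (f \<xi> - f \<xi>)\<^sup>2"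
        by (intro tendsto_intros)
      then show ?case by simp
    qed
    show "AE \<xi> in leb01. norm ((s n \<xi> - f \<xi>)\<^sup>2) \<le> (2 * w \<xi>)\<^sup>2" for n
      using le[of n] lef
    proof eventually_elim
      case (elim \<xi>)
      then have "\<bar>s n \<xi> - f \<xi>\<bar> \<le> \<bar>2 * w \<xi>\<bar>"
        by linarith
      then have "(s n \<xi> - f \<xi>)\<^sup>2 \<le> (2 * w \<xi>)\<^sup>2"
        by (simp only: abs_le_square_iff)
      then show ?case
        by simp
    qed
  qed auto
  then have "(\<lambda>n. (norm (mk_L2 (s n) - mk_L2 f))\<^sup>2) \<longlonglongrightarrow> 0"
    by (simp add: mk_L2_diff norm_mk_L2 sq_int_diff ss sf)
  then have "(\<lambda>n. sqrt ((norm (mk_L2 (s n) - mk_L2 f))\<^sup>2)) \<longlonglongrightarrow> sqrt 0"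
    by (intro tendsto_intros)
  then have "(\<lambda>n. norm (mk_L2 (s n) - mk_L2 f)) \<longlonglongrightarrow> 0"
    by simp
  then show ?thesis
    by (simp add: tendsto_norm_zero_iff LIM_zero_iff)
qed

lemma continuous_measurable_leb01:
  "continuous_on {0..1} g \<Longrightarrow> g \<in> borel_measurable leb01" for g :: "real \<Rightarrow> real"
  by (rule continuous_imp_measurable_on_sets_lebesgue) (auto intro: continuous_on_subset)

lemma sq_int_continuous:
  fixes g :: "real \<Rightarrow> real"
  assumes "continuous_on {0..1} g"
  shows "sq_int g"
proof -
  have "compact (g ` {0..1})"
    by (rule compact_continuous_image[OF assms]) simp
  then have "\<exists>b. \<forall>\<xi>\<in>{0..1}. \<bar>g \<xi>\<bar> \<le> b"
    using compact_imp_bounded[of "g ` {0..1}"] by (auto simp: bounded_iff)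
  then obtain b where b: "\<And>\<xi>. \<xi> \<in> {0..1} \<Longrightarrow> \<bar>g \<xi>\<bar> \<le> b"
    by blast
  show ?thesis
    by (rule sq_int_bound[OF continuous_measurable_leb01[OF assms] sq_int_const[of b]])
       (auto intro!: AE_I2 order_trans[OF b])
qed

lemma polynomials_dense_L2:
  fixes V :: "L2 set"
  assumes V: "closed V" "subspace V" and mono: "\<And>k. mk_L2 (\<lambda>\<xi>. \<xi> ^ k) \<in> V"
  shows "u \<in> V"
proof -
  have poly: "mk_L2 (\<lambda>\<xi>. \<Sum>i\<le>n. a i * \<xi> ^ i) \<in> V" for a :: "nat \<Rightarrow> real" and n
  proof (induction n)
    case 0
    have "mk_L2 (\<lambda>\<xi>. \<Sum>i\<le>0. a i * \<xi> ^ i) = a 0 *\<^sub>R mk_L2 (\<lambda>\<xi>. \<xi> ^ 0)"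
      by (subst mk_L2_scaleR) (auto intro: sq_int_const)
    then show ?case
      using mono V(2) by (simp only: subspace_scale)
  next
    case (Suc n)
    have "mk_L2 (\<lambda>\<xi>. \<Sum>i\<le>Suc n. a i * \<xi> ^ i)
        = mk_L2 (\<lambda>\<xi>. \<Sum>i\<le>n. a i * \<xi> ^ i) + a (Suc n) *\<^sub>R mk_L2 (\<lambda>\<xi>. \<xi> ^ Suc n)"
      by (subst mk_L2_scaleR, (intro sq_int_continuous continuous_intros),
          subst mk_L2_add, (intro sq_int_continuous continuous_intros),
          (intro sq_int_continuous continuous_intros), simp)
    then show ?case
      using Suc mono V(2) by (simp only: subspace_scale subspace_add)
  qed
  have cont: "mk_L2 g \<in> V" if g: "continuous_on {0..1} g" for g
  proof -
    have "\<exists>p. (\<exists>a n. p = (\<lambda>\<xi>. \<Sum>i\<le>n. a i * \<xi> ^ i)) \<and> (\<forall>\<xi>\<in>{0..1}. \<bar>g \<xi> - p \<xi>\<bar> < inverse (Suc m))" for m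
    proof -
      obtain p where "real_polynomial_function p"
        "\<And>\<xi>. \<xi> \<in> {0..1} \<Longrightarrow> \<bar>g \<xi> - p \<xi>\<bar> < inverse (Suc m)"
        using Stone_Weierstrass_real_polynomial_function[OF _ g, of "inverse (Suc m)"] by auto
      then show ?thesis
        unfolding real_polynomial_function_iff_sum by blast
    qed
    then obtain p where p: "\<And>m. \<exists>a n. p m = (\<lambda>\<xi>. \<Sum>i\<le>n. a i * \<xi> ^ i)"
      and gp: "\<And>m \<xi>. \<xi> \<in> {0..1} \<Longrightarrow> \<bar>g \<xi> - p m \<xi>\<bar> < inverse (Suc m)"
      by metis
    have cp: "continuous_on {0..1} (p m)" for m
      using p[of m] by (auto intro!: continuous_intros)
    have "(\<lambda>m. mk_L2 (p m)) \<longlonglongrightarrow> mk_L2 g"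
    proof (rule mk_L2_dominated_convergence)
      show "sq_int (\<lambda>\<xi>. \<bar>g \<xi>\<bar> + 1)"
        by (intro sq_int_continuous continuous_intros g)
      show "AE \<xi> in leb01. \<bar>p n \<xi>\<bar> \<le> \<bar>g \<xi>\<bar> + 1" for n
      proof (rule AE_I2)
        fix \<xi> assume "\<xi> \<in> space leb01"
        then have "\<bar>g \<xi> - p n \<xi>\<bar> < inverse (Suc n)" by (intro gp) auto
        also have "\<dots> \<le> 1" by (simp add: inverse_eq_divide)
        finally show "\<bar>p n \<xi>\<bar> \<le> \<bar>g \<xi>\<bar> + 1" by linarith
      qed
      show "AE \<xi> in leb01. (\<lambda>n. p n \<xi>) \<longlonglongrightarrow> g \<xi>"
      proof (rule AE_I2)
        fix \<xi> assume "\<xi> \<in> space leb01"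
        then have "norm (p n \<xi> - g \<xi>) \<le> inverse (real (Suc n))" for n
          using gp[of \<xi> n] by auto
        then show "(\<lambda>n. p n \<xi>) \<longlonglongrightarrow> g \<xi>"
          by (intro LIM_zero_cancel[OF Lim_null_comparison[OF _ LIMSEQ_inverse_real_of_nat]]) auto
      qed
    qed (auto intro: continuous_measurable_leb01 g cp)
    moreover have "mk_L2 (p m) \<in> V" for m
      using p[of m] poly by auto
    ultimately show ?thesis
      using V(1) by (meson closed_sequentially)
  qed
  have bdd: "mk_L2 f \<in> V"
    if f: "f \<in> borel_measurable leb01" and b: "\<And>\<xi>. \<bar>f \<xi>\<bar> \<le> b" for f b
  proof -
    have "f measurable_on {0<..<1}"
      using f by (simp add: measurable_on_iff_borel_measurable)
    then obtain N g where N: "negligible N" and g: "\<And>n. continuous_on UNIV (g n)"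
      and lim: "\<And>\<xi>. \<xi> \<notin> N \<Longrightarrow> (\<lambda>n. g n \<xi>) \<longlonglongrightarrow> (if \<xi> \<in> {0<..<1} then f \<xi> else 0)"
      unfolding measurable_on_def by blast
    define c where "c n \<xi> = max (-b) (min b (g n \<xi>))" for n :: nat and \<xi>
    have cc: "continuous_on {0..1} (c n)" for n
      unfolding c_def using g by (auto intro!: continuous_intros intro: continuous_on_subset)
    have "0 \<le> b" using b[of 0] by linarith
    have "(\<lambda>n. mk_L2 (c n)) \<longlonglongrightarrow> mk_L2 f"
    proof (rule mk_L2_dominated_convergence)
      show "sq_int (\<lambda>_. b)" by (rule sq_int_const)
      show "AE \<xi> in leb01. \<bar>c n \<xi>\<bar> \<le> b" for n
        using \<open>0 \<le> b\<close> by (auto simp: c_def)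
      have "AE \<xi> in lebesgue. \<xi> \<notin> N"
        using N by (intro AE_not_in) (simp add: negligible_iff_null_sets)
      then have "AE \<xi> in leb01. \<xi> \<notin> N"
        by (subst AE_restrict_space_iff) auto
      moreover have "AE \<xi> in leb01. \<xi> \<in> {0<..<1}"
        by (rule AE_I2) simp
      ultimately show "AE \<xi> in leb01. (\<lambda>n. c n \<xi>) \<longlonglongrightarrow> f \<xi>"
      proof eventually_elim
        case (elim \<xi>)
        then have "(\<lambda>n. g n \<xi>) \<longlonglongrightarrow> f \<xi>"
          using lim[of \<xi>] by simp
        then have "(\<lambda>n. c n \<xi>) \<longlonglongrightarrow> max (-b) (min b (f \<xi>))"
          unfolding c_def by (intro tendsto_intros)
        moreover have "max (-b) (min b (f \<xi>)) = f \<xi>"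
          using b[of \<xi>] by (auto simp: max_def min_def)
        ultimately show ?case by simp
      qed
    qed (auto intro: f continuous_measurable_leb01 cc)
    then show ?thesis
      using V(1) cont[OF cc] by (meson closed_sequentially)
  qed
  obtain f where f: "sq_int f" "u = mk_L2 f"
    by (rule mk_L2_cases)
  have [measurable]: "f \<in> borel_measurable leb01"
    using f by (simp add: sq_int_measurable)
  define c where "c n \<xi> = max (- real n) (min (real n) (f \<xi>))" for n \<xi>
  have [measurable]: "c n \<in> borel_measurable leb01" for n
    unfolding c_def by measurable
  have "(\<lambda>n. mk_L2 (c n)) \<longlonglongrightarrow> mk_L2 f"
  proof (rule mk_L2_dominated_convergence)
    show "sq_int (\<lambda>\<xi>. \<bar>f \<xi>\<bar>)" by (rule sq_int_abs[OF f(1)])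
    show "AE \<xi> in leb01. \<bar>c n \<xi>\<bar> \<le> \<bar>f \<xi>\<bar>" for n
      by (rule AE_I2) (auto simp: c_def max_def min_def)
    show "AE \<xi> in leb01. (\<lambda>n. c n \<xi>) \<longlonglongrightarrow> f \<xi>"
    proof (rule AE_I2)
      fix \<xi>
      obtain m :: nat where m: "\<bar>f \<xi>\<bar> \<le> real m"
        using real_arch_simple by blast
      have "\<forall>\<^sub>F n in sequentially. c n \<xi> = f \<xi>"
        using eventually_ge_at_top[of m]
      proof eventually_elim
        case (elim n)
        then have "real m \<le> real n" by simp
        then show ?case using m by (auto simp: c_def max_def min_def)
      qed
      then show "(\<lambda>n. c n \<xi>) \<longlonglongrightarrow> f \<xi>"
        by (rule tendsto_eventually)
    qed
  qed auto
  moreover have "mk_L2 (c n) \<in> V" for n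
    by (rule bdd[of _ "real n"]) (auto simp: c_def)
  ultimately show ?thesis
    using V(1) f(2) by (meson closed_sequentially)
qed

lemma separable_L2: "\<exists>D :: L2 set. countable D \<and> closure D = UNIV"
proof -
  define m :: "nat \<Rightarrow> L2" where "m k = mk_L2 (\<lambda>\<xi>. \<xi> ^ k)" for k
  define comb :: "(rat \<times> nat) list \<Rightarrow> L2"
    where "comb l = (\<Sum>(q, k)\<leftarrow>l. of_rat q *\<^sub>R m k)" for l
  define D where "D = range comb"
  have add: "x + y \<in> D" if xy: "x \<in> D" "y \<in> D" for x y
  proof -
    obtain l l' where "x = comb l" "y = comb l'"
      using xy unfolding D_def by blast
    then have "x + y = comb (l @ l')"
      by (simp add: comb_def)
    then show ?thesis
      unfolding D_def by (rule range_eqI)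
  qed
  have scale: "of_rat q *\<^sub>R x \<in> D" if x: "x \<in> D" for q x
  proof -
    have "of_rat q *\<^sub>R comb l = comb (map (\<lambda>(p, k). (q * p, k)) l)" for l
    proof (induction l)
      case Nil
      show ?case by (simp add: comb_def)
    next
      case (Cons a l)
      then show ?case
        by (cases a) (simp add: comb_def scaleR_right_distrib of_rat_mult)
    qed
    moreover obtain l where "x = comb l"
      using x unfolding D_def by blast
    ultimately have "of_rat q *\<^sub>R x = comb (map (\<lambda>(p, k). (q * p, k)) l)"
      by simp
    then show ?thesis
      unfolding D_def by (rule range_eqI)
  qed
  have "0 = comb []"
    by (simp add: comb_def)
  then have zero: "0 \<in> D"
    unfolding D_def by (rule range_eqI)
  have mono: "m k \<in> D" for k
  proof -
    have "m k = comb [(1, k)]"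
      by (simp add: comb_def)
    then show ?thesis
      unfolding D_def by (rule range_eqI)
  qed
  have "subspace (closure D)"
    unfolding subspace_def
  proof (intro conjI ballI allI)
    show "0 \<in> closure D"
      using zero closure_subset by blast
  next
    fix x y assume "x \<in> closure D" "y \<in> closure D"
    then obtain X Y where "\<forall>n. X n \<in> D" "X \<longlonglongrightarrow> x" "\<forall>n. Y n \<in> D" "Y \<longlonglongrightarrow> y"
      unfolding closure_sequential by blast
    then have "(\<forall>n. X n + Y n \<in> D) \<and> (\<lambda>n. X n + Y n) \<longlonglongrightarrow> x + y"
      using add tendsto_add by blast
    then show "x + y \<in> closure D"
      unfolding closure_sequential by (rule exI[of _ "\<lambda>n. X n + Y n"])
  next
    fix c :: real and x assume "x \<in> closure D"
    then obtain X where X: "\<forall>n. X n \<in> D" "X \<longlonglongrightarrow> x"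
      unfolding closure_sequential by blast
    have "\<exists>q. c < of_rat q \<and> of_rat q < c + inverse (Suc n)" for n
      by (rule of_rat_dense) simp
    then obtain q where q: "\<And>n. c < of_rat (q n)" "\<And>n. of_rat (q n) < c + inverse (Suc n)"
      by metis
    have "norm (of_rat (q n) - c) \<le> inverse (real (Suc n))" for n
      using q[of n] by (simp add: abs_if)
    then have "(\<lambda>n. of_rat (q n) - c) \<longlonglongrightarrow> 0"
      by (intro Lim_null_comparison[OF _ LIMSEQ_inverse_real_of_nat] always_eventually allI)
    then have "(\<lambda>n. of_rat (q n)) \<longlonglongrightarrow> c"
      by (rule LIM_zero_cancel)
    then have "(\<forall>n. of_rat (q n) *\<^sub>R X n \<in> D) \<and> (\<lambda>n. of_rat (q n) *\<^sub>R X n) \<longlonglongrightarrow> c *\<^sub>R x"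
      using X scale tendsto_scaleR by blast
    then show "c *\<^sub>R x \<in> closure D"
      unfolding closure_sequential by (rule exI[of _ "\<lambda>n. of_rat (q n) *\<^sub>R X n"])
  qed
  moreover have "mk_L2 (\<lambda>\<xi>. \<xi> ^ k) \<in> closure D" for k
    using mono[of k] closure_subset[of D] unfolding m_def by blast
  ultimately have "u \<in> closure D" for u
    by (rule polynomials_dense_L2[OF closed_closure])
  moreover have "countable D"
    by (simp add: D_def)
  ultimately show ?thesis by blast
qed

instance L2 :: second_countable_topology
proof
  obtain D :: "L2 set" where D: "countable D" "closure D = UNIV"
    using separable_L2 by blast
  define B where "B = (\<lambda>(d, n). ball d (inverse (real (Suc n)))) ` (D \<times> UNIV)"
  have "topological_basis B"
  proof (rule topological_basisI)
    show "open b" if "b \<in> B" for b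
      using that by (auto simp: B_def)
    fix U and x :: L2 assume "open U" "x \<in> U"
    then obtain e where e: "e > 0" "ball x e \<subseteq> U"
      by (meson openE)
    obtain n where n: "inverse (real (Suc n)) < e / 2"
      using e reals_Archimedean[of "e/2"] by auto
    have "\<forall>e>0. \<exists>d\<in>D. dist d x < e"
      using D(2) closure_approachable[of x D] by simp
    then have "\<exists>d\<in>D. dist d x < inverse (real (Suc n))"
      by (elim allE[of _ "inverse (real (Suc n))"]) simp
    then obtain d where d: "d \<in> D" "dist d x < inverse (real (Suc n))"
      by blast
    have "ball d (inverse (real (Suc n))) \<subseteq> ball x e"
    proof
      fix y assume "y \<in> ball d (inverse (real (Suc n)))"
      then have "dist x y < e"
        using d(2) n dist_triangle[of x y d] by (simp add: dist_commute)
      then show "y \<in> ball x e" by simp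
    qed
    then show "\<exists>b\<in>B. x \<in> b \<and> b \<subseteq> U"
      using d e(2) by (intro bexI[of _ "ball d (inverse (real (Suc n)))"]) (auto simp: B_def)
  qed
  moreover have "countable B"
    using D by (auto simp: B_def)
  ultimately show "\<exists>B :: L2 set set. countable B \<and> open = generate_topology B"
    using topological_basis_imp_subbasis by blast
qed


section \<open>The Dirichlet Laplacian and its functional calculus\<close>

text \<open>Infinitely differentiable functions with compact support in the open unit interval.\<close>

definition test_fun :: "(real \<Rightarrow> real) \<Rightarrow> bool" where
  "test_fun \<phi> \<longleftrightarrow> (\<forall>k \<xi>. ((deriv ^^ k) \<phi>) differentiable (at \<xi>)) \<and>
     (\<exists>a b. 0 < a \<and> b < 1 \<and> (\<forall>\<xi>. \<xi> \<notin> {a..b} \<longrightarrow> \<phi> \<xi> = 0))"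

definition weak_deriv :: "L2 \<Rightarrow> L2 \<Rightarrow> bool" where
  "weak_deriv u v \<longleftrightarrow> (\<forall>\<phi>. test_fun \<phi> \<longrightarrow> u \<bullet> mk_L2 (deriv \<phi>) = - (v \<bullet> mk_L2 \<phi>))"

definition sobolev_H2 :: "L2 set" where
  "sobolev_H2 = {u. \<exists>v w. weak_deriv u v \<and> weak_deriv v w}"

text \<open>The closure of the test functions in the first order Sobolev norm.\<close>

definition sobolev_H10 :: "L2 set" where
  "sobolev_H10 = {u. \<exists>v \<phi>. weak_deriv u v \<and> (\<forall>n::nat. test_fun (\<phi> n)) \<and>
     (\<lambda>n. mk_L2 (\<phi> n)) \<longlonglongrightarrow> u \<and> (\<lambda>n. mk_L2 (deriv (\<phi> n))) \<longlonglongrightarrow> v}"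

definition dom_A :: "L2 set" where
  "dom_A = sobolev_H10 \<inter> sobolev_H2"

text \<open>Only meaningful on \<^const>\<open>dom_A\<close>; the weak second derivative is unique.\<close>

definition op_A :: "L2 \<Rightarrow> L2" where
  "op_A u = (THE w. \<exists>v. weak_deriv u v \<and> weak_deriv v w)"

text \<open>The eigenbasis is indexed from 1; series over it therefore run over \<^term>\<open>Suc i\<close>.\<close>

definition eb :: "nat \<Rightarrow> L2" where
  "eb i = mk_L2 (\<lambda>\<xi>. sqrt 2 * sin (real i * pi * \<xi>))"

definition lam :: "nat \<Rightarrow> real" where
  "lam i = pi\<^sup>2 * (real i)\<^sup>2"

text \<open>\<open>neg_A_pow s\<close> is \<open>(-A)\<^sup>s\<close>, with domain \<open>dom_neg_A_pow s\<close>.\<close>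

definition dom_neg_A_pow :: "real \<Rightarrow> L2 set" where
  "dom_neg_A_pow s = {u. summable (\<lambda>i. (lam (Suc i) powr s * (u \<bullet> eb (Suc i)))\<^sup>2)}"

definition neg_A_pow :: "real \<Rightarrow> L2 \<Rightarrow> L2" where
  "neg_A_pow s u = (\<Sum>i. (lam (Suc i) powr s * (u \<bullet> eb (Suc i))) *\<^sub>R eb (Suc i))"

text \<open>The spaces \<open>Hdot \<gamma>\<close> are subsets of the base space, which is adequate for \<open>\<gamma> \<ge> 0\<close> only.\<close>

definition Hdot :: "real \<Rightarrow> L2 set" where
  "Hdot \<gamma> = dom_neg_A_pow (\<gamma> / 2)"

definition Hdot_norm :: "real \<Rightarrow> L2 \<Rightarrow> real" where
  "Hdot_norm \<gamma> u = norm (neg_A_pow (\<gamma> / 2) u)"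

text \<open>The semigroup \<open>e\<^bsup>tA\<^esup>\<close>.\<close>

definition semigr :: "real \<Rightarrow> L2 \<Rightarrow> L2" where
  "semigr t u = (\<Sum>i. (exp (- lam (Suc i) * t) * (u \<bullet> eb (Suc i))) *\<^sub>R eb (Suc i))"


section \<open>Operators\<close>

definition self_adjoint :: "(L2 \<Rightarrow> L2) \<Rightarrow> bool" where
  "self_adjoint B \<longleftrightarrow> (\<forall>u v. B u \<bullet> v = u \<bullet> B v)"

definition positive_definite :: "(L2 \<Rightarrow> L2) \<Rightarrow> bool" where
  "positive_definite B \<longleftrightarrow> (\<forall>u. u \<noteq> 0 \<longrightarrow> 0 < B u \<bullet> u)"

text \<open>The unique nonnegative self-adjoint bounded square root.\<close>

definition op_sqrt :: "(L2 \<Rightarrow> L2) \<Rightarrow> L2 \<Rightarrow> L2" where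
  "op_sqrt Q = (THE R. bounded_linear R \<and> self_adjoint R \<and> (\<forall>u. 0 \<le> R u \<bullet> u) \<and> R \<circ> R = Q)"

text \<open>\<open>Q\<^bsup>-1/2\<^esup>\<close>; its domain is \<^term>\<open>range (op_sqrt Q)\<close>.\<close>

definition op_inv_sqrt :: "(L2 \<Rightarrow> L2) \<Rightarrow> L2 \<Rightarrow> L2" where
  "op_inv_sqrt Q = inv (op_sqrt Q)"

definition hilbert_schmidt :: "(L2 \<Rightarrow> L2) \<Rightarrow> bool" where
  "hilbert_schmidt B \<longleftrightarrow> bounded_linear B \<and> summable (\<lambda>i. (norm (B (eb (Suc i))))\<^sup>2)"


section \<open>Path spaces\<close>

text \<open>
  Paths on \<open>[0,T]\<close> are total functions on the reals whose values outside \<open>[0,T]\<close> are ignored.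
  \<open>L2_path T V\<close> consists of the square integrable paths with values in \<open>V\<close>.
\<close>

definition L2_path :: "real \<Rightarrow> L2 set \<Rightarrow> (real \<Rightarrow> L2) set" where
  "L2_path T V = {\<phi>. \<phi> \<in> borel_measurable (lebesgue_on {0..T}) \<and>
     integrable (lebesgue_on {0..T}) (\<lambda>t. (norm (\<phi> t))\<^sup>2) \<and>
     (AE t in lebesgue_on {0..T}. \<phi> t \<in> V)}"

definition L2_path_sqnorm :: "real \<Rightarrow> (real \<Rightarrow> L2) \<Rightarrow> real" where
  "L2_path_sqnorm T \<phi> = (\<integral>t. (norm (\<phi> t))\<^sup>2 \<partial>lebesgue_on {0..T})"

definition C_path :: "real \<Rightarrow> L2 set \<Rightarrow> (real \<Rightarrow> L2) set" where
  "C_path T V = {z. continuous_on {0..T} z \<and> (\<forall>t\<in>{0..T}. z t \<in> V)}"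

text \<open>
  \<open>smooth_jet T D\<close>: the function \<open>D 0 0\<close> of \<open>(t,\<xi>)\<close> is smooth on \<open>[0,T] \<times> [0,1]\<close> up to the boundary,
  and \<open>D i j\<close> is its partial derivative of order \<open>i\<close> in \<open>t\<close> and \<open>j\<close> in \<open>\<xi>\<close>.
\<close>

definition smooth_jet :: "real \<Rightarrow> (nat \<Rightarrow> nat \<Rightarrow> real \<Rightarrow> real \<Rightarrow> real) \<Rightarrow> bool" where
  "smooth_jet T D \<longleftrightarrow> (\<forall>i j.
     continuous_on ({0..T} \<times> {0..1}) (\<lambda>(t, \<xi>). D i j t \<xi>) \<and>
     (\<forall>t\<in>{0..T}. \<forall>\<xi>\<in>{0..1}.
        ((\<lambda>s. D i j s \<xi>) has_real_derivative D (Suc i) j t \<xi>) (at t within {0..T}) \<and>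
        ((\<lambda>\<eta>. D i j t \<eta>) has_real_derivative D i (Suc j) t \<xi>) (at \<xi> within {0..1})))"

definition W12_norm ::
    "real \<Rightarrow> (real \<Rightarrow> L2) \<Rightarrow> (real \<Rightarrow> L2) \<Rightarrow> (real \<Rightarrow> L2) \<Rightarrow> (real \<Rightarrow> L2) \<Rightarrow> real" where
  "W12_norm T z zt zx zxx =
     sqrt (L2_path_sqnorm T z + L2_path_sqnorm T zt + L2_path_sqnorm T zx + L2_path_sqnorm T zxx)"

text \<open>
  An element of the closure of the smooth functions is a limit \<open>z\<close> together with the limits \<open>zt\<close>,
  \<open>zx\<close>, \<open>zxx\<close> of the derivatives, which \<open>z\<close> determines almost everywhere. Functions on
  \<open>(0,T) \<times> (0,1)\<close> are regarded as paths in \<^typ>\<open>L2\<close>, and an element of the closure is identified with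
  its representative that is continuous in time.
\<close>

definition W12_time_deriv :: "real \<Rightarrow> (real \<Rightarrow> L2) \<Rightarrow> (real \<Rightarrow> L2) \<Rightarrow> bool" where
  "W12_time_deriv T z zt \<longleftrightarrow> z \<in> C_path T UNIV \<and> zt \<in> L2_path T UNIV \<and>
     (\<exists>zx\<in>L2_path T UNIV. \<exists>zxx\<in>L2_path T UNIV. \<exists>D. (\<forall>n::nat. smooth_jet T (D n)) \<and>
        (\<lambda>n. W12_norm T
           (\<lambda>t. z t - mk_L2 (D n 0 0 t)) (\<lambda>t. zt t - mk_L2 (D n 1 0 t))
           (\<lambda>t. zx t - mk_L2 (D n 0 1 t)) (\<lambda>t. zxx t - mk_L2 (D n 0 2 t))) \<longlonglongrightarrow> 0)"

definition W12 :: "real \<Rightarrow> (real \<Rightarrow> L2) set" where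
  "W12 T = {z. \<exists>zt. W12_time_deriv T z zt}"

definition W12_Q :: "(L2 \<Rightarrow> L2) \<Rightarrow> (L2 \<Rightarrow> L2) \<Rightarrow> real \<Rightarrow> (real \<Rightarrow> L2) set" where
  "W12_Q F Q T = {z \<in> W12 T. \<exists>zt. W12_time_deriv T z zt \<and>
     (AE t in lebesgue_on {0..T}.
        z t \<in> dom_A \<and> zt t - op_A (z t) - F (z t) \<in> range (op_sqrt Q)) \<and>
     (\<lambda>t. op_inv_sqrt Q (zt t - op_A (z t) - F (z t))) \<in> L2_path T UNIV}"


section \<open>The exact rate function\<close>

text \<open>
  The mild solution is unique on \<open>[0,T]\<close> for Lipschitz \<open>F\<close>, so it is described by a predicate.
\<close>

definition mild_sol ::
    "(L2 \<Rightarrow> L2) \<Rightarrow> (L2 \<Rightarrow> L2) \<Rightarrow> real \<Rightarrow> L2 \<Rightarrow> (real \<Rightarrow> L2) \<Rightarrow> (real \<Rightarrow> L2) \<Rightarrow> bool" where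
  "mild_sol F Q T x \<phi> z \<longleftrightarrow> z \<in> C_path T UNIV \<and>
     (\<forall>t\<in>{0..T}. z t = semigr t x
        + (\<integral>s. semigr (t - s) (F (z s)) \<partial>lebesgue_on {0..t})
        + (\<integral>s. semigr (t - s) (op_sqrt Q (\<phi> s)) \<partial>lebesgue_on {0..t}))"

definition rate ::
    "(L2 \<Rightarrow> L2) \<Rightarrow> (L2 \<Rightarrow> L2) \<Rightarrow> real \<Rightarrow> L2 \<Rightarrow> (real \<Rightarrow> L2) \<Rightarrow> ereal" where
  "rate F Q T x z = ereal (1 / 2) *
     (INF \<phi>\<in>{\<phi> \<in> L2_path T UNIV. mild_sol F Q T x \<phi> z}. ereal (L2_path_sqnorm T \<phi>))"


section \<open>The rate function of the fully discrete method\<close>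

definition Hn :: "nat \<Rightarrow> L2 set" where
  "Hn n = span (eb ` {1..n})"

definition Pn :: "nat \<Rightarrow> L2 \<Rightarrow> L2" where
  "Pn n u = (\<Sum>i=1..n. (u \<bullet> eb i) *\<^sub>R eb i)"

definition An :: "nat \<Rightarrow> L2 \<Rightarrow> L2" where
  "An n u = Pn n (op_A u)"

definition Fn :: "(L2 \<Rightarrow> L2) \<Rightarrow> nat \<Rightarrow> L2 \<Rightarrow> L2" where
  "Fn F n u = Pn n (F u)"

definition Qn_sqrt :: "(L2 \<Rightarrow> L2) \<Rightarrow> nat \<Rightarrow> L2 \<Rightarrow> L2" where
  "Qn_sqrt Q n u = Pn n (op_sqrt Q u)"

text \<open>The exponential series of \<^term>\<open>An n\<close>, to be applied on \<^term>\<open>Hn n\<close>.\<close>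

definition semigr_n :: "nat \<Rightarrow> real \<Rightarrow> L2 \<Rightarrow> L2" where
  "semigr_n n t u = (\<Sum>k. (t ^ k / fact k) *\<^sub>R (An n ^^ k) u)"

definition mild_sol_n ::
    "(L2 \<Rightarrow> L2) \<Rightarrow> (L2 \<Rightarrow> L2) \<Rightarrow> real \<Rightarrow> nat \<Rightarrow> real \<Rightarrow> L2 \<Rightarrow> (real \<Rightarrow> L2) \<Rightarrow> (real \<Rightarrow> L2) \<Rightarrow> bool" where
  "mild_sol_n F Q T n \<tau> y \<phi> z \<longleftrightarrow> z \<in> C_path T (Hn n) \<and>
     (\<forall>t\<in>{0..T}. z t = semigr_n n t y
        + (\<integral>s. semigr_n n (t - s) (Fn F n (z (\<tau> * of_int \<lfloor>s / \<tau>\<rfloor>))) \<partial>lebesgue_on {0..t})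
        + (\<integral>s. semigr_n n (t - s) (Qn_sqrt Q n (\<phi> s)) \<partial>lebesgue_on {0..t}))"

definition rate_n ::
    "(L2 \<Rightarrow> L2) \<Rightarrow> (L2 \<Rightarrow> L2) \<Rightarrow> real \<Rightarrow> nat \<Rightarrow> real \<Rightarrow> L2 \<Rightarrow> (real \<Rightarrow> L2) \<Rightarrow> ereal" where
  "rate_n F Q T n \<tau> y z = ereal (1 / 2) *
     (INF \<phi>\<in>{\<phi> \<in> L2_path T (Hn n). mild_sol_n F Q T n \<tau> y \<phi> z}. ereal (L2_path_sqnorm T \<phi>))"

definition eff_dom_n :: "real \<Rightarrow> nat \<Rightarrow> L2 \<Rightarrow> (real \<Rightarrow> L2) set" where
  "eff_dom_n T n y = {z \<in> C_path T (Hn n).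
     \<exists>\<upsilon>\<in>L2_path T (Hn n). \<forall>t\<in>{0..T}. z t = y + (\<integral>s. \<upsilon> s \<partial>lebesgue_on {0..t})}"

end

theory Submission
  imports Defs
begin

text \<open>
  The path \<open>z\<close> is the mild solution for the control \<open>\<phi> = Q\<^sup>-\<^sup>1\<^sup>/\<^sup>2 (dz/dt - A z - F z)\<close>. For \<open>z'\<close> take
  the discrete mild solution driven by \<open>P\<^sub>n \<phi>\<close>. Since \<open>Q\<^sup>1\<^sup>/\<^sup>2\<close> is diagonal and injective, controls are
  determined by their paths, so the two rates are half the squared norms of \<open>\<phi>\<close> and \<open>P\<^sub>n \<phi>\<close>, which
  are close for large \<open>n\<close>. As \<open>P\<^sub>n z\<close> and \<open>z'\<close> are driven by the same control on \<open>H\<^sub>n\<close>, their distance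
  is bounded by a Gronwall argument that only uses the Lipschitz continuity of \<open>F\<close>.
\<close>

section \<open>The sine basis\<close>

text \<open>The common language is that of coordinates: a mild equation is paired with
  \<open>eb j\<close> and multiplied by \<open>exp (lam j * t)\<close>. The semigroup then
  disappears and a scalar integral identity remains, in the same form for the exact and the discrete
  equation. In these coordinates \<phi> and \<open>Pn n \<phi>\<close> act identically for j \<le>
  n, so the control cancels from the difference of the paths. What drives the error is a single
  number \<delta>, the largest distance from \<open>z s\<close> to the projection of
  \<open>z\<close> at the last grid point before \<open>s\<close>. No convergence rate enters:
  compactness of the image of \<open>z\<close> makes the projection error uniformly small, uniform
  continuity of \<open>z\<close> yields \<tau>, and \<delta> is fixed beforehand so that the factor
  \<open>exp (LF * T)\<close> costs only half of \<kappa>. The bulk of the work is to justify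
  coordinates for objects given by limits. \<open>dom_A\<close> is defined by weak derivatives and
  limits of test functions, and the sines are not test functions, so symmetry of the Laplacian
  against them needs cut-offs with controlled derivatives. Paths in \<open>W12\<close> are limits of
  smooth functions, so absolute continuity of their coordinates has to be recovered.\<close>

lemma integral_leb01_continuous:
  fixes g :: "real \<Rightarrow> real"
  assumes "continuous_on {0..1} g"
  shows "(\<integral>\<xi>. g \<xi> \<partial>leb01) = integral {0..1} g"
proof -
  have "integrable leb01 g"
    using sq_int_mult[OF sq_int_continuous[OF assms] sq_int_const[of 1]] by simp
  then have "(\<integral>\<xi>. g \<xi> \<partial>leb01) = integral {0<..<1} g"
    by (rule lebesgue_integral_eq_integral) auto
  then show ?thesis
    by (simp add: integral_open_interval_real)
qed

lemma integral_leb01_FTC: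
  fixes G g :: "real \<Rightarrow> real"
  assumes g: "continuous_on {0..1} g"
    and G: "\<And>\<xi>. \<xi> \<in> {0..1} \<Longrightarrow> (G has_real_derivative g \<xi>) (at \<xi> within {0..1})"
  shows "(\<integral>\<xi>. g \<xi> \<partial>leb01) = G 1 - G 0"
proof -
  have "(g has_integral (G 1 - G 0)) {0..1}"
    using G by (intro fundamental_theorem_of_calculus)
      (auto simp: has_real_derivative_iff_has_vector_derivative)
  then show ?thesis
    using integral_leb01_continuous[OF g] by (simp add: integral_unique)
qed

text \<open>Stated for integer frequencies because the product of two sines with indices i and j
  produces the frequencies i - j and i + j.\<close>

lemma integral_cos_int:
  fixes k :: int
  shows "(\<integral>\<xi>. cos (of_int k * pi * \<xi>) \<partial>leb01) = (if k = 0 then 1 else 0)"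
proof (cases "k = 0")
  case True
  have "(\<integral>\<xi>. (1::real) \<partial>leb01) = 1 - 0"
    by (rule integral_leb01_FTC[where G = "\<lambda>\<xi>. \<xi>"]) (auto intro!: derivative_eq_intros)
  with True show ?thesis by simp
next
  case False
  have "(\<integral>\<xi>. cos (of_int k * pi * \<xi>) \<partial>leb01)
      = sin (of_int k * pi * 1) / (of_int k * pi) - sin (of_int k * pi * 0) / (of_int k * pi)"
    using False
    by (intro integral_leb01_FTC[where G = "\<lambda>\<xi>. sin (of_int k * pi * \<xi>) / (of_int k * pi)"])
      (auto intro!: derivative_eq_intros continuous_intros)
  moreover have "sin (of_int k * pi) = 0"
    by (simp add: sin_zero_iff_int2)
  ultimately show ?thesis using False by simp
qed

lemma sq_int_eb: "sq_int (\<lambda>\<xi>. sqrt 2 * sin (real i * pi * \<xi>))"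
  by (intro sq_int_continuous continuous_intros)

text \<open>Since 2 sin a sin b = cos (a - b) - cos (a + b), only integrals of cosines remain. Index
  0 is excluded because \<open>eb 0\<close> is the zero vector.\<close>

lemma eb_orthonormal:
  assumes "i \<ge> 1" "j \<ge> 1"
  shows "eb i \<bullet> eb j = (if i = j then 1 else 0)"
proof -
  have c: "integrable leb01 (\<lambda>\<xi>. cos (c * pi * \<xi>))" for c
  proof -
    have "sq_int (\<lambda>\<xi>. cos (c * pi * \<xi>))"
      by (intro sq_int_continuous continuous_intros)
    from sq_int_mult[OF this sq_int_const[of 1]] show ?thesis by simp
  qed
  have "eb i \<bullet> eb j
      = (\<integral>\<xi>. sqrt 2 * sin (real i * pi * \<xi>) * (sqrt 2 * sin (real j * pi * \<xi>)) \<partial>leb01)"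
    unfolding eb_def by (rule inner_mk_L2[OF sq_int_eb sq_int_eb])
  also have "\<dots> = (\<integral>\<xi>. cos (of_int (int i - int j) * pi * \<xi>)
      - cos (of_int (int i + int j) * pi * \<xi>) \<partial>leb01)"
    by (intro Bochner_Integration.integral_cong refl)
      (simp add: left_diff_distrib distrib_right cos_diff cos_add)
  also have "\<dots> = (\<integral>\<xi>. cos (of_int (int i - int j) * pi * \<xi>) \<partial>leb01)
      - (\<integral>\<xi>. cos (of_int (int i + int j) * pi * \<xi>) \<partial>leb01)"
    by (rule Bochner_Integration.integral_diff) (rule c)+
  also have "\<dots> = (if i = j then 1 else 0)"
    unfolding integral_cos_int using assms by auto
  finally show ?thesis .
qed

lemma mk_L2_eq_iff:
  assumes "sq_int f" "sq_int g"
  shows "mk_L2 f = mk_L2 g \<longleftrightarrow> (AE \<xi> in leb01. f \<xi> = g \<xi>)"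
proof
  assume "mk_L2 f = mk_L2 g"
  then have "L2_eq f g"
    using assms Quotient_rel[OF Quotient_L2, of f g] by (simp add: L2_eq_def)
  then show "AE \<xi> in leb01. f \<xi> = g \<xi>"
    by (simp add: L2_eq_def)
qed (rule mk_L2_eqI[OF assms])

section \<open>Completeness of the sine system\<close>

lemma closed_subspace_orthogonal:
  fixes w :: "'a::real_inner"
  shows "closed {v. w \<bullet> v = 0}" "subspace {v. w \<bullet> v = 0}"
  by (auto simp: subspace_def inner_add_right intro!: closed_Collect_eq continuous_intros)

text \<open>The orthogonal complement of \<open>w\<close> is a closed subspace containing all
  monomials, hence everything, and so \<open>w\<close> is orthogonal to itself.\<close>

lemma L2_eq_0_if_orthogonal_monomials:
  assumes "\<And>k. w \<bullet> mk_L2 (\<lambda>\<xi>. \<xi> ^ k) = 0"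
  shows "w = 0"
proof -
  have "w \<in> {v. w \<bullet> v = 0}"
    by (rule polynomials_dense_L2[OF closed_subspace_orthogonal]) (simp add: assms)
  then show ?thesis by simp
qed

text \<open>
  If \<open>u\<close> is orthogonal to every \<open>sin (i\<pi>\<xi>)\<close>, then \<open>u sin (\<pi>\<xi>)\<close> is orthogonal to the polynomials in
  \<open>cos (\<pi>\<xi>)\<close>, which are dense.
\<close>

lemma eb_complete:
  assumes u: "\<And>i. i \<ge> 1 \<Longrightarrow> u \<bullet> eb i = 0"
  shows "u = 0"
proof -
  obtain f where f: "sq_int f" "u = mk_L2 f"
    by (rule mk_L2_cases)
  have ci: "sq_int g \<Longrightarrow> u \<bullet> mk_L2 g = (\<integral>\<xi>. f \<xi> * g \<xi> \<partial>leb01)" for g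
    using f by (simp add: inner_mk_L2)
  define s where "s n k \<xi> = sin (real n * pi * \<xi>) * cos (pi * \<xi>) ^ k" for n k :: nat and \<xi> :: real
  have ss: "sq_int (s n k)" for n k
    unfolding s_def by (intro sq_int_continuous continuous_intros)
  \<comment> \<open>Multiplying by cos (\<pi>\<xi>) replaces sin (n\<pi>\<xi>) by half the sum of
    its two neighbours of index n + 1 and n - 1. The induction on \<open>k\<close> therefore has to
    run for all \<open>n\<close> at once; for n = 0 the function is zero.\<close>
  have s0: "u \<bullet> mk_L2 (s n k) = 0" for n k
  proof (induction k arbitrary: n)
    case 0
    show ?case
    proof (cases "n = 0")
      case True
      then have "s n 0 = (\<lambda>_. 0)" by (auto simp: s_def)
      then show ?thesis by (simp add: zero_L2.abs_eq[symmetric])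
    next
      case False
      then have "u \<bullet> eb n = 0" using u by simp
      moreover have "eb n = sqrt 2 *\<^sub>R mk_L2 (s n 0)"
        by (subst mk_L2_scaleR[OF ss]) (simp add: eb_def s_def)
      ultimately show ?thesis by simp
    qed
  next
    case (Suc k)
    show ?case
    proof (cases n)
      case 0
      then have "s n (Suc k) = (\<lambda>_. 0)" by (auto simp: s_def)
      then show ?thesis by (simp add: zero_L2.abs_eq[symmetric])
    next
      case (Suc m)
      have "s n (Suc k) \<xi> = s (Suc n) k \<xi> / 2 + s m k \<xi> / 2" for \<xi>
      proof -
        have "sin (real (Suc n) * pi * \<xi>) = sin (real n * pi * \<xi>) * cos (pi * \<xi>) + cos (real n * pi * \<xi>) * sin (pi * \<xi>)"
          unfolding sin_add[symmetric] by (intro arg_cong[where f = sin]) (simp add: algebra_simps)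
        moreover have "real m * pi * \<xi> = real n * pi * \<xi> - pi * \<xi>"
          using Suc by (simp add: algebra_simps)
        then have "sin (real m * pi * \<xi>) = sin (real n * pi * \<xi>) * cos (pi * \<xi>) - cos (real n * pi * \<xi>) * sin (pi * \<xi>)"
          by (simp add: sin_diff)
        ultimately show ?thesis
          unfolding s_def power_Suc by (simp only:) (simp add: field_simps)
      qed
      then have "s n (Suc k) = (\<lambda>\<xi>. (1/2) * s (Suc n) k \<xi> + (1/2) * s m k \<xi>)" by auto
      then have "mk_L2 (s n (Suc k)) = (1/2) *\<^sub>R mk_L2 (s (Suc n) k) + (1/2) *\<^sub>R mk_L2 (s m k)"
        by (simp only: mk_L2_scaleR ss mk_L2_add sq_int_cmult)
      then show ?thesis
        by (simp add: inner_add_right Suc.IH)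
    qed
  qed
  have poly: "u \<bullet> mk_L2 (\<lambda>\<xi>. \<Sum>i\<le>n. a i * s 1 i \<xi>) = 0" for a and n :: nat
  proof -
    have "u \<bullet> mk_L2 (\<lambda>\<xi>. \<Sum>i\<le>n. a i * s 1 i \<xi>) = (\<integral>\<xi>. (\<Sum>i\<le>n. a i * (f \<xi> * s 1 i \<xi>)) \<partial>leb01)"
      unfolding s_def
      by (subst ci, (intro sq_int_continuous continuous_intros))
        (intro Bochner_Integration.integral_cong refl, simp add: sum_distrib_left algebra_simps)
    also have "\<dots> = (\<Sum>i\<le>n. a i * (\<integral>\<xi>. f \<xi> * s 1 i \<xi> \<partial>leb01))"
      by (subst Bochner_Integration.integral_sum) (auto intro!: sq_int_mult f ss)
    also have "\<dots> = 0"
      using s0 by (simp add: ci[OF ss, symmetric])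
    finally show ?thesis .
  qed
  have w: "sq_int (\<lambda>\<xi>. f \<xi> * sin (pi * \<xi>))"
  proof (rule sq_int_bound[OF _ f(1)])
    show "(\<lambda>\<xi>. f \<xi> * sin (pi * \<xi>)) \<in> borel_measurable leb01"
      by (intro borel_measurable_times sq_int_measurable[OF f(1)] continuous_measurable_leb01
          continuous_intros)
    show "AE \<xi> in leb01. \<bar>f \<xi> * sin (pi * \<xi>)\<bar> \<le> \<bar>f \<xi>\<bar>"
      by (rule AE_I2) (simp add: abs_mult mult_left_le)
  qed
  have "mk_L2 (\<lambda>\<xi>. f \<xi> * sin (pi * \<xi>)) = 0"
  proof (rule L2_eq_0_if_orthogonal_monomials)
    fix k :: nat
    \<comment> \<open>The substitution y = cos (\<pi>\<xi>) turns the monomial of degree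
      \<open>k\<close> into the continuous function \<open>g\<close> on [-1,1], to which Weierstrass
      approximation applies.\<close>
    define g where "g y = (arccos y / pi) ^ k" for y
    have g: "continuous_on {-1..1} g"
      unfolding g_def by (intro continuous_intros) auto
    have "\<exists>p. (\<exists>a n. p = (\<lambda>y. \<Sum>i\<le>n. a i * y ^ i)) \<and> (\<forall>y\<in>{-1..1}. \<bar>g y - p y\<bar> < inverse (Suc m))" for m
    proof -
      obtain p where "real_polynomial_function p" "\<And>y. y \<in> {-1..1} \<Longrightarrow> \<bar>g y - p y\<bar> < inverse (Suc m)"
        using Stone_Weierstrass_real_polynomial_function[OF _ g, of "inverse (Suc m)"] by auto
      then show ?thesis
        unfolding real_polynomial_function_iff_sum by blast
    qed
    then obtain p where p: "\<And>m. \<exists>a n. p m = (\<lambda>y. \<Sum>i\<le>n. a i * y ^ i)"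
      and gp: "\<And>m y. y \<in> {-1..1} \<Longrightarrow> \<bar>g y - p m y\<bar> < inverse (Suc m)"
      by metis
    have gcos: "g (cos (pi * \<xi>)) = \<xi> ^ k" if "\<xi> \<in> {0<..<1}" for \<xi>
      using that by (simp add: g_def arccos_cos)
    have e: "\<bar>\<xi> ^ k - p m (cos (pi * \<xi>))\<bar> < inverse (Suc m)" if "\<xi> \<in> {0<..<1}" for \<xi> m
      using gp[of "cos (pi * \<xi>)" m] that by (simp add: gcos)
    have cp: "continuous_on {0..1} (\<lambda>\<xi>. p m (cos (pi * \<xi>)))" for m
      using p[of m] by (auto intro!: continuous_intros)
    have "(\<lambda>m. mk_L2 (\<lambda>\<xi>. sin (pi * \<xi>) * p m (cos (pi * \<xi>)))) \<longlonglongrightarrow> mk_L2 (\<lambda>\<xi>. sin (pi * \<xi>) * \<xi> ^ k)"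
    proof (rule mk_L2_dominated_convergence)
      show "sq_int (\<lambda>\<xi>. 2)" by (rule sq_int_const)
      show "AE \<xi> in leb01. \<bar>sin (pi * \<xi>) * p n (cos (pi * \<xi>))\<bar> \<le> 2" for n
      proof (rule AE_I2)
        fix \<xi> assume "\<xi> \<in> space leb01"
        then have x: "\<xi> \<in> {0<..<1}" by auto
        have "\<bar>\<xi> ^ k\<bar> \<le> 1" using x by (simp add: power_le_one)
        moreover have "inverse (real (Suc n)) \<le> 1" by (simp add: inverse_eq_divide)
        ultimately have "\<bar>p n (cos (pi * \<xi>))\<bar> \<le> 2" using e[OF x, of n] by linarith
        then have "\<bar>sin (pi * \<xi>)\<bar> * \<bar>p n (cos (pi * \<xi>))\<bar> \<le> 1 * 2"
          by (intro mult_mono) auto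
        then show "\<bar>sin (pi * \<xi>) * p n (cos (pi * \<xi>))\<bar> \<le> 2" by (simp add: abs_mult)
      qed
      show "AE \<xi> in leb01. (\<lambda>n. sin (pi * \<xi>) * p n (cos (pi * \<xi>))) \<longlonglongrightarrow> sin (pi * \<xi>) * \<xi> ^ k"
      proof (rule AE_I2)
        fix \<xi> assume "\<xi> \<in> space leb01"
        then have x: "\<xi> \<in> {0<..<1}" by auto
        have "norm (p n (cos (pi * \<xi>)) - \<xi> ^ k) \<le> inverse (real (Suc n))" for n
          using e[OF x, of n] by auto
        then have "(\<lambda>n. p n (cos (pi * \<xi>))) \<longlonglongrightarrow> \<xi> ^ k"
          by (intro LIM_zero_cancel[OF Lim_null_comparison[OF _ LIMSEQ_inverse_real_of_nat]]) auto
        then show "(\<lambda>n. sin (pi * \<xi>) * p n (cos (pi * \<xi>))) \<longlonglongrightarrow> sin (pi * \<xi>) * \<xi> ^ k"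
          by (intro tendsto_intros)
      qed
    qed (intro continuous_measurable_leb01 continuous_intros cp)+
    then have "(\<lambda>m. u \<bullet> mk_L2 (\<lambda>\<xi>. sin (pi * \<xi>) * p m (cos (pi * \<xi>)))) \<longlonglongrightarrow> u \<bullet> mk_L2 (\<lambda>\<xi>. sin (pi * \<xi>) * \<xi> ^ k)"
      by (intro tendsto_intros)
    moreover have "u \<bullet> mk_L2 (\<lambda>\<xi>. sin (pi * \<xi>) * p m (cos (pi * \<xi>))) = 0" for m
    proof -
      obtain a n where "p m = (\<lambda>y. \<Sum>i\<le>n. a i * y ^ i)" using p by blast
      then have "(\<lambda>\<xi>. sin (pi * \<xi>) * p m (cos (pi * \<xi>))) = (\<lambda>\<xi>. \<Sum>i\<le>n. a i * s 1 i \<xi>)"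
        by (auto simp: s_def sum_distrib_left algebra_simps)
      then show ?thesis using poly by simp
    qed
    ultimately have "u \<bullet> mk_L2 (\<lambda>\<xi>. sin (pi * \<xi>) * \<xi> ^ k) = 0"
      by (simp add: LIMSEQ_const_iff)
    moreover have "sq_int (\<lambda>\<xi>. sin (pi * \<xi>) * \<xi> ^ k)" "sq_int (\<lambda>\<xi>. \<xi> ^ k)"
      by (intro sq_int_continuous continuous_intros)+
    ultimately show "mk_L2 (\<lambda>\<xi>. f \<xi> * sin (pi * \<xi>)) \<bullet> mk_L2 (\<lambda>\<xi>. \<xi> ^ k) = 0"
      using w by (simp add: ci inner_mk_L2 mult.assoc)
  qed
  then have "AE \<xi> in leb01. f \<xi> * sin (pi * \<xi>) = 0"
    using mk_L2_eq_iff[OF w sq_int_const[of 0]] by (simp add: zero_L2.abs_eq)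
  \<comment> \<open>The weight sin (\<pi>\<xi>), needed to pass from sines to polynomials in the
    cosine, is positive inside the interval and can be divided out.\<close>
  moreover have "AE \<xi> in leb01. sin (pi * \<xi>) \<noteq> 0"
  proof (rule AE_I2)
    fix \<xi> assume "\<xi> \<in> space leb01"
    then have "0 < sin (pi * \<xi>)" by (intro sin_gt_zero) auto
    then show "sin (pi * \<xi>) \<noteq> 0" by simp
  qed
  ultimately have "AE \<xi> in leb01. f \<xi> = 0"
    by eventually_elim simp
  then show "u = 0"
    using mk_L2_eq_iff[OF f(1) sq_int_const[of 0]] f by (simp add: zero_L2.abs_eq)
qed

text \<open>From here on identities between vectors are reduced in this way to scalar identities for
  every positive index.\<close>

lemma L2_eqI:
  assumes "\<And>i. i \<ge> 1 \<Longrightarrow> u \<bullet> eb i = v \<bullet> eb i"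
  shows "u = v"
  using eb_complete[of "u - v"] assms by (simp add: inner_diff_left)

lemma inner_sum_eb:
  assumes "finite I" "\<And>i. i \<in> I \<Longrightarrow> i \<ge> 1" "j \<ge> 1"
  shows "(\<Sum>i\<in>I. a i *\<^sub>R eb i) \<bullet> eb j = (if j \<in> I then a j else 0)"
proof -
  have "(\<Sum>i\<in>I. a i *\<^sub>R eb i) \<bullet> eb j = (\<Sum>i\<in>I. if i = j then a i else 0)"
    unfolding inner_sum_left
  proof (rule sum.cong)
    fix i assume "i \<in> I"
    then show "(a i *\<^sub>R eb i) \<bullet> eb j = (if i = j then a i else 0)"
      by (simp add: eb_orthonormal[OF assms(2) assms(3)])
  qed simp
  then show ?thesis using assms(1) by simp
qed

lemma norm_sum_eb:
  assumes "finite I" "\<And>i. i \<in> I \<Longrightarrow> i \<ge> 1"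
  shows "(norm (\<Sum>i\<in>I. a i *\<^sub>R eb i))\<^sup>2 = (\<Sum>i\<in>I. (a i)\<^sup>2)"
  unfolding power2_norm_eq_inner inner_sum_right
proof (rule sum.cong)
  fix j assume j: "j \<in> I"
  then show "(\<Sum>i\<in>I. a i *\<^sub>R eb i) \<bullet> a j *\<^sub>R eb j = (a j)\<^sup>2"
    by (simp add: inner_sum_eb[OF assms assms(2)] power2_eq_square)
qed simp

section \<open>Orthogonal projections and Fourier series\<close>

lemma Pn_inner_eb:
  assumes "j \<ge> 1"
  shows "Pn n u \<bullet> eb j = (if j \<le> n then u \<bullet> eb j else 0)"
  unfolding Pn_def using assms by (subst inner_sum_eb) auto

lemma norm_Pn: "(norm (Pn n u))\<^sup>2 = (\<Sum>i=1..n. (u \<bullet> eb i)\<^sup>2)"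
  unfolding Pn_def by (rule norm_sum_eb) auto

lemma Pn_inner_self: "Pn n u \<bullet> u = (norm (Pn n u))\<^sup>2"
  unfolding norm_Pn unfolding Pn_def inner_sum_left by (simp add: power2_eq_square inner_commute[of _ u])

text \<open>Cauchy-Schwarz applied to \<open>Pn n u \<bullet> u\<close>, which equals the square of
  the left-hand side.\<close>

lemma norm_Pn_le: "norm (Pn n u) \<le> norm u"
proof -
  have "norm (Pn n u) * norm (Pn n u) \<le> norm (Pn n u) * norm u"
    using norm_cauchy_schwarz[of "Pn n u" u] by (simp add: Pn_inner_self power2_eq_square)
  then show ?thesis
    by (cases "Pn n u = 0") auto
qed

lemma bounded_linear_Pn: "bounded_linear (Pn n)"
  unfolding Pn_def by (intro bounded_linear_sum bounded_linear_scaleR_const bounded_linear_inner_left)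

lemma Pn_in_Hn: "Pn n u \<in> Hn n"
  unfolding Pn_def Hn_def by (intro span_sum span_mul span_base) auto

lemma Pn_Hn:
  assumes "u \<in> Hn n"
  shows "Pn n u = u"
proof -
  interpret bounded_linear "Pn n" by (rule bounded_linear_Pn)
  have *: "Pn n (eb i) = eb i" if "i \<in> {1..n}" for i
    by (rule L2_eqI) (use that in \<open>auto simp: Pn_inner_eb eb_orthonormal\<close>)
  show ?thesis
    using assms unfolding Hn_def
    by (induction rule: span_induct_alt) (auto simp: add scale zero *)
qed

lemma summable_coeff: "summable (\<lambda>i. (u \<bullet> eb (Suc i))\<^sup>2)"
proof (rule bounded_imp_summable)
  show "(\<Sum>i\<le>n. (u \<bullet> eb (Suc i))\<^sup>2) \<le> (norm u)\<^sup>2" for n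
  proof -
    have "(\<Sum>i\<le>n. (u \<bullet> eb (Suc i))\<^sup>2) = (norm (Pn (Suc n) u))\<^sup>2"
      by (simp only: norm_Pn One_nat_def sum.atLeast1_atMost_eq lessThan_Suc_atMost)
    also have "\<dots> \<le> (norm u)\<^sup>2"
      by (intro power_mono norm_Pn_le) auto
    finally show ?thesis .
  qed
qed simp

text \<open>The Riesz-Fischer direction: by Pythagoras the squared norm of a block of the series is
  a block of the scalar series, so the Cauchy criterion carries over.\<close>

lemma summable_eb:
  assumes "summable (\<lambda>i. (a i)\<^sup>2)"
  shows "summable (\<lambda>i. a i *\<^sub>R eb (Suc i))"
  unfolding summable_Cauchy
proof (intro allI impI)
  fix e :: real assume "e > 0"
  then obtain N where N: "\<And>m n. m \<ge> N \<Longrightarrow> norm (\<Sum>i=m..<n. (a i)\<^sup>2) < e\<^sup>2"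
    using assms unfolding summable_Cauchy by (meson zero_less_power)
  have "norm (\<Sum>i=m..<n. a i *\<^sub>R eb (Suc i)) < e" if "m \<ge> N" for m n
  proof -
    have "(norm (\<Sum>i=m..<n. a i *\<^sub>R eb (Suc i)))\<^sup>2 = (norm (\<Sum>i\<in>Suc ` {m..<n}. a (i - 1) *\<^sub>R eb i))\<^sup>2"
      by (subst sum.reindex) (auto simp: o_def)
    also have "\<dots> = (\<Sum>i\<in>Suc ` {m..<n}. (a (i - 1))\<^sup>2)"
      by (rule norm_sum_eb) auto
    also have "\<dots> = (\<Sum>i=m..<n. (a i)\<^sup>2)"
      by (subst sum.reindex) (auto simp: o_def)
    also have "\<dots> < e\<^sup>2"
      using N[OF that, of n] by (simp add: sum_nonneg)
    finally show ?thesis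
      using \<open>e > 0\<close> by (simp add: power_less_imp_less_base)
  qed
  then show "\<exists>N. \<forall>m\<ge>N. \<forall>n. norm (\<Sum>i=m..<n. a i *\<^sub>R eb (Suc i)) < e" by blast
qed

lemma suminf_eb_inner:
  assumes "summable (\<lambda>i. (a i)\<^sup>2)" "j \<ge> 1"
  shows "(\<Sum>i. a i *\<^sub>R eb (Suc i)) \<bullet> eb j = a (j - 1)"
proof -
  have "(\<lambda>i. (a i *\<^sub>R eb (Suc i)) \<bullet> eb j) sums ((\<Sum>i. a i *\<^sub>R eb (Suc i)) \<bullet> eb j)"
    by (intro bounded_linear.sums[OF bounded_linear_inner_left] summable_sums summable_eb assms)
  moreover have "(\<lambda>i. (a i *\<^sub>R eb (Suc i)) \<bullet> eb j) = (\<lambda>i. if i = j - 1 then a i else 0)"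
    using assms(2) by (auto simp: eb_orthonormal fun_eq_iff)
  ultimately have "(\<lambda>i. if i = j - 1 then a i else 0) sums ((\<Sum>i. a i *\<^sub>R eb (Suc i)) \<bullet> eb j)"
    by simp
  then show ?thesis
    using sums_single[of "j - 1" a] by (rule sums_unique2)
qed

text \<open>The Fourier series converges to some vector with the same coordinates as
  \<open>u\<close>, and by completeness this vector is \<open>u\<close>.\<close>

lemma Pn_tendsto: "(\<lambda>n. Pn n u) \<longlonglongrightarrow> u"
proof -
  define v where "v = (\<Sum>i. (u \<bullet> eb (Suc i)) *\<^sub>R eb (Suc i))"
  have "v = u"
    unfolding v_def by (rule L2_eqI) (simp add: suminf_eb_inner summable_coeff)
  moreover have "(\<lambda>n. \<Sum>i<n. (u \<bullet> eb (Suc i)) *\<^sub>R eb (Suc i)) \<longlonglongrightarrow> v"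
    unfolding v_def by (intro summable_LIMSEQ summable_eb summable_coeff)
  ultimately show ?thesis
    by (simp add: Pn_def sum.atLeast1_atMost_eq)
qed

section \<open>Diagonal operators\<close>

text \<open>The Fourier multiplier with symbol \<open>a\<close>, used for bounded \<open>a\<close>.
  The semigroup and the square root of \<open>Q\<close> are both of this form.\<close>

definition diag_op :: "(nat \<Rightarrow> real) \<Rightarrow> L2 \<Rightarrow> L2" where
  "diag_op a u = (\<Sum>i. (a (Suc i) * (u \<bullet> eb (Suc i))) *\<^sub>R eb (Suc i))"

lemma summable_diag_op:
  assumes "\<And>i. i \<ge> 1 \<Longrightarrow> \<bar>a i\<bar> \<le> C"
  shows "summable (\<lambda>i. (a (Suc i) * (u \<bullet> eb (Suc i)))\<^sup>2)"
proof (rule summable_comparison_test'[where N = 0])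
  show "summable (\<lambda>i. C\<^sup>2 * (u \<bullet> eb (Suc i))\<^sup>2)"
    by (intro summable_mult summable_coeff)
  fix i :: nat
  have "\<bar>a (Suc i)\<bar>\<^sup>2 \<le> C\<^sup>2" using assms[of "Suc i"] by (intro power_mono) auto
  then show "norm ((a (Suc i) * (u \<bullet> eb (Suc i)))\<^sup>2) \<le> C\<^sup>2 * (u \<bullet> eb (Suc i))\<^sup>2"
    by (simp add: power_mult_distrib mult_right_mono)
qed

lemma diag_op_inner_eb:
  assumes "\<And>i. i \<ge> 1 \<Longrightarrow> \<bar>a i\<bar> \<le> C" "j \<ge> 1"
  shows "diag_op a u \<bullet> eb j = a j * (u \<bullet> eb j)"
  unfolding diag_op_def using assms(2)
  by (subst suminf_eb_inner[OF summable_diag_op[OF assms(1)]]) auto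

text \<open>For each projection the norm bound is a termwise comparison of finite sums of squares,
  and it survives the limit. Linearity is checked in coordinates.\<close>

lemma bounded_linear_diag_op:
  assumes a: "\<And>i. i \<ge> 1 \<Longrightarrow> \<bar>a i\<bar> \<le> C"
  shows "bounded_linear (diag_op a)" and "norm (diag_op a u) \<le> C * norm u"
proof -
  have C: "0 \<le> C" using a[of 1] by simp
  have le: "norm (diag_op a u) \<le> C * norm u" for u
  proof (rule LIMSEQ_le_const2[OF tendsto_norm[OF Pn_tendsto]], intro exI allI impI)
    fix n
    have "(norm (Pn n (diag_op a u)))\<^sup>2 \<le> (\<Sum>i=1..n. C\<^sup>2 * (u \<bullet> eb i)\<^sup>2)"
      unfolding norm_Pn
    proof (rule sum_mono)
      fix i assume i: "i \<in> {1..n}"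
      then have "\<bar>a i\<bar>\<^sup>2 \<le> C\<^sup>2" using a[of i] by (intro power_mono) auto
      then show "(diag_op a u \<bullet> eb i)\<^sup>2 \<le> C\<^sup>2 * (u \<bullet> eb i)\<^sup>2"
        using i by (simp add: diag_op_inner_eb[OF a] power_mult_distrib mult_right_mono)
    qed
    also have "\<dots> = (C * norm (Pn n u))\<^sup>2"
      by (simp add: norm_Pn power_mult_distrib sum_distrib_left)
    also have "\<dots> \<le> (C * norm u)\<^sup>2"
      using C by (intro power_mono mult_left_mono norm_Pn_le) auto
    finally show "norm (Pn n (diag_op a u)) \<le> C * norm u"
      using C by (auto intro: power2_le_imp_le)
  qed
  show "norm (diag_op a u) \<le> C * norm u" by (rule le)
  show "bounded_linear (diag_op a)"
  proof (rule bounded_linear_intro)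
    show "diag_op a (x + y) = diag_op a x + diag_op a y" for x y
      by (rule L2_eqI) (simp add: diag_op_inner_eb[OF a] inner_add_left algebra_simps)
    show "diag_op a (r *\<^sub>R x) = r *\<^sub>R diag_op a x" for r x
      by (rule L2_eqI) (simp add: diag_op_inner_eb[OF a])
    show "norm (diag_op a x) \<le> norm x * C" for x
      using le[of x] by (simp add: mult.commute)
  qed
qed

lemma lam_nonneg: "0 \<le> lam i"
  by (simp add: lam_def)

lemma exp_lam_le:
  assumes "0 \<le> t"
  shows "\<bar>exp (- lam i * t)\<bar> \<le> 1"
  using assms lam_nonneg[of i] by simp

lemma semigr_eq_diag_op: "semigr t = diag_op (\<lambda>i. exp (- lam i * t))"
  by (auto simp: semigr_def diag_op_def)

lemma semigr_inner_eb:
  assumes "0 \<le> t" "j \<ge> 1"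
  shows "semigr t u \<bullet> eb j = exp (- lam j * t) * (u \<bullet> eb j)"
  unfolding semigr_eq_diag_op by (rule diag_op_inner_eb[where C = 1]) (use assms exp_lam_le in auto)

lemma norm_semigr_le:
  assumes "0 \<le> t"
  shows "norm (semigr t u) \<le> norm u"
  using bounded_linear_diag_op(2)[of "\<lambda>i. exp (- lam i * t)" 1 u] exp_lam_le[OF assms]
  unfolding semigr_eq_diag_op by simp

section \<open>The square root of the covariance operator\<close>

text \<open>Both operators agree on every \<open>Pn n u\<close> by linearity, and these vectors
  converge to \<open>u\<close>.\<close>

lemma bounded_linear_eb_eqI:
  assumes "bounded_linear R" "bounded_linear S" "\<And>i. i \<ge> 1 \<Longrightarrow> R (eb i) = S (eb i)"
  shows "R = S"
proof
  fix u
  interpret R: bounded_linear R by fact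
  interpret S: bounded_linear S by fact
  have "R (Pn n u) = S (Pn n u)" for n
    unfolding Pn_def R.sum S.sum by (rule sum.cong) (auto simp: R.scale S.scale assms(3))
  then have "(\<lambda>n. R (Pn n u)) \<longlonglongrightarrow> S u"
    using S.tendsto[OF Pn_tendsto] by simp
  then show "R u = S u"
    by (rule LIMSEQ_unique[OF R.tendsto[OF Pn_tendsto]])
qed

text \<open>
  With \<open>r = \<surd>c\<close> the vector \<open>w = (R - r) e\<close> satisfies \<open>R w = - r w\<close>, contradicting
  positivity of \<open>R\<close> unless \<open>w = 0\<close>.
\<close>

lemma nonneg_sqrt_eigenvector:
  assumes R: "bounded_linear R" "\<And>u. 0 \<le> R u \<bullet> u" and e: "R (R e) = c *\<^sub>R e" and c: "c > 0"
  shows "R e = sqrt c *\<^sub>R (e :: 'a::real_inner)"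
proof -
  interpret R: bounded_linear R by fact
  define w where "w = R e - sqrt c *\<^sub>R e"
  have "R w = - sqrt c *\<^sub>R w"
    unfolding w_def R.diff R.scale e using c by (simp add: scaleR_diff_right)
  then have "0 \<le> - sqrt c * (norm w)\<^sup>2"
    using R(2)[of w] by (simp add: power2_norm_eq_inner)
  then have "(norm w)\<^sup>2 \<le> 0"
    using c by (simp add: mult_le_0_iff)
  then have "w = 0" by simp
  then show ?thesis by (simp add: w_def)
qed

text \<open>As \<open>op_sqrt\<close> is a definite description, the diagonal operator
  \<open>S\<close> with entries \<open>sqrt (q i)\<close> is shown to satisfy it and to be the only
  candidate. A competitor \<open>R\<close> satisfies
  \<open>R (R (eb i)) = q i *\<^sub>R eb i\<close>, and \<open>nonneg_sqrt_eigenvector\<close> then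
  fixes its value on each \<open>eb i\<close>.\<close>

lemma op_sqrt_props:
  fixes q :: "nat \<Rightarrow> real"
  assumes Q: "bounded_linear Q" and q: "\<And>i. i \<ge> 1 \<Longrightarrow> q i > 0" "\<And>i. i \<ge> 1 \<Longrightarrow> Q (eb i) = q i *\<^sub>R eb i"
  shows "bounded_linear (op_sqrt Q)"
    and "i \<ge> 1 \<Longrightarrow> op_sqrt Q u \<bullet> eb i = sqrt (q i) * (u \<bullet> eb i)"
proof -
  obtain K where K: "\<And>u. norm (Q u) \<le> norm u * K"
    using bounded_linear.bounded[OF Q] by blast
  have neb: "norm (eb i) = 1" if "i \<ge> 1" for i
    using that by (simp add: norm_eq_sqrt_inner eb_orthonormal)
  \<comment> \<open>The eigenvalue \<open>q i\<close> is the norm of \<open>Q (eb i)\<close> for a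
    unit vector, hence at most the bound \<open>K\<close> of \<open>Q\<close>.\<close>
  have bd: "\<bar>sqrt (q i)\<bar> \<le> sqrt K" if "i \<ge> 1" for i
    using K[of "eb i"] q(1)[OF that] by (simp add: q(2)[OF that] neb[OF that])
  define S where "S = diag_op (\<lambda>i. sqrt (q i))"
  note S = bounded_linear_diag_op[OF bd]
  have Si: "S u \<bullet> eb i = sqrt (q i) * (u \<bullet> eb i)" if "i \<ge> 1" for i u
    unfolding S_def by (rule diag_op_inner_eb[OF bd that])
  have Seb: "S (eb i) = sqrt (q i) *\<^sub>R eb i" if "i \<ge> 1" for i
    by (rule L2_eqI) (use that in \<open>auto simp: Si eb_orthonormal\<close>)
  have blS: "bounded_linear S" unfolding S_def by (rule S(1))
  \<comment> \<open>The sums are symmetric in \<open>u\<close> and \<open>v\<close> and nonnegative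
    for u = v, so this limit gives both self-adjointness and nonnegativity of
    \<open>S\<close>.\<close>
  have inner_S: "(\<lambda>n. \<Sum>i=1..n. sqrt (q i) * (u \<bullet> eb i) * (v \<bullet> eb i)) \<longlonglongrightarrow> S u \<bullet> v" for u v
  proof -
    have "(\<lambda>n. Pn n (S u) \<bullet> v) \<longlonglongrightarrow> S u \<bullet> v"
      by (intro tendsto_inner Pn_tendsto tendsto_const)
    moreover have "(\<lambda>n. Pn n (S u) \<bullet> v) = (\<lambda>n. \<Sum>i=1..n. sqrt (q i) * (u \<bullet> eb i) * (v \<bullet> eb i))"
      unfolding Pn_def inner_sum_left by (auto simp: Si inner_commute[of v] intro!: sum.cong)
    ultimately show ?thesis by simp
  qed
  have "op_sqrt Q = S"
    unfolding op_sqrt_def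
  proof (rule the_equality)
    have "S u \<bullet> v = u \<bullet> S v" for u v
    proof -
      have "S u \<bullet> v = S v \<bullet> u"
      proof (rule LIMSEQ_unique[OF inner_S])
        show "(\<lambda>n. \<Sum>i=1..n. sqrt (q i) * (u \<bullet> eb i) * (v \<bullet> eb i)) \<longlonglongrightarrow> S v \<bullet> u"
          using inner_S[of v u] by (simp only: mult.assoc mult.commute[of "v \<bullet> _"])
      qed
      then show ?thesis by (simp add: inner_commute)
    qed
    moreover have "0 \<le> S u \<bullet> u" for u
    proof (rule LIMSEQ_le_const[OF inner_S], intro exI allI impI sum_nonneg)
      fix n i :: nat assume "i \<in> {1..n}"
      then have "0 \<le> sqrt (q i) * (u \<bullet> eb i)\<^sup>2" using q(1)[of i] by (intro mult_nonneg_nonneg) auto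
      then show "0 \<le> sqrt (q i) * (u \<bullet> eb i) * (u \<bullet> eb i)" by (simp add: power2_eq_square mult.assoc)
    qed
    moreover have "S \<circ> S = Q"
    proof (rule bounded_linear_eb_eqI[OF _ Q])
      show "bounded_linear (S \<circ> S)"
        using bounded_linear_compose[OF blS blS] by (simp add: o_def)
      show "(S \<circ> S) (eb i) = Q (eb i)" if "i \<ge> 1" for i
        using q(1)[OF that] by (simp add: Seb[OF that] q(2)[OF that] linear_simps[OF blS])
    qed
    ultimately show "bounded_linear S \<and> self_adjoint S \<and> (\<forall>u. 0 \<le> S u \<bullet> u) \<and> S \<circ> S = Q"
      using blS by (simp add: self_adjoint_def)
  next
    fix R assume R: "bounded_linear R \<and> self_adjoint R \<and> (\<forall>u. 0 \<le> R u \<bullet> u) \<and> R \<circ> R = Q"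
    show "R = S"
    proof (rule bounded_linear_eb_eqI[OF _ blS])
      show "R (eb i) = S (eb i)" if i: "i \<ge> 1" for i
      proof -
        have "R (R (eb i)) = q i *\<^sub>R eb i"
          using R q(2)[OF i] by (metis comp_apply)
        then show ?thesis
          using R q(1)[OF i] nonneg_sqrt_eigenvector[of R "eb i" "q i"] by (simp add: Seb[OF i])
      qed
    qed (use R in blast)
  qed
  then show "bounded_linear (op_sqrt Q)" "i \<ge> 1 \<Longrightarrow> op_sqrt Q u \<bullet> eb i = sqrt (q i) * (u \<bullet> eb i)"
    using blS Si by simp_all
qed

section \<open>Test functions and the Dirichlet Laplacian\<close>

text \<open>The classical smooth function exp (-d/y), extended by zero, times the power of 1/y with
  exponent \<open>k\<close>. The extra powers make the family closed under differentiation up to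
  linear combinations.\<close>

definition flat :: "nat \<Rightarrow> real \<Rightarrow> real \<Rightarrow> real" where
  "flat k d y = (if y > 0 then exp (- d * inverse y) * inverse y ^ k else 0)"

lemma flat_nonneg: "0 \<le> flat k d y"
  by (simp add: flat_def)

text \<open>With n = k + 2 and v = d/y, the inequality \<open>(1 + v / n) ^ n \<le> exp v\<close>
  bounds exp (-d/y) by \<open>(n * y / d) ^ n\<close>. The negative power of \<open>y\<close> in
  \<open>flat\<close> consumes \<open>k\<close> of the \<open>k + 2\<close> factors, and the
  remaining square is what differentiability at 0 requires.\<close>

lemma flat_le_square:
  assumes "d > 0"
  shows "flat k d y \<le> (real (k + 2) / d) ^ (k + 2) * y\<^sup>2"
proof (cases "y > 0")
  case True
  define n where "n = k + 2"
  have n: "n > 0" "n = k + 2" by (auto simp: n_def)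
  define u where "u = d * inverse y / n"
  have "u ^ n \<le> (1 + d * inverse y / real n) ^ n"
    using True assms by (intro power_mono) (auto simp: u_def)
  also have "\<dots> \<le> exp (d * inverse y)"
    using True assms n by (intro exp_ge_one_plus_x_over_n_power_n) (auto intro: order_trans[of _ 0])
  finally have "u ^ n * exp (- d * inverse y) \<le> exp (d * inverse y) * exp (- d * inverse y)"
    by (intro mult_right_mono) auto
  then have *: "u ^ n * exp (- d * inverse y) \<le> 1"
    by (simp add: exp_add[symmetric])
  have "flat k d y = (real n / d) ^ n * y\<^sup>2 * (u ^ n * exp (- d * inverse y))"
  proof -
    have "real n / d * u = inverse y"
      using n assms by (simp add: u_def)
    then have "(real n / d) ^ n * u ^ n = inverse y ^ n"
      by (metis power_mult_distrib)
    then have "(real n / d) ^ n * u ^ n = inverse y ^ k * (inverse y)\<^sup>2"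
      by (simp only: n(2) power_add)
    moreover have "(inverse y)\<^sup>2 * y\<^sup>2 = 1"
      using True by (simp add: power_mult_distrib[symmetric])
    ultimately have "(real n / d) ^ n * u ^ n * y\<^sup>2 = inverse y ^ k"
      by (simp add: mult.assoc)
    then show ?thesis
      using True by (simp add: flat_def mult_ac)
  qed
  also have "\<dots> \<le> (real n / d) ^ n * y\<^sup>2 * 1"
    using * assms by (intro mult_left_mono) auto
  finally show ?thesis by (simp add: n_def)
qed (use assms in \<open>auto simp: flat_def\<close>)

text \<open>Away from 0 the function coincides locally with an elementary one. At 0 the quadratic
  bound makes the difference quotient at most \<open>C * \<bar>h\<bar>\<close>.\<close>

lemma DERIV_flat:
  assumes d: "d > 0"
  shows "(flat k d has_real_derivative d * flat (k + 2) d y - real k * flat (k + 1) d y) (at y)"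
proof (cases y "0 :: real" rule: linorder_cases)
  case less
  have "(flat k d has_real_derivative 0) (at y) \<longleftrightarrow> ((\<lambda>_. 0) has_real_derivative 0) (at y)"
    by (rule DERIV_cong_ev) (use less eventually_nhds_in_open[of "{..<0}" y] in \<open>auto elim!: eventually_mono simp: flat_def\<close>)
  then show ?thesis using less by (simp add: flat_def)
next
  case equal
  define C where "C = (real (k + 2) / d) ^ (k + 2)"
  have "((\<lambda>h. flat k d h / h) \<longlongrightarrow> 0) (at 0)"
  proof (rule Lim_null_comparison)
    show "((\<lambda>h. C * \<bar>h\<bar>) \<longlongrightarrow> 0) (at 0)"
      by (auto intro!: tendsto_eq_intros)
    show "\<forall>\<^sub>F h in at 0. norm (flat k d h / h) \<le> C * \<bar>h\<bar>"
    proof (rule always_eventually, rule allI)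
      fix h
      show "norm (flat k d h / h) \<le> C * \<bar>h\<bar>"
      proof (cases "h = 0")
        case False
        have "norm (flat k d h / h) = flat k d h / \<bar>h\<bar>"
          using flat_nonneg[of k d h] by simp
        also have "\<dots> \<le> C * h\<^sup>2 / \<bar>h\<bar>"
          unfolding C_def by (intro divide_right_mono flat_le_square d) simp
        also have "\<dots> = C * \<bar>h\<bar>"
          using False nonzero_mult_div_cancel_right[of "\<bar>h\<bar>" "C * \<bar>h\<bar>"]
          by (simp add: power2_eq_square mult.assoc)
        finally show ?thesis .
      qed simp
    qed
  qed
  then have "(flat k d has_real_derivative 0) (at 0)"
    by (simp add: DERIV_def flat_def)
  then show ?thesis using equal by (simp add: flat_def)
next
  case greater
  let ?f = "\<lambda>y. exp (- d * inverse y) * inverse y ^ k"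
  have "(flat k d has_real_derivative D) (at y) \<longleftrightarrow> (?f has_real_derivative D) (at y)" for D
    by (rule DERIV_cong_ev) (use greater eventually_nhds_in_open[of "{0<..}" y] in \<open>auto elim!: eventually_mono simp: flat_def\<close>)
  moreover have "(?f has_real_derivative d * flat (k + 2) d y - real k * flat (k + 1) d y) (at y)"
  proof -
    have i: "(inverse has_real_derivative - (inverse y)\<^sup>2) (at y)"
      using DERIV_inverse[of y UNIV] greater by (simp add: numeral_2_eq_2)
    have "((\<lambda>y. inverse y ^ k) has_real_derivative - real k * inverse y ^ (k + 1)) (at y)"
      using DERIV_power[OF i, of k] by (cases k) (simp_all add: power2_eq_square algebra_simps)
    moreover have "((\<lambda>y. exp (- d * inverse y)) has_real_derivative
        exp (- d * inverse y) * (- d * - (inverse y)\<^sup>2)) (at y)"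
      by (rule DERIV_chain2[OF DERIV_exp DERIV_cmult[OF i]])
    ultimately show ?thesis
      using greater by (auto dest: DERIV_mult simp: flat_def power2_eq_square algebra_simps)
  qed
  ultimately show ?thesis by simp
qed

text \<open>A smooth bump vanishing outside [d, 1 - d]. The parameter serves both as margin and as
  factor in the exponent, so that the single limit d \<rightarrow> 0 makes the bump converge to 1 at
  every interior point.\<close>

definition cutoff :: "real \<Rightarrow> real \<Rightarrow> real" where
  "cutoff d x = flat 0 d (x * (1 - x) - d)"

text \<open>A syntactic class closed under differentiation. Membership yields derivatives of all
  orders, as \<open>test_fun\<close> demands, without computing them.\<close>

inductive smooth_gen :: "(real \<Rightarrow> real) \<Rightarrow> bool" where
  const: "smooth_gen (\<lambda>x. c)"
| ident: "smooth_gen (\<lambda>x. x)"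
| sin: "smooth_gen (\<lambda>x. sin (c * x))"
| cos: "smooth_gen (\<lambda>x. cos (c * x))"
| flat: "d > 0 \<Longrightarrow> smooth_gen (\<lambda>x. flat k d (x * (1 - x) - d))"
| add: "smooth_gen f \<Longrightarrow> smooth_gen g \<Longrightarrow> smooth_gen (\<lambda>x. f x + g x)"
| mult: "smooth_gen f \<Longrightarrow> smooth_gen g \<Longrightarrow> smooth_gen (\<lambda>x. f x * g x)"

lemma smooth_gen_deriv:
  assumes "smooth_gen f"
  shows "\<exists>g. smooth_gen g \<and> (\<forall>x. (f has_real_derivative g x) (at x))"
  using assms
proof induction
  case (const c)
  show ?case by (rule exI[of _ "\<lambda>_. 0"]) (auto intro: smooth_gen.intros)
next
  case ident
  show ?case by (rule exI[of _ "\<lambda>_. 1"]) (auto intro: smooth_gen.intros)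
next
  case (sin c)
  show ?case
    by (rule exI[of _ "\<lambda>x. c * cos (c * x)"])
      (auto intro!: smooth_gen.intros derivative_eq_intros)
next
  case (cos c)
  show ?case
    by (rule exI[of _ "\<lambda>x. - c * sin (c * x)"])
      (intro conjI allI smooth_gen.intros, auto intro!: derivative_eq_intros)
next
  case (flat d k)
  let ?b = "\<lambda>x. x * (1 - x) - d"
  let ?g = "\<lambda>x. (d * flat (k + 2) d (?b x) + (- real k) * flat (k + 1) d (?b x)) * (1 + (- 2) * x)"
  have "smooth_gen ?g"
    using flat by (intro smooth_gen.intros)
  moreover have "((\<lambda>x. flat k d (?b x)) has_real_derivative ?g x) (at x)" for x
  proof -
    have "(?b has_real_derivative (1 + (- 2) * x)) (at x)"
      by (auto intro!: derivative_eq_intros)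
    from DERIV_chain2[OF DERIV_flat[OF flat] this] show ?thesis by simp
  qed
  ultimately show ?case by blast
next
  case (add f g)
  then obtain f' g' where "smooth_gen f'" "\<forall>x. (f has_real_derivative f' x) (at x)"
    "smooth_gen g'" "\<forall>x. (g has_real_derivative g' x) (at x)" by blast
  then show ?case
    by (intro exI[of _ "\<lambda>x. f' x + g' x"]) (auto intro: smooth_gen.intros derivative_intros)
next
  case (mult f g)
  then obtain f' g' where "smooth_gen f'" "\<forall>x. (f has_real_derivative f' x) (at x)"
    "smooth_gen g'" "\<forall>x. (g has_real_derivative g' x) (at x)" by blast
  with mult.hyps show ?case
    by (intro exI[of _ "\<lambda>x. f' x * g x + g' x * f x"])
      (auto intro!: smooth_gen.intros derivative_intros DERIV_mult)
qed

lemma smooth_gen_DERIV: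
  assumes "smooth_gen f"
  shows "smooth_gen (deriv f)" "(f has_real_derivative deriv f x) (at x)"
proof -
  obtain g where g: "smooth_gen g" "\<And>x. (f has_real_derivative g x) (at x)"
    using smooth_gen_deriv[OF assms] by blast
  then have "deriv f = g"
    by (intro ext DERIV_imp_deriv)
  with g show "smooth_gen (deriv f)" "(f has_real_derivative deriv f x) (at x)" by auto
qed

lemma smooth_gen_continuous: "smooth_gen f \<Longrightarrow> continuous_on S f"
  using smooth_gen_DERIV(2) by (meson DERIV_continuous_on has_field_derivative_at_within)

lemma test_fun_cutoff:
  assumes d: "d > 0" and G: "smooth_gen G"
  shows "test_fun (\<lambda>x. cutoff d x * G x)"
proof -
  define f where "f = (\<lambda>x. cutoff d x * G x)"
  have "smooth_gen f"
    unfolding f_def cutoff_def by (intro smooth_gen.intros d G)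
  then have "smooth_gen ((deriv ^^ k) f)" for k
    by (induction k) (auto intro: smooth_gen_DERIV)
  then have "(deriv ^^ k) f differentiable at x" for k x
    using smooth_gen_DERIV(2) real_differentiable_def by blast
  moreover have "\<exists>a b. 0 < a \<and> b < 1 \<and> (\<forall>x. x \<notin> {a..b} \<longrightarrow> f x = 0)"
  proof (rule exI[of _ d], rule exI[of _ "1 - d"], intro conjI allI impI)
    fix x assume x: "x \<notin> {d..1 - d}"
    \<comment> \<open>Inside the unit interval the parabola lies below both x and 1 - x; outside it
      is nonpositive. Hence \<open>cutoff\<close> vanishes wherever x < d or x > 1 - d.\<close>
    have "x * (1 - x) \<le> d"
    proof (cases "0 < x \<and> x < 1")
      case True
      then have "x * (1 - x) \<le> x * 1" "x * (1 - x) \<le> 1 * (1 - x)"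
        by (intro mult_mono; simp)+
      then show ?thesis using x by auto
    next
      case False
      then have "x * (1 - x) \<le> 0" by (auto simp: mult_le_0_iff)
      then show ?thesis using d by simp
    qed
    then show "f x = 0" by (simp add: f_def cutoff_def flat_def)
  qed (use d in auto)
  ultimately show ?thesis
    unfolding test_fun_def f_def[symmetric] by blast
qed

lemma cutoff_bounds: "d > 0 \<Longrightarrow> 0 \<le> cutoff d x \<and> cutoff d x \<le> 1"
  by (simp add: cutoff_def flat_def)

abbreviation (input) dseq :: "nat \<Rightarrow> real" where
  "dseq n \<equiv> inverse (real (Suc n))"

text \<open>The exponent tends to 0 and only the power remains. The case k = 0 is convergence of the
  cut-off to 1; the case k = 2 serves for its derivative.\<close>

lemma flat_tendsto:
  assumes "x \<in> {0<..<1}"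
  shows "(\<lambda>n. flat k (dseq n) (x * (1 - x) - dseq n)) \<longlonglongrightarrow> inverse (x * (1 - x)) ^ k"
proof -
  define b where "b = x * (1 - x)"
  have b: "b > 0" using assms by (simp add: b_def)
  have ev: "\<forall>\<^sub>F n in sequentially. dseq n < b"
    using b LIMSEQ_inverse_real_of_nat by (rule order_tendstoD(2)[rotated])
  have "(\<lambda>n. exp (- dseq n * inverse (b - dseq n)) * inverse (b - dseq n) ^ k) \<longlonglongrightarrow> exp (- 0 * inverse (b - 0)) * inverse (b - 0) ^ k"
    using b by (intro tendsto_intros LIMSEQ_inverse_real_of_nat) auto
  then have "(\<lambda>n. flat k (dseq n) (b - dseq n)) \<longlonglongrightarrow> exp (- 0 * inverse (b - 0)) * inverse (b - 0) ^ k"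
    by (rule Lim_transform_eventually) (use ev in \<open>eventually_elim, simp add: flat_def\<close>)
  then show ?thesis by (simp add: b_def)
qed

text \<open>The cut-off has values in [0,1], so \<open>\<bar>G x\<bar>\<close> is a majorant for
  dominated convergence.\<close>

lemma cutoff_mult_tendsto:
  assumes G: "smooth_gen G"
  shows "(\<lambda>n. mk_L2 (\<lambda>x. cutoff (dseq n) x * G x)) \<longlonglongrightarrow> mk_L2 G"
proof (rule mk_L2_dominated_convergence)
  show "sq_int (\<lambda>x. \<bar>G x\<bar>)"
    by (intro sq_int_continuous continuous_intros smooth_gen_continuous G)
  show "G \<in> borel_measurable leb01"
    by (intro continuous_measurable_leb01 smooth_gen_continuous G)
  show "(\<lambda>x. cutoff (dseq n) x * G x) \<in> borel_measurable leb01" for n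
    unfolding cutoff_def
    by (intro continuous_measurable_leb01 smooth_gen_continuous smooth_gen.intros G) simp
  show "AE x in leb01. \<bar>cutoff (dseq n) x * G x\<bar> \<le> \<bar>G x\<bar>" for n
    using cutoff_bounds[of "dseq n"] by (intro AE_I2) (auto simp: abs_mult intro!: mult_left_le_one_le)
  show "AE x in leb01. (\<lambda>n. cutoff (dseq n) x * G x) \<longlonglongrightarrow> G x"
  proof (rule AE_I2)
    fix x assume "x \<in> space leb01"
    then have "x \<in> {0<..<1}" by simp
    from flat_tendsto[OF this, of 0] have "(\<lambda>n. cutoff (dseq n) x * G x) \<longlonglongrightarrow> 1 * G x"
      unfolding cutoff_def by (intro tendsto_intros) simp
    then show "(\<lambda>n. cutoff (dseq n) x * G x) \<longlonglongrightarrow> G x" by simp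
  qed
qed

text \<open>Monomials multiplied by the cut-off are test functions and converge to the
  monomials.\<close>

lemma L2_eq_0_if_orthogonal_test_fun:
  assumes w: "\<And>\<phi>. test_fun \<phi> \<Longrightarrow> w \<bullet> mk_L2 \<phi> = 0"
  shows "w = 0"
proof (rule L2_eq_0_if_orthogonal_monomials)
  fix k :: nat
  have G: "smooth_gen (\<lambda>x. x ^ k)"
    by (induction k) (auto intro: smooth_gen.intros)
  have "(\<lambda>n. w \<bullet> mk_L2 (\<lambda>x. cutoff (dseq n) x * x ^ k)) \<longlonglongrightarrow> w \<bullet> mk_L2 (\<lambda>x. x ^ k)"
    by (intro tendsto_intros cutoff_mult_tendsto G)
  moreover have "w \<bullet> mk_L2 (\<lambda>x. cutoff (dseq n) x * x ^ k) = 0" for n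
    by (intro w test_fun_cutoff G) simp
  ultimately show "w \<bullet> mk_L2 (\<lambda>x. x ^ k) = 0"
    by (simp add: LIMSEQ_const_iff)
qed

section \<open>Weak derivatives and integration by parts\<close>

lemma weak_deriv_unique:
  assumes "weak_deriv u v" "weak_deriv u v'"
  shows "v = v'"
proof -
  have "(v - v') \<bullet> mk_L2 \<phi> = 0" if "test_fun \<phi>" for \<phi>
    using assms that by (simp add: weak_deriv_def inner_diff_left)
  from L2_eq_0_if_orthogonal_test_fun[OF this] show ?thesis by simp
qed

lemma op_A_eqI:
  assumes "weak_deriv u v" "weak_deriv v w"
  shows "op_A u = w"
  unfolding op_A_def using assms weak_deriv_unique by (intro the_equality) blast+

lemma test_fun_DERIV:
  assumes "test_fun \<phi>"
  shows "(\<phi> has_real_derivative deriv \<phi> x) (at x)" "continuous_on S \<phi>" "continuous_on S (deriv \<phi>)"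
    "\<phi> 0 = 0" "\<phi> 1 = 0"
proof -
  have "(deriv ^^ k) \<phi> differentiable at x" for k x
    using assms by (simp add: test_fun_def)
  from this[of 0] this[of 1] have "\<phi> differentiable at x" "deriv \<phi> differentiable at x" for x
    by simp_all
  then show "(\<phi> has_real_derivative deriv \<phi> x) (at x)" "continuous_on S \<phi>" "continuous_on S (deriv \<phi>)"
    by (auto simp: DERIV_deriv_iff_real_differentiable differentiable_at_withinI
        intro!: differentiable_imp_continuous_on differentiable_at_imp_differentiable_on)
  show "\<phi> 0 = 0" "\<phi> 1 = 0"
    using assms by (auto simp: test_fun_def)
qed

text \<open>Integration by parts; the boundary terms vanish through the test function alone, which
  lets \<open>g\<close> be a cosine with nonzero boundary values.\<close>

lemma weak_deriv_mk_L2: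
  assumes g: "\<And>x. (g has_real_derivative g' x) (at x)" and g': "continuous_on {0..1} g'"
  shows "weak_deriv (mk_L2 g) (mk_L2 g')"
  unfolding weak_deriv_def
proof (intro allI impI)
  fix \<phi> assume \<phi>: "test_fun \<phi>"
  note D = test_fun_DERIV[OF \<phi>]
  have cg: "continuous_on {0..1} g"
    using g by (meson DERIV_continuous_on has_field_derivative_at_within)
  have sq: "sq_int g" "sq_int g'" "sq_int \<phi>" "sq_int (deriv \<phi>)"
    by (intro sq_int_continuous cg g' D)+
  have "(\<integral>x. g x * deriv \<phi> x + g' x * \<phi> x \<partial>leb01) = g 1 * \<phi> 1 - g 0 * \<phi> 0"
  proof (rule integral_leb01_FTC)
    show "continuous_on {0..1} (\<lambda>x. g x * deriv \<phi> x + g' x * \<phi> x)"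
      by (intro continuous_intros cg g' D)
    show "((\<lambda>x. g x * \<phi> x) has_real_derivative g x * deriv \<phi> x + g' x * \<phi> x) (at x within {0..1})" for x
      using DERIV_mult'[OF g D(1)] by (rule has_field_derivative_at_within)
  qed
  then have "mk_L2 g \<bullet> mk_L2 (deriv \<phi>) + mk_L2 g' \<bullet> mk_L2 \<phi> = 0"
    using sq D(4,5) by (simp add: inner_mk_L2 sq_int_mult)
  then show "mk_L2 g \<bullet> mk_L2 (deriv \<phi>) = - (mk_L2 g' \<bullet> mk_L2 \<phi>)" by simp
qed

section \<open>The sines as eigenfunctions in the weak sense\<close>

definition eb_deriv :: "nat \<Rightarrow> real \<Rightarrow> real" where
  "eb_deriv i \<xi> = sqrt 2 * (real i * pi) * cos (real i * pi * \<xi>)"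

lemma weak_deriv_eb:
  "weak_deriv (eb i) (mk_L2 (eb_deriv i))" "weak_deriv (mk_L2 (eb_deriv i)) (- lam i *\<^sub>R eb i)"
proof -
  show "weak_deriv (eb i) (mk_L2 (eb_deriv i))"
    unfolding eb_def eb_deriv_def
    by (rule weak_deriv_mk_L2) (auto intro!: derivative_eq_intros continuous_intros)
  have "- lam i *\<^sub>R eb i = mk_L2 (\<lambda>\<xi>. - lam i * (sqrt 2 * sin (real i * pi * \<xi>)))"
    unfolding eb_def by (rule mk_L2_scaleR[OF sq_int_eb])
  then show "weak_deriv (mk_L2 (eb_deriv i)) (- lam i *\<^sub>R eb i)"
    unfolding eb_deriv_def [abs_def]
    by (simp only:) (rule weak_deriv_mk_L2,
      auto intro!: derivative_eq_intros continuous_intros simp: lam_def power2_eq_square)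
qed

lemma weak_deriv_sum:
  assumes "\<And>i. i \<in> I \<Longrightarrow> weak_deriv (u i) (v i)"
  shows "weak_deriv (\<Sum>i\<in>I. c i *\<^sub>R u i) (\<Sum>i\<in>I. c i *\<^sub>R v i)"
  using assms by (auto simp: weak_deriv_def inner_sum_left sum_negf[symmetric] intro!: sum.cong)

lemma op_A_sum_eb: "op_A (\<Sum>i\<in>I. c i *\<^sub>R eb i) = (\<Sum>i\<in>I. (- lam i * c i) *\<^sub>R eb i)"
proof -
  have "op_A (\<Sum>i\<in>I. c i *\<^sub>R eb i) = (\<Sum>i\<in>I. c i *\<^sub>R (- lam i *\<^sub>R eb i))"
    by (rule op_A_eqI[OF weak_deriv_sum weak_deriv_sum]) (rule weak_deriv_eb)+
  then show ?thesis by (simp add: mult.commute)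
qed

text \<open>The sine is bounded by its argument, and by reflection also with 1 - \<xi> in place of
  \<xi>; the smaller of the two is at most 2\<xi>(1 - \<xi>). This decay at the boundary will
  compensate the growth of the derivative of the cut-off.\<close>

lemma sin_le_parabola:
  assumes "\<xi> \<in> {0..1}"
  shows "\<bar>sin (real i * pi * \<xi>)\<bar> \<le> 2 * (real i * pi) * (\<xi> * (1 - \<xi>))"
proof -
  have "\<bar>sin (real i * pi * (1 - \<xi>))\<bar> = \<bar>sin (real i * pi * \<xi>)\<bar>"
    by (simp add: right_diff_distrib sin_diff abs_mult)
  then have "\<bar>sin (real i * pi * \<xi>)\<bar> \<le> real i * pi * \<xi>" "\<bar>sin (real i * pi * \<xi>)\<bar> \<le> real i * pi * (1 - \<xi>)"
    using abs_sin_x_le_abs_x[of "real i * pi * \<xi>"] abs_sin_x_le_abs_x[of "real i * pi * (1 - \<xi>)"] assms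
    by auto
  moreover have "\<xi> \<le> 2 * (\<xi> * (1 - \<xi>)) \<or> 1 - \<xi> \<le> 2 * (\<xi> * (1 - \<xi>))"
  proof (cases "\<xi> \<le> 1/2")
    case True
    then have "\<xi> * 1 \<le> \<xi> * (2 * (1 - \<xi>))" using assms by (intro mult_left_mono) auto
    then show ?thesis by (intro disjI1) (simp add: algebra_simps)
  next
    case False
    then have "1 * (1 - \<xi>) \<le> (2 * \<xi>) * (1 - \<xi>)" using assms by (intro mult_right_mono) auto
    then show ?thesis by (intro disjI2) (simp add: algebra_simps)
  qed
  then have "real i * pi * \<xi> \<le> real i * pi * (2 * (\<xi> * (1 - \<xi>))) \<or>
      real i * pi * (1 - \<xi>) \<le> real i * pi * (2 * (\<xi> * (1 - \<xi>)))"
    by (auto intro: mult_left_mono)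
  ultimately have "\<bar>sin (real i * pi * \<xi>)\<bar> \<le> real i * pi * (2 * (\<xi> * (1 - \<xi>)))"
    by linarith
  then show ?thesis by (simp add: mult_ac)
qed

text \<open>With \<open>w = d / (b - d)\<close> the left-hand side is \<open>w (1 + w) e\<^bsup>-w\<^esup>\<close>.\<close>

lemma flat_deriv_bound:
  assumes "d > 0"
  shows "d * flat 2 d (b - d) * b \<le> 2"
proof (cases "b > d")
  case True
  define w where "w = d * inverse (b - d)"
  have w: "w > 0" using True assms by (simp add: w_def)
  have "d * flat 2 d (b - d) * b = (w * (1 + w)) * exp (- w)"
    using True by (simp add: flat_def w_def field_simps power2_eq_square)
  also have "\<dots> \<le> (2 * (1 + w + w\<^sup>2 / 2)) * exp (- w)"
    using w by (intro mult_right_mono) (auto simp: algebra_simps power2_eq_square)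
  also have "\<dots> \<le> (2 * exp w) * exp (- w)"
    using w exp_lower_Taylor_quadratic[of w] by (intro mult_right_mono mult_left_mono) auto
  also have "\<dots> = 2" by (simp add: exp_minus)
  finally show ?thesis .
qed (simp add: flat_def)

text \<open>The sines lie in the closure of the test functions in the first order Sobolev norm. The
  cut-off sines work: the derivative falling on the sine converges as before, and the derivative
  falling on the cut-off is harmless because the sine vanishes at the boundary.\<close>

lemma eb_test_fun_approx:
  obtains \<psi> where "\<And>n. test_fun (\<psi> n)"
    "(\<lambda>n. mk_L2 (\<psi> n)) \<longlonglongrightarrow> eb i" "(\<lambda>n. mk_L2 (deriv (\<psi> n))) \<longlonglongrightarrow> mk_L2 (eb_deriv i)"
proof -
  define g where "g \<xi> = sqrt 2 * sin (real i * pi * \<xi>)" for \<xi>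
  have g: "smooth_gen g"
    unfolding g_def by (intro smooth_gen.intros)
  have dg: "(g has_real_derivative eb_deriv i \<xi>) (at \<xi>)" for \<xi>
    unfolding g_def eb_deriv_def by (auto intro!: derivative_eq_intros)
  have g': "smooth_gen (eb_deriv i)"
    unfolding eb_deriv_def by (intro smooth_gen.intros)
  define \<psi> where "\<psi> n \<xi> = cutoff (dseq n) \<xi> * g \<xi>" for n \<xi>
  \<comment> \<open>The part of the product rule in which the cut-off is differentiated. With b =
    \<xi>(1 - \<xi>), the derivative of the cut-off is at most 2/b in modulus while the sine is at
    most C b, so \<open>h\<close> is bounded by 2 C; the factor \<open>dseq n\<close> sends it to 0
    pointwise.\<close>
  define h where "h n \<xi> = dseq n * flat 2 (dseq n) (\<xi> * (1 - \<xi>) - dseq n) * (1 + (- 2) * \<xi>) * g \<xi>" for n \<xi>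
  have h: "smooth_gen (h n)" for n
    unfolding h_def by (intro smooth_gen.intros g) simp
  have sc: "smooth_gen (\<lambda>\<xi>. cutoff (dseq n) \<xi> * eb_deriv i \<xi>)" for n
    unfolding cutoff_def by (intro smooth_gen.intros g') simp
  have d\<psi>: "deriv (\<psi> n) = (\<lambda>\<xi>. h n \<xi> + cutoff (dseq n) \<xi> * eb_deriv i \<xi>)" for n
  proof (intro ext DERIV_imp_deriv)
    fix \<xi>
    have "((\<lambda>\<xi>. \<xi> * (1 - \<xi>) - dseq n) has_real_derivative (1 + (- 2) * \<xi>)) (at \<xi>)"
      by (auto intro!: derivative_eq_intros)
    moreover have "0 < dseq n" by simp
    note DERIV_flat[OF this, of 0]
    ultimately have "((\<lambda>\<xi>. flat 0 (dseq n) (\<xi> * (1 - \<xi>) - dseq n)) has_real_derivative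
        dseq n * flat 2 (dseq n) (\<xi> * (1 - \<xi>) - dseq n) * (1 + (- 2) * \<xi>)) (at \<xi>)"
      by (auto dest: DERIV_chain2 simp: numeral_2_eq_2)
    from DERIV_mult[OF this dg]
    show "(\<psi> n has_real_derivative h n \<xi> + cutoff (dseq n) \<xi> * eb_deriv i \<xi>) (at \<xi>)"
      unfolding \<psi>_def cutoff_def h_def by (simp add: mult.assoc mult.commute)
  qed
  have h0: "(\<lambda>n. mk_L2 (h n)) \<longlonglongrightarrow> mk_L2 (\<lambda>_. 0)"
  proof (rule mk_L2_dominated_convergence)
    define C where "C = sqrt 2 * (2 * (real i * pi))"
    have gC: "\<bar>g \<xi>\<bar> \<le> C * (\<xi> * (1 - \<xi>))" if "\<xi> \<in> {0<..<1}" for \<xi>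
    proof -
      have "sqrt 2 * \<bar>sin (real i * pi * \<xi>)\<bar> \<le> sqrt 2 * (2 * (real i * pi) * (\<xi> * (1 - \<xi>)))"
        using that by (intro mult_left_mono sin_le_parabola) auto
      then show ?thesis by (simp add: g_def C_def abs_mult mult.assoc)
    qed
    have C: "0 \<le> C" by (simp add: C_def)
    show "sq_int (\<lambda>_. 2 * C)" by (rule sq_int_const)
    show "AE \<xi> in leb01. \<bar>h n \<xi>\<bar> \<le> 2 * C" for n
    proof (rule AE_I2)
      fix \<xi> assume "\<xi> \<in> space leb01"
      then have x: "\<xi> \<in> {0<..<1}" by simp
      let ?f = "dseq n * flat 2 (dseq n) (\<xi> * (1 - \<xi>) - dseq n)"
      have f: "0 \<le> ?f" using flat_nonneg by (intro mult_nonneg_nonneg) auto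
      have "h n \<xi> = ?f * ((1 + (- 2) * \<xi>) * g \<xi>)"
        by (simp only: h_def mult.assoc)
      then have "\<bar>h n \<xi>\<bar> = ?f * (\<bar>1 + (- 2) * \<xi>\<bar> * \<bar>g \<xi>\<bar>)"
        by (simp only: abs_mult[of ?f] abs_of_nonneg[OF f]) (simp only: abs_mult)
      also have "\<dots> \<le> ?f * (1 * (C * (\<xi> * (1 - \<xi>))))"
        using x f C gC[OF x] by (intro mult_left_mono mult_mono) auto
      also have "\<dots> = C * (?f * (\<xi> * (1 - \<xi>)))" by simp
      also have "\<dots> \<le> C * 2"
        using C by (intro mult_left_mono flat_deriv_bound) auto
      finally show "\<bar>h n \<xi>\<bar> \<le> 2 * C" by simp
    qed
    show "AE \<xi> in leb01. (\<lambda>n. h n \<xi>) \<longlonglongrightarrow> 0"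
    proof (rule AE_I2)
      fix \<xi> assume "\<xi> \<in> space leb01"
      then have "\<xi> \<in> {0<..<1}" by simp
      from flat_tendsto[OF this, of 2]
      have "(\<lambda>n. h n \<xi>) \<longlonglongrightarrow> 0 * inverse (\<xi> * (1 - \<xi>)) ^ 2 * (1 + (- 2) * \<xi>) * g \<xi>"
        unfolding h_def by (intro tendsto_intros LIMSEQ_inverse_real_of_nat)
      then show "(\<lambda>n. h n \<xi>) \<longlonglongrightarrow> 0" by simp
    qed
  qed (intro continuous_measurable_leb01 smooth_gen_continuous smooth_gen.intros h)+
  show ?thesis
  proof (rule that)
    show "test_fun (\<psi> n)" for n
      unfolding \<psi>_def by (intro test_fun_cutoff g) simp
    show "(\<lambda>n. mk_L2 (\<psi> n)) \<longlonglongrightarrow> eb i"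
      using cutoff_mult_tendsto[OF g] unfolding \<psi>_def eb_def g_def .
    have "(\<lambda>n. mk_L2 (h n) + mk_L2 (\<lambda>\<xi>. cutoff (dseq n) \<xi> * eb_deriv i \<xi>)) \<longlonglongrightarrow> mk_L2 (\<lambda>_. 0) + mk_L2 (eb_deriv i)"
      by (intro tendsto_add h0 cutoff_mult_tendsto g')
    moreover have "mk_L2 (deriv (\<psi> n)) = mk_L2 (h n) + mk_L2 (\<lambda>\<xi>. cutoff (dseq n) \<xi> * eb_deriv i \<xi>)" for n
      unfolding d\<psi> by (intro mk_L2_add[symmetric] sq_int_continuous smooth_gen_continuous h sc)
    ultimately show "(\<lambda>n. mk_L2 (deriv (\<psi> n))) \<longlonglongrightarrow> mk_L2 (eb_deriv i)"
      by (simp only: zero_L2.abs_eq[symmetric] add_0)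
  qed
qed

text \<open>Two integrations by parts. Neither \<open>u\<close> nor \<open>eb i\<close> is a test
  function, so each one is approximated once: the sine by \<psi> to move the derivative off
  \<open>w\<close>, and \<open>u\<close> by \<phi> to move it off \<open>v\<close>. The Dirichlet
  condition on \<open>u\<close> enters through \<phi>.\<close>

lemma op_A_inner_eb:
  assumes "u \<in> dom_A"
  shows "op_A u \<bullet> eb i = - lam i * (u \<bullet> eb i)"
proof -
  obtain v \<phi> where v: "weak_deriv u v" and \<phi>: "\<And>n. test_fun (\<phi> n)"
    "(\<lambda>n. mk_L2 (\<phi> n)) \<longlonglongrightarrow> u" "(\<lambda>n. mk_L2 (deriv (\<phi> n))) \<longlonglongrightarrow> v"
    using assms by (auto simp: dom_A_def sobolev_H10_def)
  obtain v' w where "weak_deriv u v'" "weak_deriv v' w"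
    using assms by (auto simp: dom_A_def sobolev_H2_def)
  \<comment> \<open>The two parts of \<open>dom_A\<close> supply first derivatives separately;
    uniqueness identifies them.\<close>
  then have w: "weak_deriv v w" using weak_deriv_unique[OF v] by blast
  obtain \<psi> where \<psi>: "\<And>n. test_fun (\<psi> n)"
    "(\<lambda>n. mk_L2 (\<psi> n)) \<longlonglongrightarrow> eb i" "(\<lambda>n. mk_L2 (deriv (\<psi> n))) \<longlonglongrightarrow> mk_L2 (eb_deriv i)"
    using eb_test_fun_approx by blast
  have "(\<lambda>n. v \<bullet> mk_L2 (deriv (\<psi> n))) \<longlonglongrightarrow> v \<bullet> mk_L2 (eb_deriv i)"
    by (intro tendsto_intros \<psi>)
  moreover have "(\<lambda>n. v \<bullet> mk_L2 (deriv (\<psi> n))) = (\<lambda>n. - (w \<bullet> mk_L2 (\<psi> n)))"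
    using w \<psi>(1) by (auto simp: weak_deriv_def)
  moreover have "(\<lambda>n. - (w \<bullet> mk_L2 (\<psi> n))) \<longlonglongrightarrow> - (w \<bullet> eb i)"
    by (intro tendsto_intros \<psi>)
  ultimately have 1: "v \<bullet> mk_L2 (eb_deriv i) = - (w \<bullet> eb i)"
    using LIMSEQ_unique by simp blast
  have "(\<lambda>n. mk_L2 (deriv (\<phi> n)) \<bullet> mk_L2 (eb_deriv i)) \<longlonglongrightarrow> v \<bullet> mk_L2 (eb_deriv i)"
    by (intro tendsto_intros \<phi>)
  moreover have "mk_L2 (deriv (\<phi> n)) \<bullet> mk_L2 (eb_deriv i) = lam i * (mk_L2 (\<phi> n) \<bullet> eb i)" for n
    using weak_deriv_eb(2)[of i] \<phi>(1)[of n]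
    by (simp add: weak_deriv_def inner_commute[of "mk_L2 (deriv (\<phi> n))"] inner_commute[of "mk_L2 (\<phi> n)"])
  moreover have "(\<lambda>n. lam i * (mk_L2 (\<phi> n) \<bullet> eb i)) \<longlonglongrightarrow> lam i * (u \<bullet> eb i)"
    by (intro tendsto_intros \<phi>)
  ultimately have 2: "v \<bullet> mk_L2 (eb_deriv i) = lam i * (u \<bullet> eb i)"
    using LIMSEQ_unique by simp blast
  show ?thesis
    using op_A_eqI[OF v w] 1 2 by simp
qed

section \<open>The exponential of the projected Laplacian\<close>

lemma An_funpow_Pn: "(An n ^^ k) (Pn n u) = (\<Sum>i=1..n. ((- lam i) ^ k * (u \<bullet> eb i)) *\<^sub>R eb i)"
proof (induction k)
  case 0
  show ?case by (simp add: Pn_def)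
next
  case (Suc k)
  have "(An n ^^ Suc k) (Pn n u) = Pn n (\<Sum>i=1..n. ((- lam i) ^ Suc k * (u \<bullet> eb i)) *\<^sub>R eb i)"
    by (simp add: Suc An_def op_A_sum_eb mult.assoc)
  moreover have "(\<Sum>i=1..n. ((- lam i) ^ Suc k * (u \<bullet> eb i)) *\<^sub>R eb i) \<in> Hn n"
    unfolding Hn_def by (intro span_sum span_mul span_base) auto
  ultimately show ?case by (simp only: Pn_Hn)
qed

text \<open>On \<open>Hn n\<close> the operator \<open>An n\<close> is diagonal, so its exponential
  series splits into finitely many scalar exponential series.\<close>

lemma semigr_n_Pn: "semigr_n n t (Pn n u) = (\<Sum>i=1..n. (exp (- lam i * t) * (u \<bullet> eb i)) *\<^sub>R eb i)"
proof -
  have "(\<lambda>k. \<Sum>i=1..n. ((- lam i * t) ^ k /\<^sub>R fact k) *\<^sub>R ((u \<bullet> eb i) *\<^sub>R eb i)) sums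
      (\<Sum>i=1..n. exp (- lam i * t) *\<^sub>R ((u \<bullet> eb i) *\<^sub>R eb i))"
    by (intro sums_sum bounded_linear.sums[OF bounded_linear_scaleR_left] exp_converges)
  moreover have "(\<Sum>i=1..n. ((- lam i * t) ^ k /\<^sub>R fact k) *\<^sub>R ((u \<bullet> eb i) *\<^sub>R eb i))
      = (t ^ k / fact k) *\<^sub>R (An n ^^ k) (Pn n u)" for k
    unfolding An_funpow_Pn scaleR_sum_right
  proof (intro sum.cong refl)
    fix i
    have "(- lam i * t) ^ k = (- lam i) ^ k * t ^ k"
      by (rule power_mult_distrib)
    then show "((- lam i * t) ^ k /\<^sub>R fact k) *\<^sub>R ((u \<bullet> eb i) *\<^sub>R eb i)
        = (t ^ k / fact k) *\<^sub>R (((- lam i) ^ k * (u \<bullet> eb i)) *\<^sub>R eb i)"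
      by (simp only: scaleR_scaleR real_scaleR_def) (simp add: divide_inverse mult_ac del: mult_minus_left)
  qed
  ultimately have "(\<lambda>k. (t ^ k / fact k) *\<^sub>R (An n ^^ k) (Pn n u)) sums
      (\<Sum>i=1..n. exp (- lam i * t) *\<^sub>R ((u \<bullet> eb i) *\<^sub>R eb i))"
    by simp
  from sums_unique[OF this] show ?thesis
    by (simp add: semigr_n_def)
qed

section \<open>Integrals over time intervals\<close>

lemma integrable_Icc_mono:
  fixes f :: "real \<Rightarrow> 'b::{banach, second_countable_topology}"
  assumes f: "integrable (lebesgue_on {a..b}) f" and sub: "{c..d} \<subseteq> {a..b}"
  shows "integrable (lebesgue_on {c..d}) f"
proof -
  have "integrable lebesgue (\<lambda>x. indicator {a..b} x *\<^sub>R f x)"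
    using f by (subst (asm) integrable_restrict_space) auto
  then have "integrable lebesgue (\<lambda>x. indicator {c..d} x *\<^sub>R (indicator {a..b} x *\<^sub>R f x))"
    by (rule integrable_mult_indicator[rotated]) auto
  moreover have "indicator {c..d} x *\<^sub>R (indicator {a..b} x *\<^sub>R f x) = indicator {c..d} x *\<^sub>R f x" for x
    using sub by (auto simp: indicator_def)
  ultimately have "integrable lebesgue (\<lambda>x. indicator {c..d} x *\<^sub>R f x)"
    by (simp only:)
  then show ?thesis
    by (subst integrable_restrict_space) auto
qed

lemma finite_measure_Icc: "finite_measure (lebesgue_on {a..b::real})"
  by (rule finite_measure_lebesgue_on) auto

lemma measurable_continuous_Icc:
  fixes f :: "real \<Rightarrow> 'b::topological_space"
  shows "continuous_on {a..b} f \<Longrightarrow> f \<in> borel_measurable (lebesgue_on {a..b})"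
  by (rule continuous_imp_measurable_on_sets_lebesgue) auto

lemma continuous_bounded_Icc:
  fixes f :: "real \<Rightarrow> 'b::real_normed_vector"
  assumes "continuous_on {a..b} f"
  obtains B where "B \<ge> 0" "\<And>x. x \<in> {a..b} \<Longrightarrow> norm (f x) \<le> B"
proof -
  have "bounded (f ` {a..b})"
    by (intro compact_imp_bounded compact_continuous_image assms) auto
  then obtain B where B: "\<forall>x\<in>{a..b}. norm (f x) \<le> B"
    by (auto simp: bounded_iff)
  show ?thesis
    by (rule that[of "max 0 B"]) (use B in \<open>auto intro: max.coboundedI2\<close>)
qed

lemma integrable_bounded_Icc:
  fixes f :: "real \<Rightarrow> 'b::{banach, second_countable_topology}"
  assumes "f \<in> borel_measurable (lebesgue_on {a..b})" "\<And>x. x \<in> {a..b} \<Longrightarrow> norm (f x) \<le> B"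
  shows "integrable (lebesgue_on {a..b}) f"
proof -
  interpret finite_measure "lebesgue_on {a..b}" by (rule finite_measure_Icc)
  show ?thesis
    by (rule integrable_const_bound[of _ B]) (use assms in auto)
qed

lemma integrable_continuous_Icc:
  fixes f :: "real \<Rightarrow> 'b::{banach, second_countable_topology}"
  assumes "continuous_on {a..b} f"
  shows "integrable (lebesgue_on {a..b}) f"
proof -
  obtain B where "\<And>x. x \<in> {a..b} \<Longrightarrow> norm (f x) \<le> B"
    using continuous_bounded_Icc[OF assms] by blast
  then show ?thesis
    by (rule integrable_bounded_Icc[OF measurable_continuous_Icc[OF assms]])
qed

lemma integrable_continuous_mult:
  fixes g v :: "real \<Rightarrow> real"
  assumes g: "continuous_on {a..b} g" and v: "integrable (lebesgue_on {a..b}) v"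
  shows "integrable (lebesgue_on {a..b}) (\<lambda>s. g s * v s)"
proof -
  obtain B where B: "\<And>x. x \<in> {a..b} \<Longrightarrow> norm (g x) \<le> B"
    using continuous_bounded_Icc[OF g] by blast
  show ?thesis
  proof (rule Bochner_Integration.integrable_bound)
    show "integrable (lebesgue_on {a..b}) (\<lambda>s. B * v s)" using v by simp
    show "(\<lambda>s. g s * v s) \<in> borel_measurable (lebesgue_on {a..b})"
      using v measurable_continuous_Icc[OF g] by auto
    show "AE s in lebesgue_on {a..b}. norm (g s * v s) \<le> norm (B * v s)"
    proof (rule AE_I2)
      fix s assume "s \<in> space (lebesgue_on {a..b})"
      then have "\<bar>g s\<bar> \<le> \<bar>B\<bar>" using B[of s] by simp
      then show "norm (g s * v s) \<le> norm (B * v s)"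
        by (simp add: abs_mult mult_right_mono)
    qed
  qed
qed

lemma integral_Icc_HK:
  fixes f :: "real \<Rightarrow> real"
  assumes "integrable (lebesgue_on {a..b}) f"
  shows "f integrable_on {a..b}" "(\<integral>s. f s \<partial>lebesgue_on {a..b}) = integral {a..b} f"
  using assms by (auto intro: integrable_on_lebesgue_on lebesgue_integral_eq_integral)

lemma continuous_on_integral_Icc:
  fixes f :: "real \<Rightarrow> real"
  assumes "integrable (lebesgue_on {0..T}) f"
  shows "continuous_on {0..T} (\<lambda>t. \<integral>s. f s \<partial>lebesgue_on {0..t})"
proof -
  have "continuous_on {0..T} (\<lambda>t. integral {0..t} f)"
    by (intro indefinite_integral_continuous_1 integral_Icc_HK assms)
  moreover have "integral {0..t} f = (\<integral>s. f s \<partial>lebesgue_on {0..t})" if "t \<in> {0..T}" for t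
    using that by (intro integral_Icc_HK(2)[symmetric] integrable_Icc_mono[OF assms]) auto
  ultimately show ?thesis
    by (rule continuous_on_eq)
qed

text \<open>The half-lines are stable under intersection and generate the Borel sets, so the
  integral vanishes over every Borel set and then, up to null sets, over every Lebesgue set. A
  function with this property is zero almost everywhere.\<close>

lemma AE_zero_if_integrals_zero:
  fixes f :: "real \<Rightarrow> real"
  assumes f: "integrable (lebesgue_on {0..T}) f"
    and zero: "\<And>t. t \<in> {0..T} \<Longrightarrow> (\<integral>s. f s \<partial>lebesgue_on {0..t}) = 0"
  shows "AE s in lebesgue_on {0..T}. f s = 0"
proof (cases "0 \<le> T")
  case False
  then show ?thesis by (intro AE_I2) simp
next
  case T: True
  \<comment> \<open>Extension by zero turns the hypothesis into a statement about half-lines, which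
    meet [0,T] in an initial segment or not at all.\<close>
  define g where "g s = indicator {0..T} s *\<^sub>R f s" for s
  have g: "integrable lebesgue g"
    using f unfolding g_def by (subst (asm) integrable_restrict_space) auto
  have restr: "(\<integral>x\<in>A. g x \<partial>lebesgue) = (\<integral>s. f s \<partial>lebesgue_on {0..t})"
    if A: "A \<inter> {0..T} = {0..t}" for A t
  proof -
    have "indicator A x *\<^sub>R g x = indicator {0..t} x *\<^sub>R f x" for x
      using A by (auto simp: g_def indicator_def)
    then show ?thesis
      unfolding set_lebesgue_integral_def by (subst integral_restrict_space) auto
  qed
  \<comment> \<open>The total integral is what the step for complements in the Dynkin induction
    relies on.\<close>
  have all: "(\<integral>x\<in>UNIV. g x \<partial>lebesgue) = 0"
    using restr[of UNIV T] zero[of T] T by simp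
  have gs: "set_integrable lebesgue A g" if "A \<in> sets lebesgue" for A
    unfolding set_integrable_def by (rule integrable_mult_indicator[OF that g])
  have borel: "(\<integral>x\<in>A. g x \<partial>lebesgue) = 0" if A: "A \<in> sets borel" for A :: "real set"
  proof -
    define G where "G = range (\<lambda>a::real. {..a})"
    have sG: "sets borel = sigma_sets UNIV G"
      unfolding G_def borel_eq_atMost by simp
    have "Int_stable G"
      by (auto simp: Int_stable_def G_def)
    moreover have "G \<subseteq> Pow UNIV" by simp
    moreover have "A \<in> sigma_sets UNIV G" using A sG by simp
    ultimately show ?thesis
    proof (induction rule: sigma_sets_induct_disjoint)
      case (basic A)
      then obtain a where a: "A = {..a}" by (auto simp: G_def)
      show ?case
      proof (cases "0 \<le> a")
        case True
        have "A \<inter> {0..T} = {0..min a T}" using a by auto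
        from restr[OF this] show ?thesis using zero[of "min a T"] True T by simp
      next
        case False
        have "(\<lambda>x. indicator A x *\<^sub>R g x) = (\<lambda>_. 0)"
          using a False by (auto simp: g_def indicator_def)
        then show ?thesis by (simp only: set_lebesgue_integral_def) simp
      qed
    next
      case empty
      show ?case by (simp add: set_lebesgue_integral_def)
    next
      case (compl A)
      then have "A \<in> sets borel" using sG by simp
      then have "A \<in> sets lebesgue" "UNIV - A \<in> sets lebesgue" by auto
      then have "(\<integral>x\<in>A \<union> (UNIV - A). g x \<partial>lebesgue) = (\<integral>x\<in>A. g x \<partial>lebesgue) + (\<integral>x\<in>UNIV - A. g x \<partial>lebesgue)"
        by (intro set_integral_Un gs) auto
      then show ?case using all compl by simp
    next
      case (union A)
      then have "A i \<in> sets borel" for i using sG by auto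
      then have "A i \<in> sets lebesgue" for i by simp
      then have "(\<integral>x\<in>(\<Union>i. A i). g x \<partial>lebesgue) = (\<Sum>i. (\<integral>x\<in>A i. g x \<partial>lebesgue))"
        using union(1) by (intro lebesgue_integral_countable_add gs) (auto simp: disjoint_family_on_def)
      then show ?case using union by simp
    qed
  qed
  have leb: "(\<integral>x\<in>A. g x \<partial>lebesgue) = 0" if A: "A \<in> sets lebesgue" for A
  proof -
    obtain S N N' where S: "A = S \<union> N" "N \<subseteq> N'" "N' \<in> null_sets lborel" "S \<in> sets lborel"
      using A by (rule sets_completionE)
    have "(\<integral>x\<in>A. g x \<partial>lebesgue) = (\<integral>x\<in>S. g x \<partial>lebesgue)"
    proof (rule set_integral_null_delta[OF g A])
      show "S \<in> sets lebesgue" using S by simp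
      have "N' \<in> null_sets lebesgue" using S(3) by (rule null_sets_completionI)
      moreover have "(A - S) \<union> (S - A) \<subseteq> N'" using S by auto
      ultimately show "(A - S) \<union> (S - A) \<in> null_sets lebesgue"
        using null_sets_completion_subset by blast
    qed
    then show ?thesis using borel S(4) by simp
  qed
  have "AE x in lebesgue. g x = 0"
    by (rule density_unique_real[OF g]) (simp_all add: leb)
  then have "AE x in lebesgue. x \<in> {0..T} \<longrightarrow> f x = 0"
    by eventually_elim (auto simp: g_def)
  then show ?thesis
    by (subst AE_restrict_space_iff) auto
qed

text \<open>
  The difference \<open>D\<close> of the two sides has derivative zero, because its increment over \<open>[s,t]\<close> is
  at most a constant times \<open>(t - s) \<integral>\<^sub>s\<^sup>t \<bar>v\<bar>\<close>.
\<close>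

lemma exp_weighted_integral:
  fixes k v :: "real \<Rightarrow> real"
  assumes v: "integrable (lebesgue_on {0..T}) v"
    and k: "\<And>t. t \<in> {0..T} \<Longrightarrow> k t = k0 + (\<integral>s. v s \<partial>lebesgue_on {0..t})"
    and t: "t \<in> {0..T}"
  shows "exp (c * t) * k t = k0 + (\<integral>s. exp (c * s) * (c * k s + v s) \<partial>lebesgue_on {0..t})"
proof -
  note HKv = integral_Icc_HK[OF integrable_Icc_mono[OF v]]
  have ck: "continuous_on {0..T} k"
    by (rule continuous_on_eq[OF continuous_on_add[OF continuous_on_const[of _ k0] continuous_on_integral_Icc[OF v]]])
      (rule k[symmetric])
  define h where "h s = exp (c * s) * (c * k s + v s)" for s
  have h: "integrable (lebesgue_on {0..T}) h"
    unfolding h_def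
    by (intro integrable_continuous_mult Bochner_Integration.integrable_add v integrable_continuous_Icc
        continuous_intros ck)
  note HKh = integral_Icc_HK[OF integrable_Icc_mono[OF h]]
  have absv: "integrable (lebesgue_on {0..T}) (\<lambda>s. \<bar>v s\<bar>)" using v by simp
  note HKa = integral_Icc_HK[OF integrable_Icc_mono[OF absv]]
  define D where "D t = exp (c * t) * k t - integral {0..t} h" for t
  define W where "W t = integral {0..t} (\<lambda>s. \<bar>v s\<bar>)" for t
  \<comment> \<open>The modulus covers both signs: the lemma serves with \<open>c\<close> equal to
    \<open>lam j\<close> and to \<open>- lam j\<close>. \<open>B\<close> is then a Lipschitz
    constant of the exponential on [0,T].\<close>
  define M where "M = exp (\<bar>c\<bar> * T)"
  define B where "B = \<bar>c\<bar> * M"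
  have B: "0 \<le> B" by (simp add: B_def M_def)
  have M: "exp (c * r) \<le> M" if "r \<in> {0..T}" for r
  proof -
    have "c * r \<le> \<bar>c\<bar> * r" using that by (intro mult_right_mono) auto
    also have "\<dots> \<le> \<bar>c\<bar> * T" using that by (intro mult_left_mono) auto
    finally show ?thesis by (simp add: M_def)
  qed
  have FTC: "((\<lambda>r. c * exp (c * r)) has_integral (exp (c * t) - exp (c * s))) {s..t}" if "s \<le> t" for s t
    using that by (intro fundamental_theorem_of_calculus)
      (auto intro!: derivative_eq_intros simp: has_real_derivative_iff_has_vector_derivative[symmetric])
  have expd: "\<bar>exp (c * t) - exp (c * r)\<bar> \<le> B * (t - r)" if "r \<in> {0..T}" "t \<in> {0..T}" "r \<le> t" for r t
  proof -
    have "norm (integral {r..t} (\<lambda>r. c * exp (c * r))) \<le> integral {r..t} (\<lambda>_. B)"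
    proof (rule Henstock_Kurzweil_Integration.integral_norm_bound_integral)
      fix x assume "x \<in> {r..t}"
      then show "norm (c * exp (c * x)) \<le> B"
        using M[of x] that by (simp add: B_def abs_mult mult_left_mono)
    qed (use FTC[OF that(3)] in auto)
    then show ?thesis
      using integral_unique[OF FTC[OF that(3)]] that by (simp add: mult.commute)
  qed
  have key: "\<bar>D t - D s\<bar> \<le> 2 * B * (t - s) * (W t - W s)" if st: "s \<in> {0..T}" "t \<in> {0..T}" "s \<le> t" for s t
  proof -
    have sub: "{0..t} \<subseteq> {0..T}" "{0..s} \<subseteq> {0..T}" "{s..t} \<subseteq> {0..T}" using st by auto
    have inc: "k r - k s = integral {s..r} v" if "r \<in> {s..t}" for r
    proof -
      have "integral {0..s} v + integral {s..r} v = integral {0..r} v"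
        using st that by (intro Henstock_Kurzweil_Integration.integral_combine HKv) auto
      then show ?thesis
        using k[of r] k[of s] HKv(2)[of 0 r] HKv(2)[of 0 s] st that by auto
    qed
    have incW: "W r - W s = integral {s..r} (\<lambda>s. \<bar>v s\<bar>)" if "r \<in> {s..t}" for r
    proof -
      have "integral {0..s} (\<lambda>s. \<bar>v s\<bar>) + integral {s..r} (\<lambda>s. \<bar>v s\<bar>) = integral {0..r} (\<lambda>s. \<bar>v s\<bar>)"
        using st that by (intro Henstock_Kurzweil_Integration.integral_combine HKa) auto
      then show ?thesis by (simp add: W_def)
    qed
    have inch: "integral {0..t} h - integral {0..s} h = integral {s..t} h"
      using Henstock_Kurzweil_Integration.integral_combine[of 0 s t h] HKh(1)[OF sub(1)] st by auto
    have kb: "\<bar>k s - k r\<bar> \<le> W t - W s" if r: "r \<in> {s..t}" for r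
    proof -
      have sr: "{s..r} \<subseteq> {0..T}" "{r..t} \<subseteq> {0..T}" using r st by auto
      have "\<bar>k s - k r\<bar> = norm (integral {s..r} v)"
        using inc[OF r] by simp
      also have "\<dots> \<le> integral {s..r} (\<lambda>s. \<bar>v s\<bar>)"
        by (rule Henstock_Kurzweil_Integration.integral_norm_bound_integral) (use HKv HKa sr in auto)
      also have "\<dots> \<le> integral {s..t} (\<lambda>s. \<bar>v s\<bar>)"
        using r sub sr by (intro integral_subset_le HKa) auto
      finally show ?thesis using incW[of t] st by simp
    qed
    have vi: "v integrable_on {s..t}" "h integrable_on {s..t}" "(\<lambda>s. \<bar>v s\<bar>) integrable_on {s..t}"
      by (intro HKv HKh HKa sub)+
    have ei: "(\<lambda>r. c * exp (c * r) * k s) integrable_on {s..t}"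
      by (intro integrable_continuous_real continuous_intros)
    have "D t - D s = exp (c * t) * (k t - k s) + (exp (c * t) - exp (c * s)) * k s - integral {s..t} h"
      using inch by (simp add: D_def algebra_simps)
    also have "\<dots> = integral {s..t} (\<lambda>r. exp (c * t) * v r) + integral {s..t} (\<lambda>r. c * exp (c * r) * k s) - integral {s..t} h"
      using inc[of t] st integral_unique[OF FTC[OF st(3)]] by simp
    also have "\<dots> = integral {s..t} (\<lambda>r. exp (c * t) * v r + c * exp (c * r) * k s - h r)"
      using vi ei by (simp add: Henstock_Kurzweil_Integration.integral_add Henstock_Kurzweil_Integration.integral_diff integrable_add)
    finally have eq: "D t - D s = integral {s..t} (\<lambda>r. exp (c * t) * v r + c * exp (c * r) * k s - h r)" .
    have "norm (D t - D s) \<le> integral {s..t} (\<lambda>r. B * (t - s) * \<bar>v r\<bar> + B * (W t - W s))"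
      unfolding eq
    proof (rule Henstock_Kurzweil_Integration.integral_norm_bound_integral)
      show "(\<lambda>r. exp (c * t) * v r + c * exp (c * r) * k s - h r) integrable_on {s..t}"
        using vi ei by (intro integrable_diff integrable_add) auto
      show "(\<lambda>r. B * (t - s) * \<bar>v r\<bar> + B * (W t - W s)) integrable_on {s..t}"
        using integrable_cmul[OF vi(3), of "B * (t - s)"] by (intro integrable_add) auto
      fix r assume r: "r \<in> {s..t}"
      \<comment> \<open>Regrouping makes both terms small: one contains an increment of the
        exponential, of order t - s, the other an increment of \<open>k\<close>, controlled by the
        increment of \<open>W\<close>.\<close>
      have "exp (c * t) * v r + c * exp (c * r) * k s - h r
          = (exp (c * t) - exp (c * r)) * v r + c * exp (c * r) * (k s - k r)"
        by (simp add: h_def algebra_simps)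
      then have "norm (exp (c * t) * v r + c * exp (c * r) * k s - h r)
          \<le> \<bar>exp (c * t) - exp (c * r)\<bar> * \<bar>v r\<bar> + (\<bar>c\<bar> * exp (c * r)) * \<bar>k s - k r\<bar>"
        using abs_triangle_ineq[of "(exp (c * t) - exp (c * r)) * v r" "c * exp (c * r) * (k s - k r)"]
        by (simp add: abs_mult)
      also have "\<dots> \<le> (B * (t - s)) * \<bar>v r\<bar> + B * (W t - W s)"
      proof (intro add_mono mult_right_mono mult_mono kb r)
        have "\<bar>exp (c * t) - exp (c * r)\<bar> \<le> B * (t - r)" using r st by (intro expd) auto
        also have "\<dots> \<le> B * (t - s)" using r B by (intro mult_left_mono) auto
        finally show "\<bar>exp (c * t) - exp (c * r)\<bar> \<le> B * (t - s)" .
        show "\<bar>c\<bar> * exp (c * r) \<le> B"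
          using M[of r] r st by (auto simp: B_def intro: mult_left_mono)
      qed (use B in auto)
      finally show "norm (exp (c * t) * v r + c * exp (c * r) * k s - h r) \<le> B * (t - s) * \<bar>v r\<bar> + B * (W t - W s)" .
    qed
    also have "\<dots> = B * (t - s) * (W t - W s) + B * (W t - W s) * (t - s)"
    proof -
      have "integral {s..t} (\<lambda>r. B * (t - s) * \<bar>v r\<bar> + B * (W t - W s))
          = integral {s..t} (\<lambda>r. B * (t - s) * \<bar>v r\<bar>) + integral {s..t} (\<lambda>r. B * (W t - W s))"
        using integrable_cmul[OF vi(3), of "B * (t - s)"]
        by (intro Henstock_Kurzweil_Integration.integral_add) auto
      then show ?thesis using incW[of t] st by simp
    qed
    finally show ?thesis by (simp add: algebra_simps)
  qed
  have cW: "continuous_on {0..T} W"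
    unfolding W_def by (intro indefinite_integral_continuous_1 HKa) auto
  \<comment> \<open>By \<open>key\<close> the difference quotient is at most a multiple of an
    increment of \<open>W\<close>, which vanishes by continuity. This holds at every point although
    \<open>v\<close> is only integrable.\<close>
  have "(D has_field_derivative 0) (at x within {0..T})" if x: "x \<in> {0..T}" for x
    unfolding has_field_derivative_iff
  proof (rule Lim_null_comparison)
    have "((\<lambda>y. 2 * B * \<bar>W y - W x\<bar>) \<longlongrightarrow> 2 * B * \<bar>W x - W x\<bar>) (at x within {0..T})"
      using cW x by (intro tendsto_intros) (auto simp: continuous_on_def)
    then show "((\<lambda>y. 2 * B * \<bar>W y - W x\<bar>) \<longlongrightarrow> 0) (at x within {0..T})" by simp
    show "\<forall>\<^sub>F y in at x within {0..T}. norm ((D y - D x) / (y - x)) \<le> 2 * B * \<bar>W y - W x\<bar>"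
      unfolding eventually_at_filter
    proof (rule always_eventually, intro allI impI)
      fix y assume y: "y \<noteq> x" "y \<in> {0..T}"
      have "\<bar>D y - D x\<bar> \<le> 2 * B * \<bar>y - x\<bar> * \<bar>W y - W x\<bar>"
      proof (cases "x \<le> y")
        case True
        then have "\<bar>D y - D x\<bar> \<le> 2 * B * (y - x) * (W y - W x)" using key x y by blast
        also have "\<dots> \<le> 2 * B * \<bar>y - x\<bar> * \<bar>W y - W x\<bar>" using True B by (simp add: mult_left_mono)
        finally show ?thesis .
      next
        case False
        then have "\<bar>D x - D y\<bar> \<le> 2 * B * (x - y) * (W x - W y)" using key[of y x] x y by simp
        also have "\<dots> \<le> 2 * B * \<bar>y - x\<bar> * \<bar>W y - W x\<bar>" using False B by (simp add: mult_left_mono)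
        finally show ?thesis by (simp add: abs_minus_commute)
      qed
      then show "norm ((D y - D x) / (y - x)) \<le> 2 * B * \<bar>W y - W x\<bar>"
        using y by (simp add: divide_le_eq mult_ac)
    qed
  qed
  then obtain d where d: "\<And>x. x \<in> {0..T} \<Longrightarrow> D x = d"
    using has_field_derivative_zero_constant[of "{0..T}" D] by auto
  have "0 \<in> {0..T}" using t by auto
  then have "D 0 = k0" using k[of 0] HKv(2)[of 0 0] by (simp add: D_def)
  then have "D t = k0" using d[OF t] d[OF \<open>0 \<in> {0..T}\<close>] by simp
  then show ?thesis
    using HKh(2)[of 0 t] t by (simp add: D_def h_def)
qed

section \<open>Variation of constants\<close>

lemma integrable_inner_eb:
  assumes "integrable M (w :: real \<Rightarrow> L2)"
  shows "integrable M (\<lambda>s. w s \<bullet> eb j)"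
  using assms by (intro integrable_inner_left)

lemma exp_convolution:
  fixes v :: "real \<Rightarrow> real"
  shows "(\<integral>s. exp (- c * (t - s)) * v s \<partial>lebesgue_on {0..t})
    = exp (- c * t) * (\<integral>s. exp (c * s) * v s \<partial>lebesgue_on {0..t})"
  unfolding integral_mult_right_zero[symmetric] mult.assoc[symmetric] exp_add[symmetric]
  by (simp add: algebra_simps)

text \<open>Measurability comes from writing the integrand as the pointwise limit of its
  projections, which are finite sums of measurable functions; the contraction property supplies the
  majorant.\<close>

lemma semigr_integrable:
  assumes w: "integrable (lebesgue_on {0..t}) w"
  shows "integrable (lebesgue_on {0..t}) (\<lambda>s. semigr (t - s) (w s))"
proof (rule Bochner_Integration.integrable_bound[OF w])
  have [measurable]: "w \<in> borel_measurable (lebesgue_on {0..t})" using w by auto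
  have [measurable]: "(\<lambda>s. exp (- lam i * (t - s))) \<in> borel_measurable (lebesgue_on {0..t})" for i
    by (intro measurable_continuous_Icc continuous_intros)
  show "(\<lambda>s. semigr (t - s) (w s)) \<in> borel_measurable (lebesgue_on {0..t})"
  proof (rule borel_measurable_LIMSEQ_metric)
    show "(\<lambda>s. \<Sum>i=1..n. (exp (- lam i * (t - s)) * (w s \<bullet> eb i)) *\<^sub>R eb i) \<in> borel_measurable (lebesgue_on {0..t})" for n
      by measurable
    fix s assume "s \<in> space (lebesgue_on {0..t})"
    then have "(\<Sum>i=1..n. (exp (- lam i * (t - s)) * (w s \<bullet> eb i)) *\<^sub>R eb i) = Pn n (semigr (t - s) (w s))" for n
      unfolding Pn_def by (intro sum.cong) (auto simp: semigr_inner_eb)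
    then show "(\<lambda>n. \<Sum>i=1..n. (exp (- lam i * (t - s)) * (w s \<bullet> eb i)) *\<^sub>R eb i) \<longlonglongrightarrow> semigr (t - s) (w s)"
      by (simp only: Pn_tendsto)
  qed
  show "AE s in lebesgue_on {0..t}. norm (semigr (t - s) (w s)) \<le> norm (w s)"
    by (rule AE_I2) (auto intro: norm_semigr_le)
qed

lemma semigr_integral_inner_eb:
  assumes w: "integrable (lebesgue_on {0..t}) w" and j: "j \<ge> 1"
  shows "(\<integral>s. semigr (t - s) (w s) \<partial>lebesgue_on {0..t}) \<bullet> eb j
    = (\<integral>s. exp (- lam j * (t - s)) * (w s \<bullet> eb j) \<partial>lebesgue_on {0..t})"
proof -
  have "(\<integral>s. semigr (t - s) (w s) \<partial>lebesgue_on {0..t}) \<bullet> eb j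
      = (\<integral>s. semigr (t - s) (w s) \<bullet> eb j \<partial>lebesgue_on {0..t})"
    by (intro integral_inner_left[symmetric] semigr_integrable w)
  also have "\<dots> = (\<integral>s. exp (- lam j * (t - s)) * (w s \<bullet> eb j) \<partial>lebesgue_on {0..t})"
    using j by (intro Bochner_Integration.integral_cong) (auto simp: semigr_inner_eb)
  finally show ?thesis .
qed

lemma semigr_n_integral:
  assumes w: "integrable (lebesgue_on {0..t}) w"
  shows "(\<integral>s. semigr_n n (t - s) (Pn n (w s)) \<partial>lebesgue_on {0..t})
    = (\<Sum>i=1..n. (\<integral>s. exp (- lam i * (t - s)) * (w s \<bullet> eb i) \<partial>lebesgue_on {0..t}) *\<^sub>R eb i)"
proof -
  have i: "integrable (lebesgue_on {0..t}) (\<lambda>s. exp (- lam i * (t - s)) * (w s \<bullet> eb i))" for i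
    by (intro integrable_continuous_mult integrable_inner_eb w continuous_intros)
  show ?thesis
    unfolding semigr_n_Pn
    by (subst Bochner_Integration.integral_sum[OF integrable_scaleR_left[OF i]])
      (simp only: integral_scaleR_left[OF i])
qed

section \<open>Square integrable paths\<close>

lemma L2_path_iff:
  "\<phi> \<in> L2_path T UNIV \<longleftrightarrow> \<phi> \<in> borel_measurable (lebesgue_on {0..T}) \<and>
    integrable (lebesgue_on {0..T}) (\<lambda>t. (norm (\<phi> t))\<^sup>2)"
  by (simp add: L2_path_def)

lemma L2_path_bound:
  assumes "\<phi> \<in> borel_measurable (lebesgue_on {0..T})"
    and "integrable (lebesgue_on {0..T}) g"
    and "\<And>t. t \<in> {0..T} \<Longrightarrow> (norm (\<phi> t))\<^sup>2 \<le> g t"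
  shows "\<phi> \<in> L2_path T UNIV"
  unfolding L2_path_iff
proof (intro conjI)
  show "integrable (lebesgue_on {0..T}) (\<lambda>t. (norm (\<phi> t))\<^sup>2)"
  proof (rule Bochner_Integration.integrable_bound[OF assms(2)])
    show "(\<lambda>t. (norm (\<phi> t))\<^sup>2) \<in> borel_measurable (lebesgue_on {0..T})"
      using assms(1) by measurable
    show "AE t in lebesgue_on {0..T}. norm ((norm (\<phi> t))\<^sup>2) \<le> norm (g t)"
      by (rule AE_I2) (auto intro: order_trans[OF assms(3)])
  qed
qed (rule assms(1))

lemma L2_path_add:
  assumes "u \<in> L2_path T UNIV" "v \<in> L2_path T UNIV"
  shows "(\<lambda>t. u t + v t) \<in> L2_path T UNIV"
proof (rule L2_path_bound)
  show "(\<lambda>t. u t + v t) \<in> borel_measurable (lebesgue_on {0..T})"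
    using assms by (auto simp: L2_path_iff)
  show "integrable (lebesgue_on {0..T}) (\<lambda>t. 2 * (norm (u t))\<^sup>2 + 2 * (norm (v t))\<^sup>2)"
    using assms by (auto simp: L2_path_iff)
  show "(norm (u t + v t))\<^sup>2 \<le> 2 * (norm (u t))\<^sup>2 + 2 * (norm (v t))\<^sup>2" for t
  proof -
    have "(norm (u t + v t))\<^sup>2 \<le> (norm (u t) + norm (v t))\<^sup>2"
      by (intro power_mono norm_triangle_ineq) auto
    also have "\<dots> \<le> 2 * (norm (u t))\<^sup>2 + 2 * (norm (v t))\<^sup>2"
      using sum_squares_bound[of "norm (u t)" "norm (v t)"] by (simp add: power2_sum)
    finally show ?thesis .
  qed
qed

lemma L2_path_bounded_linear:
  assumes B: "bounded_linear B" and u: "u \<in> L2_path T UNIV"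
  shows "(\<lambda>t. B (u t)) \<in> L2_path T UNIV"
proof -
  obtain K where K: "\<And>x. norm (B x) \<le> norm x * K"
    using bounded_linear.bounded[OF B] by blast
  show ?thesis
  proof (rule L2_path_bound)
    have "B \<in> borel_measurable borel"
      by (intro borel_measurable_continuous_onI linear_continuous_on B)
    then show "(\<lambda>t. B (u t)) \<in> borel_measurable (lebesgue_on {0..T})"
      using u by (auto simp: L2_path_iff)
    show "integrable (lebesgue_on {0..T}) (\<lambda>t. (norm (u t))\<^sup>2 * K\<^sup>2)"
      using u by (auto simp: L2_path_iff)
    show "(norm (B (u t)))\<^sup>2 \<le> (norm (u t))\<^sup>2 * K\<^sup>2" for t
      using power_mono[OF K norm_ge_zero, of "u t" 2] by (simp add: power_mult_distrib)
  qed
qed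

lemma L2_path_diff:
  assumes "u \<in> L2_path T UNIV" "v \<in> L2_path T UNIV"
  shows "(\<lambda>t. u t - v t) \<in> L2_path T UNIV"
  using L2_path_add[OF assms(1) L2_path_bounded_linear[OF bounded_linear_minus[OF bounded_linear_ident] assms(2)]]
  by simp

lemma L2_path_bounded:
  assumes "u \<in> borel_measurable (lebesgue_on {0..T})" "\<And>t. t \<in> {0..T} \<Longrightarrow> norm (u t) \<le> B"
  shows "u \<in> L2_path T UNIV"
proof (rule L2_path_bound[OF assms(1)])
  show "integrable (lebesgue_on {0..T}) (\<lambda>_. B\<^sup>2)"
    by (intro integrable_continuous_Icc continuous_intros)
  show "(norm (u t))\<^sup>2 \<le> B\<^sup>2" if "t \<in> {0..T}" for t
    using assms(2)[OF that] by (intro power_mono) auto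
qed

lemma L2_path_continuous:
  assumes "continuous_on {0..T} u"
  shows "u \<in> L2_path T UNIV"
proof -
  obtain B where "\<And>t. t \<in> {0..T} \<Longrightarrow> norm (u t) \<le> B"
    using continuous_bounded_Icc[OF assms] by blast
  then show ?thesis
    by (rule L2_path_bounded[OF measurable_continuous_Icc[OF assms]])
qed

lemma L2_path_sqnorm_nonneg: "0 \<le> L2_path_sqnorm T u"
  by (simp add: L2_path_sqnorm_def)

lemma L2_path_integrable:
  assumes u: "u \<in> L2_path T UNIV"
  shows "integrable (lebesgue_on {0..T}) u"
proof (rule Bochner_Integration.integrable_bound)
  interpret finite_measure "lebesgue_on {0..T}" by (rule finite_measure_Icc)
  show "integrable (lebesgue_on {0..T}) (\<lambda>t. 1 + (norm (u t))\<^sup>2)"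
    using u by (auto simp: L2_path_iff)
  show "u \<in> borel_measurable (lebesgue_on {0..T})"
    using u by (simp add: L2_path_iff)
  have "norm x \<le> 1 + (norm x)\<^sup>2" for x :: L2
    using sum_squares_bound[of "norm x" 1] by simp (smt (verit) norm_ge_zero)
  then show "AE t in lebesgue_on {0..T}. norm (u t) \<le> norm (1 + (norm (u t))\<^sup>2)"
    by (intro AE_I2) (auto intro: order_trans)
qed

lemma measure_Icc: "0 \<le> T \<Longrightarrow> measure (lebesgue_on {0..T}) {0..T} = (T::real)"
  by (subst measure_restrict_space) auto

text \<open>Cauchy-Schwarz in time, obtained from nonnegativity of the variance about the mean
  \<open>m\<close>.\<close>

lemma L2_path_L1_le:
  assumes u: "u \<in> L2_path T UNIV" and T: "T > 0"
  shows "(\<integral>t. norm (u t) \<partial>lebesgue_on {0..T}) \<le> sqrt T * sqrt (L2_path_sqnorm T u)"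
proof -
  let ?M = "lebesgue_on {0..T}"
  define I where "I = (\<integral>t. norm (u t) \<partial>?M)"
  define m where "m = I / T"
  have iu: "integrable ?M (\<lambda>t. norm (u t))"
    using L2_path_integrable[OF u] by simp
  have i2: "integrable ?M (\<lambda>t. (norm (u t))\<^sup>2)" using u by (simp add: L2_path_iff)
  have ic: "integrable ?M (\<lambda>t. m\<^sup>2)" by (intro integrable_continuous_Icc continuous_intros)
  have "0 \<le> (\<integral>t. (norm (u t) - m)\<^sup>2 \<partial>?M)" by simp
  also have "\<dots> = (\<integral>t. (norm (u t))\<^sup>2 + m\<^sup>2 - 2 * m * norm (u t) \<partial>?M)"
    by (intro Bochner_Integration.integral_cong) (auto simp: power2_diff)
  also have "\<dots> = L2_path_sqnorm T u + T * m\<^sup>2 - 2 * m * I"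
    using iu i2 ic T unfolding I_def L2_path_sqnorm_def
    by (simp add: Bochner_Integration.integral_diff Bochner_Integration.integral_add measure_Icc)
  also have "\<dots> = L2_path_sqnorm T u - I\<^sup>2 / T"
    using T by (simp add: m_def power2_eq_square field_simps)
  finally have "I\<^sup>2 \<le> T * L2_path_sqnorm T u"
    using T by (simp add: field_simps)
  then have "I \<le> sqrt (T * L2_path_sqnorm T u)"
    by (rule real_le_rsqrt)
  then show ?thesis by (simp add: I_def real_sqrt_mult)
qed

section \<open>Absolute continuity of the paths in the parabolic Sobolev space\<close>

lemma continuous_on_section:
  assumes "continuous_on (S \<times> X) (\<lambda>(t, \<xi>). d t \<xi>)" "t \<in> S"
  shows "continuous_on X (d t)"
proof -
  have "continuous_on X (\<lambda>\<xi>. (\<lambda>(t, \<xi>). d t \<xi>) (t, \<xi>))"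
    by (rule continuous_on_compose2[OF assms(1)]) (use assms(2) in \<open>auto intro!: continuous_intros\<close>)
  then show ?thesis by simp
qed

text \<open>On the compact rectangle \<open>d\<close> is bounded, so pointwise convergence along a
  sequence of times becomes convergence in \<open>L2\<close> by domination with a constant.\<close>

lemma continuous_on_mk_L2:
  fixes d :: "real \<Rightarrow> real \<Rightarrow> real"
  assumes d: "continuous_on ({0..T} \<times> {0..1}) (\<lambda>(t, \<xi>). d t \<xi>)"
  shows "continuous_on {0..T} (\<lambda>t. mk_L2 (d t))"
  unfolding continuous_on_sequentially
proof (intro allI ballI impI, elim conjE)
  fix X t assume t: "t \<in> {0..T}" and X: "\<forall>n. X n \<in> {0..T}" "X \<longlonglongrightarrow> t"
  have "bounded ((\<lambda>(t, \<xi>). d t \<xi>) ` ({0..T} \<times> {0..1}))"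
    by (intro compact_imp_bounded compact_continuous_image d compact_Times) auto
  then have "\<exists>B. \<forall>t\<in>{0..T}. \<forall>\<xi>\<in>{0..1}. \<bar>d t \<xi>\<bar> \<le> B"
    by (auto simp: bounded_iff)
  then obtain B where B: "\<And>t \<xi>. t \<in> {0..T} \<Longrightarrow> \<xi> \<in> {0..1} \<Longrightarrow> \<bar>d t \<xi>\<bar> \<le> B"
    by blast
  note sec = continuous_on_section[OF d]
  have "(\<lambda>n. mk_L2 (d (X n))) \<longlonglongrightarrow> mk_L2 (d t)"
  proof (rule mk_L2_dominated_convergence)
    show "sq_int (\<lambda>_. B)" by (rule sq_int_const)
    show "AE \<xi> in leb01. \<bar>d (X n) \<xi>\<bar> \<le> B" for n
      using B X by (intro AE_I2) auto
    show "AE \<xi> in leb01. (\<lambda>n. d (X n) \<xi>) \<longlonglongrightarrow> d t \<xi>"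
    proof (rule AE_I2)
      fix \<xi> assume "\<xi> \<in> space leb01"
      then have xi: "\<xi> \<in> {0..1}" by simp
      have "(\<lambda>n. (X n, \<xi>)) \<longlonglongrightarrow> (t, \<xi>)"
        by (intro tendsto_intros X)
      then have "(\<lambda>n. (\<lambda>(t, \<xi>). d t \<xi>) (X n, \<xi>)) \<longlonglongrightarrow> (\<lambda>(t, \<xi>). d t \<xi>) (t, \<xi>)"
        by (rule continuous_on_tendsto_compose[OF d]) (use X t xi in auto)
      then show "(\<lambda>n. d (X n) \<xi>) \<longlonglongrightarrow> d t \<xi>" by simp
    qed
  qed (use X t sec in \<open>auto intro: continuous_measurable_leb01\<close>)
  then show "((\<lambda>t. mk_L2 (d t)) \<circ> X) \<longlonglongrightarrow> mk_L2 (d t)"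
    by (simp add: o_def)
qed

text \<open>Differentiation under the integral sign, followed by the fundamental theorem of calculus
  in time.\<close>

lemma smooth_jet_inner_eb:
  assumes D: "smooth_jet T D" and t: "t \<in> {0..T}"
  shows "mk_L2 (D 0 0 t) \<bullet> eb i = mk_L2 (D 0 0 0) \<bullet> eb i
    + (\<integral>s. mk_L2 (D 1 0 s) \<bullet> eb i \<partial>lebesgue_on {0..t})"
proof -
  define e where "e \<xi> = sqrt 2 * sin (real i * pi * \<xi>)" for \<xi>
  have ce: "continuous_on X e" for X
    unfolding e_def by (intro continuous_intros)
  have cD: "continuous_on ({0..T} \<times> {0..1}) (\<lambda>(t, \<xi>). D k 0 t \<xi>)" for k
    using D by (auto simp: smooth_jet_def)
  have cDe: "continuous_on ({0..T} \<times> {0..1}) (\<lambda>(t, \<xi>). D k 0 t \<xi> * e \<xi>)" for k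
  proof -
    have "continuous_on ({0..T} \<times> {0..1}) (\<lambda>p :: real \<times> real. e (snd p))"
      by (intro continuous_on_compose2[OF ce[of UNIV]] continuous_intros) auto
    from continuous_on_mult[OF cD[of k] this] show ?thesis
      by (simp add: case_prod_unfold)
  qed
  have dD: "((\<lambda>s. D 0 0 s \<xi>) has_real_derivative D 1 0 t \<xi>) (at t within {0..T})"
    if "t \<in> {0..T}" "\<xi> \<in> {0..1}" for t \<xi>
    using D that by (auto simp: smooth_jet_def)
  have inner: "mk_L2 (D k 0 t) \<bullet> eb i = integral (cbox 0 1) (\<lambda>\<xi>. D k 0 t \<xi> * e \<xi>)" if "t \<in> {0..T}" for k t
  proof -
    have c: "continuous_on {0..1} (D k 0 t)" "continuous_on {0..1} (\<lambda>\<xi>. D k 0 t \<xi> * e \<xi>)"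
      using continuous_on_section[OF cD that] continuous_on_section[OF cDe that] .
    then have "mk_L2 (D k 0 t) \<bullet> eb i = (\<integral>\<xi>. D k 0 t \<xi> * e \<xi> \<partial>leb01)"
      unfolding eb_def e_def by (intro inner_mk_L2 sq_int_continuous sq_int_eb)
    then show ?thesis using integral_leb01_continuous[OF c(2)] by simp
  qed
  have cont: "continuous_on {0..T} (\<lambda>t. mk_L2 (D 1 0 t) \<bullet> eb i)"
    by (intro continuous_intros continuous_on_mk_L2 cD)
  have der: "((\<lambda>t. mk_L2 (D 0 0 t) \<bullet> eb i) has_real_derivative mk_L2 (D 1 0 s) \<bullet> eb i) (at s within {0..T})"
    if s: "s \<in> {0..T}" for s
  proof -
    have "((\<lambda>t. integral (cbox 0 1) (\<lambda>\<xi>. D 0 0 t \<xi> * e \<xi>)) has_real_derivative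
        integral (cbox 0 1) (\<lambda>\<xi>. D 1 0 s \<xi> * e \<xi>)) (at s within {0..T})"
    proof (rule leibniz_rule_field_derivative[where fx = "\<lambda>s \<xi>. D 1 0 s \<xi> * e \<xi>"])
      show "((\<lambda>t. D 0 0 t \<xi> * e \<xi>) has_real_derivative D 1 0 t \<xi> * e \<xi>) (at t within {0..T})"
        if "t \<in> {0..T}" "\<xi> \<in> cbox 0 1" for t \<xi>
        using that by (intro DERIV_cmult_right dD) auto
      show "(\<lambda>\<xi>. D 0 0 t \<xi> * e \<xi>) integrable_on cbox 0 1" if "t \<in> {0..T}" for t
        using continuous_on_section[OF cDe that] by (intro integrable_continuous) simp
      show "continuous_on ({0..T} \<times> cbox 0 1) (\<lambda>(t, \<xi>). D 1 0 t \<xi> * e \<xi>)"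
        using cDe[of 1] by simp
    qed (use s in auto)
    then show ?thesis
      unfolding inner[OF s] by (rule has_field_derivative_transform_within[OF _ zero_less_one s]) (simp add: inner)
  qed
  have "((\<lambda>s. mk_L2 (D 1 0 s) \<bullet> eb i) has_integral (mk_L2 (D 0 0 t) \<bullet> eb i - mk_L2 (D 0 0 0) \<bullet> eb i)) {0..t}"
  proof (rule fundamental_theorem_of_calculus)
    fix s assume "s \<in> {0..t}"
    then have "s \<in> {0..T}" "{0..t} \<subseteq> {0..T}" using t by auto
    from DERIV_subset[OF der[OF this(1)] this(2)]
    show "((\<lambda>t. mk_L2 (D 0 0 t) \<bullet> eb i) has_vector_derivative mk_L2 (D 1 0 s) \<bullet> eb i) (at s within {0..t})"
      by (simp add: has_real_derivative_iff_has_vector_derivative)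
  qed (use t in auto)
  moreover have "(\<integral>s. mk_L2 (D 1 0 s) \<bullet> eb i \<partial>lebesgue_on {0..t}) = integral {0..t} (\<lambda>s. mk_L2 (D 1 0 s) \<bullet> eb i)"
    using t by (intro integral_Icc_HK(2) integrable_continuous_Icc continuous_on_subset[OF cont]) auto
  ultimately show ?thesis by (simp add: integral_unique)
qed

text \<open>
  The smooth approximations \<open>a\<^sub>n\<close> satisfy \<open>a\<^sub>n(t) - \<integral>\<^sub>0\<^sup>t a\<^sub>n' = a\<^sub>n(0)\<close>, so the \<open>L\<^sup>1\<close> limit \<open>c\<close> of the
  left-hand sides is almost everywhere equal to its mean \<open>m\<close>.
\<close>

lemma W12_time_deriv_inner_eb:
  assumes T: "T > 0" and z: "W12_time_deriv T z zt" and t: "t \<in> {0..T}" and i: "i \<ge> 1"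
  shows "z t \<bullet> eb i = z 0 \<bullet> eb i + (\<integral>s. zt s \<bullet> eb i \<partial>lebesgue_on {0..t})"
proof -
  let ?M = "lebesgue_on {0..T}"
  have neb: "norm (eb i) = 1"
    using i by (simp add: norm_eq_sqrt_inner eb_orthonormal)
  have cz: "continuous_on {0..T} z" and zt: "zt \<in> L2_path T UNIV"
    using z by (auto simp: W12_time_deriv_def C_path_def)
  obtain zx zxx D where D: "\<And>n::nat. smooth_jet T (D n)"
    and lim: "(\<lambda>n. W12_norm T
           (\<lambda>t. z t - mk_L2 (D n 0 0 t)) (\<lambda>t. zt t - mk_L2 (D n 1 0 t))
           (\<lambda>t. zx t - mk_L2 (D n 0 1 t)) (\<lambda>t. zxx t - mk_L2 (D n 0 2 t))) \<longlonglongrightarrow> 0"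
    using z unfolding W12_time_deriv_def by blast
  define u where "u n t = z t - mk_L2 (D n 0 0 t)" for n t
  define v where "v n t = zt t - mk_L2 (D n 1 0 t)" for n t
  have cD: "continuous_on {0..T} (\<lambda>t. mk_L2 (D n k 0 t))" for n k
    using D[of n] by (intro continuous_on_mk_L2) (auto simp: smooth_jet_def)
  have u: "u n \<in> L2_path T UNIV" for n
    unfolding u_def by (intro L2_path_continuous continuous_intros cz cD)
  have v: "v n \<in> L2_path T UNIV" for n
    unfolding v_def by (intro L2_path_diff zt L2_path_continuous cD)
  define w where "w n = W12_norm T (u n) (v n)
      (\<lambda>t. zx t - mk_L2 (D n 0 1 t)) (\<lambda>t. zxx t - mk_L2 (D n 0 2 t))" for n
  have w0: "w \<longlonglongrightarrow> 0" using lim unfolding w_def u_def v_def .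
  have le: "sqrt (L2_path_sqnorm T (u n)) \<le> w n" "sqrt (L2_path_sqnorm T (v n)) \<le> w n" for n
    unfolding w_def W12_norm_def using L2_path_sqnorm_nonneg by (auto simp: add_increasing add_increasing2)
  have L1: "(\<integral>t. \<bar>f n t \<bullet> eb i\<bar> \<partial>?M) \<le> sqrt T * w n"
    if f: "f n \<in> L2_path T UNIV" and fw: "sqrt (L2_path_sqnorm T (f n)) \<le> w n" for f n
  proof -
    have "(\<integral>t. \<bar>f n t \<bullet> eb i\<bar> \<partial>?M) \<le> (\<integral>t. norm (f n t) \<partial>?M)"
    proof (rule integral_mono)
      show "\<bar>f n t \<bullet> eb i\<bar> \<le> norm (f n t)" for t
        using Cauchy_Schwarz_ineq2[of "f n t" "eb i"] neb by simp
    qed (use L2_path_integrable[OF f] in \<open>auto intro: integrable_inner_eb\<close>)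
    also have "\<dots> \<le> sqrt T * sqrt (L2_path_sqnorm T (f n))"
      by (rule L2_path_L1_le[OF f T])
    also have "\<dots> \<le> sqrt T * w n"
      using T by (intro mult_left_mono fw) auto
    finally show ?thesis .
  qed
  define b where "b s = zt s \<bullet> eb i" for s
  have ib: "integrable ?M b"
    unfolding b_def by (intro integrable_inner_eb L2_path_integrable zt)
  define c where "c t = z t \<bullet> eb i - (\<integral>s. b s \<partial>lebesgue_on {0..t})" for t
  have cc: "continuous_on {0..T} c"
    unfolding c_def by (intro continuous_intros cz continuous_on_integral_Icc ib)
  define a0 where "a0 n = mk_L2 (D n 0 0 0) \<bullet> eb i" for n
  have iu: "integrable ?M (\<lambda>t. \<bar>u n t \<bullet> eb i\<bar>)" "integrable ?M (\<lambda>t. \<bar>v n t \<bullet> eb i\<bar>)" for n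
    using L2_path_integrable[OF u] L2_path_integrable[OF v] by (auto intro: integrable_inner_eb)
  have ca: "(\<integral>t. \<bar>c t - a0 n\<bar> \<partial>?M) \<le> (1 + T) * (sqrt T * w n)" for n
  proof -
    define V where "V = (\<integral>t. \<bar>v n t \<bullet> eb i\<bar> \<partial>?M)"
    \<comment> \<open>The error in the time integral of the derivative is bounded by
      \<open>V\<close> uniformly in \<open>t\<close>; only the error of the function itself has to
      be integrated.\<close>
    have pt: "\<bar>c t - a0 n\<bar> \<le> \<bar>u n t \<bullet> eb i\<bar> + V" if t: "t \<in> {0..T}" for t
    proof -
      have sub: "{0..t} \<subseteq> {0..T}" using t by auto
      have ic: "integrable (lebesgue_on {0..t}) (\<lambda>s. mk_L2 (D n 1 0 s) \<bullet> eb i)"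
        by (intro integrable_continuous_Icc continuous_intros continuous_on_subset[OF cD sub])
      have "a0 n = mk_L2 (D n 0 0 t) \<bullet> eb i - (\<integral>s. mk_L2 (D n 1 0 s) \<bullet> eb i \<partial>lebesgue_on {0..t})"
        using smooth_jet_inner_eb[OF D t, of n i] by (simp add: a0_def)
      then have "c t - a0 n = u n t \<bullet> eb i
          - ((\<integral>s. b s \<partial>lebesgue_on {0..t}) - (\<integral>s. mk_L2 (D n 1 0 s) \<bullet> eb i \<partial>lebesgue_on {0..t}))"
        by (simp add: c_def u_def inner_diff_left)
      also have "(\<integral>s. b s \<partial>lebesgue_on {0..t}) - (\<integral>s. mk_L2 (D n 1 0 s) \<bullet> eb i \<partial>lebesgue_on {0..t})
          = (\<integral>s. v n s \<bullet> eb i \<partial>lebesgue_on {0..t})"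
        using Bochner_Integration.integral_diff[OF integrable_Icc_mono[OF ib sub] ic]
        by (simp only: v_def b_def[abs_def] inner_diff_left)
      finally have "\<bar>c t - a0 n\<bar> \<le> \<bar>u n t \<bullet> eb i\<bar> + \<bar>\<integral>s. v n s \<bullet> eb i \<partial>lebesgue_on {0..t}\<bar>"
        by linarith
      also have "\<bar>\<integral>s. v n s \<bullet> eb i \<partial>lebesgue_on {0..t}\<bar> \<le> (\<integral>s. \<bar>v n s \<bullet> eb i\<bar> \<partial>lebesgue_on {0..t})"
        using integral_norm_bound[of "lebesgue_on {0..t}" "\<lambda>s. v n s \<bullet> eb i"] by simp
      also have "\<dots> \<le> V"
      proof -
        have "integral {0..t} (\<lambda>s. \<bar>v n s \<bullet> eb i\<bar>) \<le> integral {0..T} (\<lambda>s. \<bar>v n s \<bullet> eb i\<bar>)"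
          by (intro integral_subset_le sub integral_Icc_HK(1) iu integrable_Icc_mono[OF iu(2) sub]) auto
        then show ?thesis
          unfolding V_def by (simp add: integral_Icc_HK(2)[OF iu(2)] integral_Icc_HK(2)[OF integrable_Icc_mono[OF iu(2) sub]])
      qed
      finally show ?thesis by simp
    qed
    have "(\<integral>t. \<bar>c t - a0 n\<bar> \<partial>?M) \<le> (\<integral>t. \<bar>u n t \<bullet> eb i\<bar> + V \<partial>?M)"
      by (intro integral_mono Bochner_Integration.integrable_add iu integrable_continuous_Icc continuous_intros cc pt) auto
    also have "\<dots> = (\<integral>t. \<bar>u n t \<bullet> eb i\<bar> \<partial>?M) + T * V"
      using T by (subst Bochner_Integration.integral_add) (auto intro!: iu integrable_continuous_Icc simp: measure_Icc)
    also have "\<dots> \<le> sqrt T * w n + T * (sqrt T * w n)"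
      unfolding V_def using T by (intro add_mono mult_left_mono L1 u v le) auto
    finally show ?thesis by (simp add: algebra_simps)
  qed
  \<comment> \<open>Comparison with the mean avoids any statement about convergence of the initial
    coordinates \<open>a0 n\<close>: replacing \<open>a0 n\<close> by \<open>m\<close> merely
    doubles the bound.\<close>
  define m where "m = (\<integral>t. c t \<partial>?M) / T"
  have ma: "T * \<bar>m - a0 n\<bar> \<le> (1 + T) * (sqrt T * w n)" for n
  proof -
    have "T * (m - a0 n) = (\<integral>t. c t - a0 n \<partial>?M)"
      using T by (subst Bochner_Integration.integral_diff)
        (auto intro!: integrable_continuous_Icc cc simp: measure_Icc m_def right_diff_distrib)
    then have "T * \<bar>m - a0 n\<bar> = \<bar>\<integral>t. c t - a0 n \<partial>?M\<bar>"
      using T by (metis abs_mult abs_of_pos)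
    also have "\<dots> \<le> (\<integral>t. \<bar>c t - a0 n\<bar> \<partial>?M)"
      using integral_norm_bound[of ?M "\<lambda>t. c t - a0 n"] by simp
    finally show ?thesis using ca[of n] by linarith
  qed
  have cm: "(\<integral>t. \<bar>c t - m\<bar> \<partial>?M) \<le> 2 * ((1 + T) * (sqrt T * w n))" for n
  proof -
    have "(\<integral>t. \<bar>c t - m\<bar> \<partial>?M) \<le> (\<integral>t. \<bar>c t - a0 n\<bar> + \<bar>m - a0 n\<bar> \<partial>?M)"
      by (intro integral_mono integrable_continuous_Icc continuous_intros cc) auto
    also have "\<dots> = (\<integral>t. \<bar>c t - a0 n\<bar> \<partial>?M) + T * \<bar>m - a0 n\<bar>"
      using T by (subst Bochner_Integration.integral_add)
        (auto intro!: integrable_continuous_Icc continuous_intros cc simp: measure_Icc)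
    finally show ?thesis using ca[of n] ma[of n] by linarith
  qed
  have "(\<lambda>n. 2 * ((1 + T) * (sqrt T * w n))) \<longlonglongrightarrow> 2 * ((1 + T) * (sqrt T * 0))"
    by (intro tendsto_intros w0)
  then have "(\<integral>t. \<bar>c t - m\<bar> \<partial>?M) \<le> 2 * ((1 + T) * (sqrt T * 0))"
    by (rule LIMSEQ_le_const) (use cm in auto)
  moreover have "0 \<le> (\<integral>t. \<bar>c t - m\<bar> \<partial>?M)" by simp
  ultimately have "(\<integral>t. \<bar>c t - m\<bar> \<partial>?M) = 0" by simp
  then have "integral {0..T} (\<lambda>t. \<bar>c t - m\<bar>) = 0"
    by (subst (asm) integral_Icc_HK(2)) (auto intro!: integrable_continuous_Icc continuous_intros cc)
  \<comment> \<open>Continuity of the chosen representative \<open>z\<close> upgrades the statement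
    from almost every \<open>t\<close> to every \<open>t\<close>, in particular to t = 0, where
    \<open>c\<close> equals the initial coordinate.\<close>
  then have "\<forall>t\<in>{0..T}. \<bar>c t - m\<bar> = 0"
    using T by (subst (asm) integral_eq_0_iff) (auto intro!: continuous_intros cc)
  then have "c t = m" "c 0 = m" using t T by auto
  moreover have "(\<integral>s. b s \<partial>lebesgue_on {0..0}) = 0"
    using integral_Icc_HK(2)[OF integrable_Icc_mono[OF ib, of 0 0]] T by simp
  ultimately show ?thesis by (simp add: c_def b_def)
qed

section \<open>Mild solutions in coordinates\<close>

lemma exp_minus_eq_iff: "exp (c * t) * a = b \<longleftrightarrow> a = exp (- c * t) * (b :: real)"
  by (auto simp: exp_minus field_simps)

lemma exp_convolution_add:
  fixes v w :: "real \<Rightarrow> real"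
  assumes "integrable (lebesgue_on {0..t}) v" "integrable (lebesgue_on {0..t}) w"
  shows "(\<integral>s. exp (- c * (t - s)) * v s \<partial>lebesgue_on {0..t}) + (\<integral>s. exp (- c * (t - s)) * w s \<partial>lebesgue_on {0..t})
    = exp (- c * t) * (\<integral>s. exp (c * s) * (v s + w s) \<partial>lebesgue_on {0..t})"
proof -
  have i: "integrable (lebesgue_on {0..t}) (\<lambda>s. exp (c * s) * v s)"
    "integrable (lebesgue_on {0..t}) (\<lambda>s. exp (c * s) * w s)"
    by (intro integrable_continuous_mult continuous_intros assms)+
  show ?thesis
    unfolding exp_convolution distrib_left Bochner_Integration.integral_add[OF i] ..
qed

text \<open>The semigroup acts on the coordinate with index \<open>j\<close> as multiplication by an
  exponential, and \<open>exp (- lam j * t)\<close> can be pulled out of both convolutions.\<close>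

lemma mild_sol_iff:
  assumes R: "bounded_linear (op_sqrt Q)" and z: "z \<in> C_path T UNIV" and \<phi>: "\<phi> \<in> L2_path T UNIV"
    and Fz: "integrable (lebesgue_on {0..T}) (\<lambda>s. F (z s))"
  shows "mild_sol F Q T x \<phi> z \<longleftrightarrow> (\<forall>t\<in>{0..T}. \<forall>j\<ge>1. exp (lam j * t) * (z t \<bullet> eb j) = x \<bullet> eb j
    + (\<integral>s. exp (lam j * s) * (F (z s) \<bullet> eb j + op_sqrt Q (\<phi> s) \<bullet> eb j) \<partial>lebesgue_on {0..t}))"
proof -
  have "z t = semigr t x + (\<integral>s. semigr (t - s) (F (z s)) \<partial>lebesgue_on {0..t})
        + (\<integral>s. semigr (t - s) (op_sqrt Q (\<phi> s)) \<partial>lebesgue_on {0..t}) \<longleftrightarrow>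
      (\<forall>j\<ge>1. exp (lam j * t) * (z t \<bullet> eb j) = x \<bullet> eb j
    + (\<integral>s. exp (lam j * s) * (F (z s) \<bullet> eb j + op_sqrt Q (\<phi> s) \<bullet> eb j) \<partial>lebesgue_on {0..t}))"
    (is "z t = ?r \<longleftrightarrow> _") if t: "t \<in> {0..T}" for t
  proof -
    have sub: "{0..t} \<subseteq> {0..T}" using t by auto
    have iF: "integrable (lebesgue_on {0..t}) (\<lambda>s. F (z s))"
      by (rule integrable_Icc_mono[OF Fz sub])
    have iR: "integrable (lebesgue_on {0..t}) (\<lambda>s. op_sqrt Q (\<phi> s))"
      by (rule integrable_Icc_mono[OF L2_path_integrable[OF L2_path_bounded_linear[OF R \<phi>]] sub])
    have "?r \<bullet> eb j = exp (- lam j * t) * (x \<bullet> eb j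
        + (\<integral>s. exp (lam j * s) * (F (z s) \<bullet> eb j + op_sqrt Q (\<phi> s) \<bullet> eb j) \<partial>lebesgue_on {0..t}))"
      if j: "j \<ge> 1" for j
      using t j exp_convolution_add[OF integrable_inner_eb[OF iF, of j] integrable_inner_eb[OF iR, of j], of "lam j"]
      by (simp add: inner_add_left semigr_inner_eb semigr_integral_inner_eb[OF iF j] semigr_integral_inner_eb[OF iR j]
          distrib_left)
    then show ?thesis
      unfolding exp_minus_eq_iff using L2_eqI[of "z t" ?r] by auto
  qed
  then show ?thesis
    unfolding mild_sol_def using z by blast
qed

lemma inner_eb_Hn: "u \<in> Hn n \<Longrightarrow> n < j \<Longrightarrow> u \<bullet> eb j = 0"
  using Pn_inner_eb[of j n u] by (simp add: Pn_Hn)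

text \<open>As in the exact case, but only the first \<open>n\<close> coordinates carry information:
  the others vanish on both sides since the path stays in \<open>Hn n\<close>. The projections in
  \<open>Fn\<close> and \<open>Qn_sqrt\<close> leave the first \<open>n\<close> coordinates
  unchanged and so drop out.\<close>

lemma mild_sol_n_iff:
  assumes R: "bounded_linear (op_sqrt Q)" and z: "z \<in> C_path T (Hn n)" and \<phi>: "\<phi> \<in> L2_path T UNIV"
    and Fz: "integrable (lebesgue_on {0..T}) (\<lambda>s. F (z (\<tau> * of_int \<lfloor>s / \<tau>\<rfloor>)))"
  shows "mild_sol_n F Q T n \<tau> (Pn n x) \<phi> z \<longleftrightarrow>
    (\<forall>t\<in>{0..T}. \<forall>j\<in>{1..n}. exp (lam j * t) * (z t \<bullet> eb j) = x \<bullet> eb j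
      + (\<integral>s. exp (lam j * s) * (F (z (\<tau> * of_int \<lfloor>s / \<tau>\<rfloor>)) \<bullet> eb j + op_sqrt Q (\<phi> s) \<bullet> eb j) \<partial>lebesgue_on {0..t}))"
proof -
  have "z t = semigr_n n t (Pn n x)
        + (\<integral>s. semigr_n n (t - s) (Fn F n (z (\<tau> * of_int \<lfloor>s / \<tau>\<rfloor>))) \<partial>lebesgue_on {0..t})
        + (\<integral>s. semigr_n n (t - s) (Qn_sqrt Q n (\<phi> s)) \<partial>lebesgue_on {0..t}) \<longleftrightarrow>
      (\<forall>j\<in>{1..n}. exp (lam j * t) * (z t \<bullet> eb j) = x \<bullet> eb j
      + (\<integral>s. exp (lam j * s) * (F (z (\<tau> * of_int \<lfloor>s / \<tau>\<rfloor>)) \<bullet> eb j + op_sqrt Q (\<phi> s) \<bullet> eb j) \<partial>lebesgue_on {0..t}))"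
    (is "z t = ?r \<longleftrightarrow> _") if t: "t \<in> {0..T}" for t
  proof -
    have sub: "{0..t} \<subseteq> {0..T}" using t by auto
    have iF: "integrable (lebesgue_on {0..t}) (\<lambda>s. F (z (\<tau> * of_int \<lfloor>s / \<tau>\<rfloor>)))"
      by (rule integrable_Icc_mono[OF Fz sub])
    have iR: "integrable (lebesgue_on {0..t}) (\<lambda>s. op_sqrt Q (\<phi> s))"
      by (rule integrable_Icc_mono[OF L2_path_integrable[OF L2_path_bounded_linear[OF R \<phi>]] sub])
    define I where "I j = exp (- lam j * t) * (x \<bullet> eb j
        + (\<integral>s. exp (lam j * s) * (F (z (\<tau> * of_int \<lfloor>s / \<tau>\<rfloor>)) \<bullet> eb j + op_sqrt Q (\<phi> s) \<bullet> eb j) \<partial>lebesgue_on {0..t}))" for j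
    have r: "?r = (\<Sum>j=1..n. I j *\<^sub>R eb j)"
      unfolding Fn_def Qn_sqrt_def semigr_n_integral[OF iF] semigr_n_integral[OF iR] sum.distrib[symmetric]
        semigr_n_Pn[of n t x] scaleR_left_distrib[symmetric] I_def
      using exp_convolution_add[OF integrable_inner_eb[OF iF] integrable_inner_eb[OF iR]]
      by (intro sum.cong refl) (simp add: distrib_left add.assoc)
    have rj: "?r \<bullet> eb j = (if j \<in> {1..n} then I j else 0)" if "j \<ge> 1" for j
      unfolding r using that by (subst inner_sum_eb) auto
    have zn: "z t \<in> Hn n" using z t by (auto simp: C_path_def)
    have "z t = ?r \<longleftrightarrow> (\<forall>j\<ge>1. z t \<bullet> eb j = ?r \<bullet> eb j)"
      using L2_eqI[of "z t" ?r] by auto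
    also have "\<dots> \<longleftrightarrow> (\<forall>j\<in>{1..n}. z t \<bullet> eb j = I j)"
    proof (intro iffI ballI allI impI)
      fix j assume *: "\<forall>j\<ge>1. z t \<bullet> eb j = ?r \<bullet> eb j" and j: "j \<in> {1..n}"
      then have "z t \<bullet> eb j = ?r \<bullet> eb j" by simp
      then show "z t \<bullet> eb j = I j" using rj[of j] j by simp
    next
      fix j :: nat assume *: "\<forall>j\<in>{1..n}. z t \<bullet> eb j = I j" and j: "1 \<le> j"
      show "z t \<bullet> eb j = ?r \<bullet> eb j"
        using * j rj[OF j] inner_eb_Hn[OF zn, of j] by (cases "j \<le> n") auto
    qed
    finally show ?thesis
      unfolding exp_minus_eq_iff I_def .
  qed
  then show ?thesis
    unfolding mild_sol_n_def using z by blast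
qed

section \<open>Uniqueness of the control\<close>

text \<open>The common term \<open>a\<close> cancels in the difference of the integrands, whose
  primitive is zero; the exponential is then divided out. Below, \<open>a\<close> is the drift and
  \<open>f\<close>, \<open>g\<close> are the contributions of two controls.\<close>

lemma exp_integrals_unique:
  fixes a f g :: "real \<Rightarrow> real"
  assumes a: "integrable (lebesgue_on {0..T}) a" and f: "integrable (lebesgue_on {0..T}) f"
    and g: "integrable (lebesgue_on {0..T}) g"
    and eq: "\<And>t. t \<in> {0..T} \<Longrightarrow> (\<integral>s. exp (c * s) * (a s + f s) \<partial>lebesgue_on {0..t})
      = (\<integral>s. exp (c * s) * (a s + g s) \<partial>lebesgue_on {0..t})"
  shows "AE s in lebesgue_on {0..T}. f s = g s"
proof -
  have i: "integrable (lebesgue_on {0..T}) (\<lambda>s. exp (c * s) * (a s + f s))"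
    "integrable (lebesgue_on {0..T}) (\<lambda>s. exp (c * s) * (a s + g s))"
    by (intro integrable_continuous_mult continuous_intros Bochner_Integration.integrable_add assms)+
  have "AE s in lebesgue_on {0..T}. exp (c * s) * (a s + f s) - exp (c * s) * (a s + g s) = 0"
  proof (rule AE_zero_if_integrals_zero)
    fix t assume t: "t \<in> {0..T}"
    then have sub: "{0..t} \<subseteq> {0..T}" by auto
    show "(\<integral>s. exp (c * s) * (a s + f s) - exp (c * s) * (a s + g s) \<partial>lebesgue_on {0..t}) = 0"
      using eq[OF t] by (subst Bochner_Integration.integral_diff) (auto intro!: integrable_Icc_mono[OF _ sub] i)
  qed (intro Bochner_Integration.integrable_diff i)
  then show ?thesis
    by eventually_elim simp
qed

text \<open>The infimum runs over a single value. Any admissible control agrees with \<phi> almost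
  everywhere: each coordinate of its image under the square root of \<open>Q\<close> is determined,
  countably many null sets are discarded, and \<open>r i \<noteq> 0\<close> recovers the coordinates
  of the control.\<close>

lemma rate_eq:
  assumes R: "bounded_linear (op_sqrt Q)"
    and r: "\<And>i u. i \<ge> 1 \<Longrightarrow> op_sqrt Q u \<bullet> eb i = r i * (u \<bullet> eb i)" "\<And>i. i \<ge> 1 \<Longrightarrow> r i \<noteq> 0"
    and Fz: "integrable (lebesgue_on {0..T}) (\<lambda>s. F (z s))"
    and \<phi>: "\<phi> \<in> L2_path T UNIV" "mild_sol F Q T x \<phi> z"
  shows "rate F Q T x z = ereal (1 / 2 * L2_path_sqnorm T \<phi>)"
proof -
  have z: "z \<in> C_path T UNIV" using \<phi>(2) by (simp add: mild_sol_def)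
  have eq: "L2_path_sqnorm T \<psi> = L2_path_sqnorm T \<phi>" if \<psi>: "\<psi> \<in> L2_path T UNIV" "mild_sol F Q T x \<psi> z" for \<psi>
  proof -
    have "AE s in lebesgue_on {0..T}. op_sqrt Q (\<psi> s) \<bullet> eb (Suc i) = op_sqrt Q (\<phi> s) \<bullet> eb (Suc i)" for i
    proof (rule exp_integrals_unique)
      show "(\<integral>s. exp (lam (Suc i) * s) * (F (z s) \<bullet> eb (Suc i) + op_sqrt Q (\<psi> s) \<bullet> eb (Suc i)) \<partial>lebesgue_on {0..t})
        = (\<integral>s. exp (lam (Suc i) * s) * (F (z s) \<bullet> eb (Suc i) + op_sqrt Q (\<phi> s) \<bullet> eb (Suc i)) \<partial>lebesgue_on {0..t})"
        if "t \<in> {0..T}" for t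
        using mild_sol_iff[OF R z \<phi>(1) Fz, THEN iffD1, OF \<phi>(2), rule_format, OF that, of "Suc i"]
          mild_sol_iff[OF R z \<psi>(1) Fz, THEN iffD1, OF \<psi>(2), rule_format, OF that, of "Suc i"]
        by simp
    qed (intro integrable_inner_eb Fz L2_path_integrable L2_path_bounded_linear[OF R] \<phi> \<psi>)+
    then have "AE s in lebesgue_on {0..T}. \<forall>i. op_sqrt Q (\<psi> s) \<bullet> eb (Suc i) = op_sqrt Q (\<phi> s) \<bullet> eb (Suc i)"
      by (simp add: AE_all_countable)
    then have "AE s in lebesgue_on {0..T}. \<psi> s = \<phi> s"
    proof eventually_elim
      case (elim s)
      show ?case
      proof (rule L2_eqI)
        fix i :: nat assume i: "i \<ge> 1"
        then show "\<psi> s \<bullet> eb i = \<phi> s \<bullet> eb i"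
          using elim[rule_format, of "i - 1"] r(1)[OF i] r(2)[OF i] by simp
      qed
    qed
    then show ?thesis
      unfolding L2_path_sqnorm_def using \<phi> \<psi> by (intro integral_cong_AE) (auto simp: L2_path_iff)
  qed
  have "(INF \<psi>\<in>{\<psi> \<in> L2_path T UNIV. mild_sol F Q T x \<psi> z}. ereal (L2_path_sqnorm T \<psi>)) = ereal (L2_path_sqnorm T \<phi>)"
  proof (rule INF_eq_const)
    fix \<psi> assume "\<psi> \<in> {\<psi> \<in> L2_path T UNIV. mild_sol F Q T x \<psi> z}"
    then show "ereal (L2_path_sqnorm T \<psi>) = ereal (L2_path_sqnorm T \<phi>)"
      by (simp only: mem_Collect_eq eq)
  qed (use \<phi> in blast)
  then show ?thesis by (simp add: rate_def)
qed

lemma L2_path_subset: "\<phi> \<in> L2_path T V \<Longrightarrow> \<phi> \<in> L2_path T UNIV"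
  by (simp add: L2_path_def)

text \<open>The equation determines the coordinates of a control up to index \<open>n\<close>; the
  remaining ones vanish because admissible controls take values in \<open>Hn n\<close> almost
  everywhere.\<close>

lemma rate_n_eq:
  assumes R: "bounded_linear (op_sqrt Q)"
    and r: "\<And>i u. i \<ge> 1 \<Longrightarrow> op_sqrt Q u \<bullet> eb i = r i * (u \<bullet> eb i)" "\<And>i. i \<ge> 1 \<Longrightarrow> r i \<noteq> 0"
    and Fz: "integrable (lebesgue_on {0..T}) (\<lambda>s. F (z (\<tau> * of_int \<lfloor>s / \<tau>\<rfloor>)))"
    and \<phi>: "\<phi> \<in> L2_path T (Hn n)" "mild_sol_n F Q T n \<tau> (Pn n x) \<phi> z"
  shows "rate_n F Q T n \<tau> (Pn n x) z = ereal (1 / 2 * L2_path_sqnorm T \<phi>)"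
proof -
  have z: "z \<in> C_path T (Hn n)" using \<phi>(2) by (simp add: mild_sol_n_def)
  note \<phi>U = L2_path_subset[OF \<phi>(1)]
  have eq: "L2_path_sqnorm T \<psi> = L2_path_sqnorm T \<phi>"
    if \<psi>: "\<psi> \<in> L2_path T (Hn n)" "mild_sol_n F Q T n \<tau> (Pn n x) \<psi> z" for \<psi>
  proof -
    note \<psi>U = L2_path_subset[OF \<psi>(1)]
    have *: "AE s in lebesgue_on {0..T}. op_sqrt Q (\<psi> s) \<bullet> eb i = op_sqrt Q (\<phi> s) \<bullet> eb i" if i: "i \<in> {1..n}" for i
    proof (rule exp_integrals_unique)
      show "(\<integral>s. exp (lam i * s) * (F (z (\<tau> * of_int \<lfloor>s / \<tau>\<rfloor>)) \<bullet> eb i + op_sqrt Q (\<psi> s) \<bullet> eb i) \<partial>lebesgue_on {0..t})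
        = (\<integral>s. exp (lam i * s) * (F (z (\<tau> * of_int \<lfloor>s / \<tau>\<rfloor>)) \<bullet> eb i + op_sqrt Q (\<phi> s) \<bullet> eb i) \<partial>lebesgue_on {0..t})"
        if "t \<in> {0..T}" for t
        using mild_sol_n_iff[OF R z \<phi>U Fz, THEN iffD1, OF \<phi>(2), rule_format, OF that i]
          mild_sol_n_iff[OF R z \<psi>U Fz, THEN iffD1, OF \<psi>(2), rule_format, OF that i]
        by simp
    qed (intro integrable_inner_eb Fz L2_path_integrable L2_path_bounded_linear[OF R] \<phi>U \<psi>U)+
    have "AE s in lebesgue_on {0..T}. \<forall>i\<in>{1..n}. op_sqrt Q (\<psi> s) \<bullet> eb i = op_sqrt Q (\<phi> s) \<bullet> eb i"
      by (rule AE_finite_allI) (use * in auto)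
    moreover have "AE s in lebesgue_on {0..T}. \<psi> s \<in> Hn n" "AE s in lebesgue_on {0..T}. \<phi> s \<in> Hn n"
      using \<phi>(1) \<psi>(1) by (auto simp: L2_path_def)
    ultimately have "AE s in lebesgue_on {0..T}. \<psi> s = \<phi> s"
    proof eventually_elim
      case (elim s)
      show ?case
      proof (rule L2_eqI)
        fix i :: nat assume i: "i \<ge> 1"
        show "\<psi> s \<bullet> eb i = \<phi> s \<bullet> eb i"
        proof (cases "i \<le> n")
          case True
          then have "op_sqrt Q (\<psi> s) \<bullet> eb i = op_sqrt Q (\<phi> s) \<bullet> eb i"
            using elim(1) i by simp
          then show ?thesis using r(1)[OF i] r(2)[OF i] by simp
        next
          case False
          then show ?thesis using elim inner_eb_Hn by simp
        qed
      qed
    qed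
    then show ?thesis
      unfolding L2_path_sqnorm_def using \<phi>U \<psi>U by (intro integral_cong_AE) (auto simp: L2_path_iff)
  qed
  have "(INF \<psi>\<in>{\<psi> \<in> L2_path T (Hn n). mild_sol_n F Q T n \<tau> (Pn n x) \<psi> z}. ereal (L2_path_sqnorm T \<psi>)) = ereal (L2_path_sqnorm T \<phi>)"
  proof (rule INF_eq_const)
    fix \<psi> assume "\<psi> \<in> {\<psi> \<in> L2_path T (Hn n). mild_sol_n F Q T n \<tau> (Pn n x) \<psi> z}"
    then show "ereal (L2_path_sqnorm T \<psi>) = ereal (L2_path_sqnorm T \<phi>)"
      by (simp only: mem_Collect_eq eq)
  qed (use \<phi> in blast)
  then show ?thesis by (simp add: rate_n_def)
qed

text \<open>Each coordinate of \<open>z\<close> is absolutely continuous, so the product rule with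
  \<open>exp (lam j * t)\<close> gives the integrand
  \<open>lam j * (z s \<bullet> eb j) + zt s \<bullet> eb j\<close>. By \<open>op_A_inner_eb\<close>
  this is the coordinate of \<open>zt s - op_A (z s)\<close>, that is, of drift plus
  control.\<close>

lemma W12_Q_mild_sol:
  assumes R: "bounded_linear (op_sqrt Q)" and F: "continuous_on UNIV F" and T: "T > 0"
    and z: "z \<in> W12_Q F Q T"
  obtains \<phi> where "\<phi> \<in> L2_path T UNIV" "mild_sol F Q T (z 0) \<phi> z"
proof -
  obtain zt where zt: "W12_time_deriv T z zt"
    and ae: "AE t in lebesgue_on {0..T}. z t \<in> dom_A \<and> zt t - op_A (z t) - F (z t) \<in> range (op_sqrt Q)"
    and \<phi>: "(\<lambda>t. op_inv_sqrt Q (zt t - op_A (z t) - F (z t))) \<in> L2_path T UNIV"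
    using z by (auto simp: W12_Q_def)
  define \<phi> where "\<phi> t = op_inv_sqrt Q (zt t - op_A (z t) - F (z t))" for t
  have p: "\<phi> \<in> L2_path T UNIV" using \<phi> unfolding \<phi>_def .
  have cz: "continuous_on {0..T} z" and zC: "z \<in> C_path T UNIV" and ztL: "zt \<in> L2_path T UNIV"
    using zt by (auto simp: W12_time_deriv_def C_path_def)
  have cF: "continuous_on {0..T} (\<lambda>s. F (z s))"
    by (rule continuous_on_compose2[OF F cz]) auto
  have Fz: "integrable (lebesgue_on {0..T}) (\<lambda>s. F (z s))"
    by (rule integrable_continuous_Icc[OF cF])
  have iR: "integrable (lebesgue_on {0..T}) (\<lambda>s. op_sqrt Q (\<phi> s))"
    by (rule L2_path_integrable[OF L2_path_bounded_linear[OF R p]])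
  have "mild_sol F Q T (z 0) \<phi> z"
    unfolding mild_sol_iff[OF R zC p Fz]
  proof (intro ballI allI impI)
    fix t and j :: nat assume t: "t \<in> {0..T}" and j: "j \<ge> 1"
    have sub: "{0..t} \<subseteq> {0..T}" using t by auto
    have "exp (lam j * t) * (z t \<bullet> eb j)
        = z 0 \<bullet> eb j + (\<integral>s. exp (lam j * s) * (lam j * (z s \<bullet> eb j) + zt s \<bullet> eb j) \<partial>lebesgue_on {0..t})"
      by (rule exp_weighted_integral[OF integrable_inner_eb[OF L2_path_integrable[OF ztL]] _ t])
        (rule W12_time_deriv_inner_eb[OF T zt _ j])
    also have "(\<integral>s. exp (lam j * s) * (lam j * (z s \<bullet> eb j) + zt s \<bullet> eb j) \<partial>lebesgue_on {0..t})
        = (\<integral>s. exp (lam j * s) * (F (z s) \<bullet> eb j + op_sqrt Q (\<phi> s) \<bullet> eb j) \<partial>lebesgue_on {0..t})"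
    proof (rule integral_cong_AE)
      show "(\<lambda>s. exp (lam j * s) * (lam j * (z s \<bullet> eb j) + zt s \<bullet> eb j)) \<in> borel_measurable (lebesgue_on {0..t})"
        by (intro borel_measurable_integrable integrable_continuous_mult Bochner_Integration.integrable_add
            integrable_inner_eb integrable_Icc_mono[OF L2_path_integrable[OF ztL] sub] integrable_continuous_Icc
            continuous_on_subset[OF _ sub] continuous_intros cz)
      show "(\<lambda>s. exp (lam j * s) * (F (z s) \<bullet> eb j + op_sqrt Q (\<phi> s) \<bullet> eb j)) \<in> borel_measurable (lebesgue_on {0..t})"
        by (intro borel_measurable_integrable integrable_continuous_mult Bochner_Integration.integrable_add
            integrable_inner_eb integrable_Icc_mono[OF Fz sub] integrable_Icc_mono[OF iR sub] continuous_intros)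
      have "AE s in lebesgue_on {0..t}. z s \<in> dom_A \<and> zt s - op_A (z s) - F (z s) \<in> range (op_sqrt Q)"
        using ae sub by (auto simp: AE_restrict_space_iff elim: eventually_mono)
      then show "AE s in lebesgue_on {0..t}. exp (lam j * s) * (lam j * (z s \<bullet> eb j) + zt s \<bullet> eb j)
          = exp (lam j * s) * (F (z s) \<bullet> eb j + op_sqrt Q (\<phi> s) \<bullet> eb j)"
      proof eventually_elim
        case (elim s)
        \<comment> \<open>Since the residual lies in the range, \<open>inv\<close> picks an actual
          preimage of it.\<close>
        then have "op_sqrt Q (\<phi> s) = zt s - op_A (z s) - F (z s)"
          by (simp add: \<phi>_def op_inv_sqrt_def f_inv_into_f)
        then show ?case
          using op_A_inner_eb[of "z s" j] elim by (simp add: inner_diff_left)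
      qed
    qed
    finally show "exp (lam j * t) * (z t \<bullet> eb j)
        = z 0 \<bullet> eb j + (\<integral>s. exp (lam j * s) * (F (z s) \<bullet> eb j + op_sqrt Q (\<phi> s) \<bullet> eb j) \<partial>lebesgue_on {0..t})" .
  qed
  with p show ?thesis by (rule that)
qed

section \<open>The discrete mild solution\<close>

text \<open>A recursion principle in which the value at \<open>m\<close> may depend on all earlier
  values through an arbitrary functional; later arguments are masked by the default
  \<open>d\<close>.\<close>

lemma nat_course_of_values:
  "\<exists>a. \<forall>m::nat. a m = \<Phi> m (\<lambda>k. if k < m then a k else d)"
proof -
  define H where "H a m = \<Phi> m (\<lambda>k. if k < m then a k else d)" for a and m :: nat
  have "H (cut (wfrec less_than H) less_than m) m = H (wfrec less_than H) m" for m
    unfolding H_def by (rule arg_cong[where f = "\<Phi> m"]) (auto simp: cut_def)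
  then have "wfrec less_than H m = H (wfrec less_than H) m" for m
    by (subst wfrec[OF wf_less_than]) simp
  then show ?thesis
    unfolding H_def by blast
qed

lemma floor_grid:
  assumes "\<tau> > 0" "0 \<le> s"
  shows "0 \<le> \<lfloor>s / \<tau>\<rfloor>" "0 \<le> \<tau> * of_int \<lfloor>s / \<tau>\<rfloor>" "\<tau> * of_int \<lfloor>s / \<tau>\<rfloor> \<le> s" "s - \<tau> * of_int \<lfloor>s / \<tau>\<rfloor> < \<tau>"
proof -
  show 0: "0 \<le> \<lfloor>s / \<tau>\<rfloor>" using assms by simp
  then show "0 \<le> \<tau> * of_int \<lfloor>s / \<tau>\<rfloor>" using assms by (intro mult_nonneg_nonneg) auto
  have "of_int \<lfloor>s / \<tau>\<rfloor> * \<tau> \<le> s / \<tau> * \<tau>" using assms by (intro mult_right_mono) auto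
  then show "\<tau> * of_int \<lfloor>s / \<tau>\<rfloor> \<le> s" using assms by (simp add: mult.commute)
  have "s / \<tau> * \<tau> < (of_int \<lfloor>s / \<tau>\<rfloor> + 1) * \<tau>" using assms by (intro mult_strict_right_mono) linarith+
  then show "s - \<tau> * of_int \<lfloor>s / \<tau>\<rfloor> < \<tau>" using assms by (simp add: algebra_simps)
qed

text \<open>Factoring through the discrete space of integers allows an arbitrary
  \<open>h\<close>.\<close>

lemma measurable_step:
  fixes \<tau> T :: real and h :: "int \<Rightarrow> 'b::topological_space"
  shows "(\<lambda>s. h \<lfloor>s / \<tau>\<rfloor>) \<in> borel_measurable (lebesgue_on {0..T})"
proof -
  have "(\<lambda>s. s / \<tau>) \<in> borel_measurable (lebesgue_on {0..T})"
    unfolding divide_inverse by (intro measurable_continuous_Icc continuous_intros)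
  moreover have "(\<lambda>x::real. \<lfloor>x\<rfloor>) \<in> measurable borel (count_space UNIV)"
    by measurable
  ultimately have "(\<lambda>s. \<lfloor>s / \<tau>\<rfloor>) \<in> measurable (lebesgue_on {0..T}) (count_space UNIV)"
    by (rule measurable_compose)
  then show ?thesis
    by (rule measurable_compose) simp
qed

lemma AE_lebesgue_on_neq: "AE s in lebesgue_on {0..t::real}. s \<noteq> c"
proof -
  have "AE s in lebesgue. s \<notin> {c}"
    by (intro AE_not_in) auto
  then show ?thesis
    by (subst AE_restrict_space_iff) auto
qed

text \<open>The drift is frozen at the last grid point, so the equation is explicit: the grid values
  follow by recursion, and the variation of constants formula \<open>V\<close> fills in the times
  between them.\<close>

lemma discrete_mild_solution_exists:
  assumes R: "bounded_linear (op_sqrt Q)" and \<phi>: "\<phi> \<in> L2_path T UNIV" and \<tau>: "\<tau> > 0"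
  obtains z where "z \<in> eff_dom_n T n (Pn n x)" "mild_sol_n F Q T n \<tau> (Pn n x) \<phi> z"
    "(\<lambda>s. F (z (\<tau> * of_int \<lfloor>s / \<tau>\<rfloor>))) \<in> L2_path T UNIV"
proof -
  define J where "J g t j = (\<integral>s. exp (lam j * s) * (F (g \<lfloor>s / \<tau>\<rfloor>) \<bullet> eb j + op_sqrt Q (\<phi> s) \<bullet> eb j) \<partial>lebesgue_on {0..t})"
    for g :: "int \<Rightarrow> L2" and t j
  define V where "V g t = (\<Sum>j=1..n. (exp (- lam j * t) * (x \<bullet> eb j + J g t j)) *\<^sub>R eb j)" for g t
  obtain a where a: "\<And>m. a m = V (\<lambda>k. if nat k < m then a (nat k) else 0) (real m * \<tau>)"
    using nat_course_of_values[of "\<lambda>m f. V (\<lambda>k. f (nat k)) (real m * \<tau>)" 0] by auto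
  define z where "z t = V (\<lambda>k. a (nat k)) t" for t
  have R\<phi>: "(\<lambda>s. op_sqrt Q (\<phi> s)) \<in> L2_path T UNIV"
    by (rule L2_path_bounded_linear[OF R \<phi>])
  have meas: "(\<lambda>s. exp (lam j * s) * (F (g \<lfloor>s / \<tau>\<rfloor>) \<bullet> eb j + op_sqrt Q (\<phi> s) \<bullet> eb j)) \<in> borel_measurable (lebesgue_on {0..t})"
    if "t \<le> T" for g t j
  proof -
    have "{0..t} \<subseteq> {0..T}" using that by auto
    from integrable_Icc_mono[OF L2_path_integrable[OF R\<phi>] this]
    have [measurable]: "(\<lambda>s. op_sqrt Q (\<phi> s)) \<in> borel_measurable (lebesgue_on {0..t})"
      by (rule borel_measurable_integrable)
    have [measurable]: "(\<lambda>s. F (g \<lfloor>s / \<tau>\<rfloor>)) \<in> borel_measurable (lebesgue_on {0..t})"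
      by (rule measurable_step)
    have [measurable]: "(\<lambda>s. exp (lam j * s)) \<in> borel_measurable (lebesgue_on {0..t})"
      by (intro measurable_continuous_Icc continuous_intros)
    show ?thesis by measurable
  qed
  \<comment> \<open>The value \<open>a m\<close> was computed with all indices from \<open>m\<close>
    on replaced by 0, whereas \<open>z\<close> uses the full sequence. Up to time
    \<open>real m * \<tau>\<close> the two integrands differ at most at the endpoint, a null
    set.\<close>
  have grid: "z (real m * \<tau>) = a m" if m: "real m * \<tau> \<le> T" for m
  proof -
    have "J (\<lambda>k. a (nat k)) (real m * \<tau>) j = J (\<lambda>k. if nat k < m then a (nat k) else 0) (real m * \<tau>) j" for j
      unfolding J_def
    proof (rule integral_cong_AE[OF meas[OF m] meas[OF m]])
      have "AE s in lebesgue_on {0..real m * \<tau>}. s \<in> {0..real m * \<tau>}"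
        by (rule AE_I2) simp
      then show "AE s in lebesgue_on {0..real m * \<tau>}.
          exp (lam j * s) * (F (a (nat \<lfloor>s / \<tau>\<rfloor>)) \<bullet> eb j + op_sqrt Q (\<phi> s) \<bullet> eb j) =
          exp (lam j * s) * (F (if nat \<lfloor>s / \<tau>\<rfloor> < m then a (nat \<lfloor>s / \<tau>\<rfloor>) else 0) \<bullet> eb j + op_sqrt Q (\<phi> s) \<bullet> eb j)"
        using AE_lebesgue_on_neq[of "real m * \<tau>" "real m * \<tau>"]
      proof eventually_elim
        case (elim s)
        then have "s / \<tau> < of_int (int m)" using \<tau> by (simp add: divide_less_eq)
        then have "\<lfloor>s / \<tau>\<rfloor> < int m" by (simp only: floor_less_iff)
        then have "nat \<lfloor>s / \<tau>\<rfloor> < m" using elim \<tau> by (simp add: nat_less_iff)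
        then show ?case by simp
      qed
    qed
    then show ?thesis
      by (subst a) (simp add: z_def V_def)
  qed
  have step: "z (\<tau> * of_int \<lfloor>s / \<tau>\<rfloor>) = a (nat \<lfloor>s / \<tau>\<rfloor>)" if s: "s \<in> {0..T}" for s
  proof -
    note fg = floor_grid[OF \<tau>, of s]
    have e: "real (nat \<lfloor>s / \<tau>\<rfloor>) * \<tau> = \<tau> * of_int \<lfloor>s / \<tau>\<rfloor>"
      using fg(1) s by (simp add: mult.commute)
    show ?thesis
      using grid[of "nat \<lfloor>s / \<tau>\<rfloor>"] fg(3) s unfolding e by simp
  qed
  have FL: "(\<lambda>s. F (a (nat \<lfloor>s / \<tau>\<rfloor>))) \<in> L2_path T UNIV"
  proof (rule L2_path_bounded)
    show "(\<lambda>s. F (a (nat \<lfloor>s / \<tau>\<rfloor>))) \<in> borel_measurable (lebesgue_on {0..T})"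
      by (rule measurable_step[of "\<lambda>k. F (a (nat k))"])
    fix s assume s: "s \<in> {0..T}"
    have "\<lfloor>s / \<tau>\<rfloor> \<le> \<lfloor>T / \<tau>\<rfloor>"
      using s \<tau> by (intro floor_mono divide_right_mono) auto
    then have "nat \<lfloor>s / \<tau>\<rfloor> \<in> {..nat \<lfloor>T / \<tau>\<rfloor>}"
      by (simp add: nat_mono)
    then show "norm (F (a (nat \<lfloor>s / \<tau>\<rfloor>))) \<le> (\<Sum>k\<le>nat \<lfloor>T / \<tau>\<rfloor>. norm (F (a k)))"
      by (intro member_le_sum[of _ _ "\<lambda>k. norm (F (a k))"]) auto
  qed
  define w where "w s = F (a (nat \<lfloor>s / \<tau>\<rfloor>)) + op_sqrt Q (\<phi> s)" for s
  have w: "w \<in> L2_path T UNIV"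
    unfolding w_def by (intro L2_path_add FL R\<phi>)
  have iw: "integrable (lebesgue_on {0..T}) (\<lambda>s. w s \<bullet> eb j)" for j
    by (intro integrable_inner_eb L2_path_integrable w)
  have Jw: "J (\<lambda>k. a (nat k)) t j = (\<integral>s. exp (lam j * s) * (w s \<bullet> eb j) \<partial>lebesgue_on {0..t})" for t j
    by (simp add: J_def w_def inner_add_left)
  have zj: "z t \<bullet> eb j = (if j \<le> n then exp (- lam j * t) * (x \<bullet> eb j + (\<integral>s. exp (lam j * s) * (w s \<bullet> eb j) \<partial>lebesgue_on {0..t})) else 0)"
    if "j \<ge> 1" for t j
    unfolding z_def V_def Jw using that by (subst inner_sum_eb) auto
  have zH: "z t \<in> Hn n" for t
    unfolding z_def V_def Hn_def by (intro span_sum span_mul span_base) auto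
  have zPn: "z t = (\<Sum>j=1..n. (z t \<bullet> eb j) *\<^sub>R eb j)" for t
    using Pn_Hn[OF zH] by (simp add: Pn_def)
  have cz: "continuous_on {0..T} z"
    unfolding z_def V_def Jw
    by (intro continuous_intros continuous_on_integral_Icc integrable_continuous_mult iw)
  have zC: "z \<in> C_path T (Hn n)"
    using cz zH by (simp add: C_path_def)
  have Fz: "(\<lambda>s. F (z (\<tau> * of_int \<lfloor>s / \<tau>\<rfloor>))) \<in> L2_path T UNIV"
  proof (rule L2_path_bound)
    show "(\<lambda>s. F (z (\<tau> * of_int \<lfloor>s / \<tau>\<rfloor>))) \<in> borel_measurable (lebesgue_on {0..T})"
      by (rule measurable_step)
    show "integrable (lebesgue_on {0..T}) (\<lambda>s. (norm (F (a (nat \<lfloor>s / \<tau>\<rfloor>))))\<^sup>2)"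
      using FL by (simp add: L2_path_iff)
  qed (simp add: step)
  have mild: "mild_sol_n F Q T n \<tau> (Pn n x) \<phi> z"
    unfolding mild_sol_n_iff[where F = F, OF R zC \<phi> L2_path_integrable[OF Fz]]
  proof (intro ballI)
    fix t j assume t: "t \<in> {0..T}" and j: "j \<in> {1..n}"
    have "(\<integral>s. exp (lam j * s) * (F (z (\<tau> * of_int \<lfloor>s / \<tau>\<rfloor>)) \<bullet> eb j + op_sqrt Q (\<phi> s) \<bullet> eb j) \<partial>lebesgue_on {0..t})
        = (\<integral>s. exp (lam j * s) * (w s \<bullet> eb j) \<partial>lebesgue_on {0..t})"
      using t by (intro Bochner_Integration.integral_cong) (auto simp: w_def inner_add_left step)
    then show "exp (lam j * t) * (z t \<bullet> eb j) = x \<bullet> eb j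
      + (\<integral>s. exp (lam j * s) * (F (z (\<tau> * of_int \<lfloor>s / \<tau>\<rfloor>)) \<bullet> eb j + op_sqrt Q (\<phi> s) \<bullet> eb j) \<partial>lebesgue_on {0..t})"
      unfolding exp_minus_eq_iff using j by (simp add: zj)
  qed
  \<comment> \<open>The time derivative of \<open>z\<close> as read off from the differential form
    of the equation: projected Laplacian plus projected drift and control.\<close>
  define \<upsilon> where "\<upsilon> s = (\<Sum>j=1..n. (- lam j * (z s \<bullet> eb j)) *\<^sub>R eb j) + Pn n (w s)" for s
  have "\<upsilon> \<in> L2_path T UNIV"
    unfolding \<upsilon>_def
    by (intro L2_path_add L2_path_bounded_linear[OF bounded_linear_Pn w] L2_path_continuous continuous_intros cz)
  moreover have "\<upsilon> s \<in> Hn n" for s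
  proof -
    have "(\<Sum>j=1..n. (- lam j * (z s \<bullet> eb j)) *\<^sub>R eb j) \<in> Hn n"
      unfolding Hn_def by (intro span_sum span_mul span_base) auto
    then show ?thesis
      using Pn_in_Hn[of n "w s"] unfolding \<upsilon>_def Hn_def by (rule span_add)
  qed
  ultimately have \<upsilon>: "\<upsilon> \<in> L2_path T (Hn n)"
    by (simp add: L2_path_def)
  have \<upsilon>j: "\<upsilon> s \<bullet> eb j = (if j \<le> n then - lam j * (z s \<bullet> eb j) + w s \<bullet> eb j else 0)" if "j \<ge> 1" for s j
    unfolding \<upsilon>_def inner_add_left using that by (subst inner_sum_eb) (auto simp: Pn_inner_eb)
  have z\<upsilon>: "z t = Pn n x + (\<integral>s. \<upsilon> s \<partial>lebesgue_on {0..t})" if t: "t \<in> {0..T}" for t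
  proof (rule L2_eqI)
    fix j :: nat assume j: "j \<ge> 1"
    have sub: "{0..t} \<subseteq> {0..T}" using t by auto
    have i: "integrable (lebesgue_on {0..t}) \<upsilon>"
      using integrable_Icc_mono[OF L2_path_integrable[OF L2_path_subset[OF \<upsilon>]] sub] .
    have "(\<integral>s. \<upsilon> s \<partial>lebesgue_on {0..t}) \<bullet> eb j = (\<integral>s. \<upsilon> s \<bullet> eb j \<partial>lebesgue_on {0..t})"
      using i by (intro integral_inner_left[symmetric])
    moreover have "z t \<bullet> eb j = Pn n x \<bullet> eb j + (\<integral>s. \<upsilon> s \<bullet> eb j \<partial>lebesgue_on {0..t})"
    proof (cases "j \<le> n")
      case True
      \<comment> \<open>Multiplying back by \<open>exp (- lam j * t)\<close> through
        \<open>exp_weighted_integral\<close> converts the mild form of the coordinate into its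
        integrated differential form.\<close>
      define k where "k t = exp (lam j * t) * (z t \<bullet> eb j)" for t
      have "exp (- lam j * t) * k t = x \<bullet> eb j
          + (\<integral>s. exp (- lam j * s) * (- lam j * k s + exp (lam j * s) * (w s \<bullet> eb j)) \<partial>lebesgue_on {0..t})"
      proof (rule exp_weighted_integral[OF _ _ t])
        show "integrable (lebesgue_on {0..T}) (\<lambda>s. exp (lam j * s) * (w s \<bullet> eb j))"
          by (intro integrable_continuous_mult continuous_intros iw)
        show "k t = x \<bullet> eb j + (\<integral>s. exp (lam j * s) * (w s \<bullet> eb j) \<partial>lebesgue_on {0..t})" for t
          unfolding k_def exp_minus_eq_iff using True j by (simp add: zj)
      qed
      moreover have "exp (- lam j * s) * (- lam j * k s + exp (lam j * s) * (w s \<bullet> eb j)) = \<upsilon> s \<bullet> eb j" for s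
      proof -
        have "exp (- lam j * s) * exp (lam j * s) = 1" by (simp add: exp_add[symmetric])
        then show ?thesis
          unfolding \<upsilon>j[OF j] k_def using True by simp algebra
      qed
      moreover have "exp (- lam j * t) * k t = z t \<bullet> eb j"
        unfolding k_def by (simp add: exp_add[symmetric] mult.assoc[symmetric])
      ultimately show ?thesis
        using True j by (simp add: Pn_inner_eb)
    next
      case False
      then show ?thesis using j by (simp add: zj \<upsilon>j Pn_inner_eb)
    qed
    ultimately show "z t \<bullet> eb j = (Pn n x + (\<integral>s. \<upsilon> s \<partial>lebesgue_on {0..t})) \<bullet> eb j"
      by (simp add: inner_add_left)
  qed
  have "z \<in> eff_dom_n T n (Pn n x)"
    unfolding eff_dom_n_def using zC \<upsilon> z\<upsilon> by blast
  then show ?thesis using mild Fz by (rule that)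
qed

section \<open>Error estimate\<close>

text \<open>
  The bound is propagated along the grid: the right-hand side at time \<open>t\<close> only involves the
  error at grid points before \<open>t\<close>.
\<close>

lemma discrete_error:
  assumes R: "bounded_linear (op_sqrt Q)"
    and r: "\<And>i u. i \<ge> 1 \<Longrightarrow> op_sqrt Q u \<bullet> eb i = r i * (u \<bullet> eb i)"
    and LF: "LF > 0" "\<And>u v. norm (F u - F v) \<le> LF * norm (u - v)"
    and \<phi>: "\<phi> \<in> L2_path T UNIV" and z: "mild_sol F Q T x \<phi> z"
    and Fz: "integrable (lebesgue_on {0..T}) (\<lambda>s. F (z s))"
    and z': "mild_sol_n F Q T n \<tau> (Pn n x) (\<lambda>s. Pn n (\<phi> s)) z'"
    and Fz': "integrable (lebesgue_on {0..T}) (\<lambda>s. F (z' (\<tau> * of_int \<lfloor>s / \<tau>\<rfloor>)))"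
    and \<tau>: "\<tau> > 0" and \<delta>: "\<And>s. s \<in> {0..T} \<Longrightarrow> norm (z s - Pn n (z (\<tau> * of_int \<lfloor>s / \<tau>\<rfloor>))) \<le> \<delta>"
    and t: "t \<in> {0..T}"
  shows "norm (Pn n (z t) - z' t) \<le> \<delta> * (exp (LF * t) - 1)"
proof -
  define d where "d t = norm (Pn n (z t) - z' t)" for t
  define G where "G s = F (z s) - F (z' (\<tau> * of_int \<lfloor>s / \<tau>\<rfloor>))" for s
  have iG: "integrable (lebesgue_on {0..T}) G"
    unfolding G_def by (intro Bochner_Integration.integrable_diff Fz Fz')
  have zC: "z \<in> C_path T UNIV" and zC': "z' \<in> C_path T (Hn n)"
    using z z' by (simp_all add: mild_sol_def mild_sol_n_def)
  have P\<phi>: "(\<lambda>s. Pn n (\<phi> s)) \<in> L2_path T UNIV"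
    by (rule L2_path_bounded_linear[OF bounded_linear_Pn \<phi>])
  note zc = mild_sol_iff[OF R zC \<phi> Fz, THEN iffD1, OF z, rule_format]
  note zc' = mild_sol_n_iff[OF R zC' P\<phi> Fz', THEN iffD1, OF z', rule_format]
  have iR: "integrable (lebesgue_on {0..T}) (\<lambda>s. op_sqrt Q (\<phi> s))"
    by (rule L2_path_integrable[OF L2_path_bounded_linear[OF R \<phi>]])
  have iR': "integrable (lebesgue_on {0..T}) (\<lambda>s. op_sqrt Q (Pn n (\<phi> s)))"
    by (rule L2_path_integrable[OF L2_path_bounded_linear[OF R P\<phi>]])
  have repr: "Pn n (z t) - z' t = (\<integral>s. semigr_n n (t - s) (Pn n (G s)) \<partial>lebesgue_on {0..t})"
    if t: "t \<in> {0..T}" for t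
  proof (rule L2_eqI)
    fix j :: nat assume j: "j \<ge> 1"
    have sub: "{0..t} \<subseteq> {0..T}" using t by auto
    note mono = integrable_Icc_mono[OF _ sub]
    show "(Pn n (z t) - z' t) \<bullet> eb j = (\<integral>s. semigr_n n (t - s) (Pn n (G s)) \<partial>lebesgue_on {0..t}) \<bullet> eb j"
    proof (cases "j \<le> n")
      case False
      have "z' t \<in> Hn n" using zC' t by (simp add: C_path_def)
      then show ?thesis
        unfolding semigr_n_integral[OF mono[OF iG]] using j False
        by (subst inner_sum_eb) (auto simp: inner_diff_left Pn_inner_eb inner_eb_Hn)
    next
      case True
      have i: "integrable (lebesgue_on {0..t}) (\<lambda>s. exp (lam j * s) * (F (z s) \<bullet> eb j + op_sqrt Q (\<phi> s) \<bullet> eb j))"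
        "integrable (lebesgue_on {0..t}) (\<lambda>s. exp (lam j * s) * (F (z' (\<tau> * of_int \<lfloor>s / \<tau>\<rfloor>)) \<bullet> eb j + op_sqrt Q (Pn n (\<phi> s)) \<bullet> eb j))"
        by (intro integrable_continuous_mult continuous_intros Bochner_Integration.integrable_add integrable_inner_eb
            mono Fz Fz' iR iR')+
      have "exp (lam j * t) * ((Pn n (z t) - z' t) \<bullet> eb j)
          = exp (lam j * t) * (z t \<bullet> eb j) - exp (lam j * t) * (z' t \<bullet> eb j)"
        using True j by (simp add: inner_diff_left Pn_inner_eb right_diff_distrib)
      also have "\<dots> = (\<integral>s. exp (lam j * s) * (F (z s) \<bullet> eb j + op_sqrt Q (\<phi> s) \<bullet> eb j) \<partial>lebesgue_on {0..t})
          - (\<integral>s. exp (lam j * s) * (F (z' (\<tau> * of_int \<lfloor>s / \<tau>\<rfloor>)) \<bullet> eb j + op_sqrt Q (Pn n (\<phi> s)) \<bullet> eb j) \<partial>lebesgue_on {0..t})"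
        using zc[OF t j] zc'[OF t, of j] True j by simp
      \<comment> \<open>Here the control disappears: \<open>op_sqrt Q\<close> is diagonal, so for j
        \<le> n it gives \<phi> and \<open>Pn n (\<phi> s)\<close> the same coordinate.\<close>
      also have "\<dots> = (\<integral>s. exp (lam j * s) * (G s \<bullet> eb j) \<partial>lebesgue_on {0..t})"
        using True j unfolding Bochner_Integration.integral_diff[OF i, symmetric]
        by (intro Bochner_Integration.integral_cong refl) (simp add: G_def inner_diff_left r Pn_inner_eb algebra_simps)
      finally have "(Pn n (z t) - z' t) \<bullet> eb j = (\<integral>s. exp (- lam j * (t - s)) * (G s \<bullet> eb j) \<partial>lebesgue_on {0..t})"
        unfolding exp_minus_eq_iff exp_convolution .
      then show ?thesis
        unfolding semigr_n_integral[OF mono[OF iG]] using True j by (subst inner_sum_eb) auto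
    qed
  qed
  \<comment> \<open>The bound reproduces itself: adding \<delta> to it at a grid point leaves
    \<delta> times an exponential, and \<open>LF\<close> times that integrates back to the same
    expression at time \<open>t\<close>.\<close>
  have step: "d t \<le> \<delta> * (exp (LF * t) - 1)"
    if t: "t \<in> {0..T}" and IH: "\<And>s. s \<in> {0..<t} \<Longrightarrow> d (\<tau> * of_int \<lfloor>s / \<tau>\<rfloor>) \<le> \<delta> * (exp (LF * (\<tau> * of_int \<lfloor>s / \<tau>\<rfloor>)) - 1)" for t
  proof -
    let ?M = "lebesgue_on {0..t}"
    have sub: "{0..t} \<subseteq> {0..T}" using t by auto
    note iGt = integrable_Icc_mono[OF iG sub]
    \<comment> \<open>In this form the contraction estimates for \<open>semigr\<close> and
      \<open>Pn\<close> apply directly.\<close>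
    have S: "semigr_n n (t - s) (Pn n (G s)) = Pn n (semigr (t - s) (G s))" if "s \<in> {0..t}" for s
      unfolding semigr_n_Pn using that by (auto simp: Pn_def semigr_inner_eb intro!: sum.cong)
    have iS: "integrable ?M (\<lambda>s. Pn n (semigr (t - s) (G s)))"
      by (rule integrable_bounded_linear[OF bounded_linear_Pn semigr_integrable[OF iGt]])
    have "d t = norm (\<integral>s. Pn n (semigr (t - s) (G s)) \<partial>?M)"
      unfolding d_def repr[OF t] by (intro arg_cong[where f = norm] Bochner_Integration.integral_cong refl S) simp
    also have "\<dots> \<le> (\<integral>s. norm (Pn n (semigr (t - s) (G s))) \<partial>?M)"
      by (rule integral_norm_bound)
    also have "\<dots> \<le> (\<integral>s. \<delta> * (LF * exp (LF * s)) \<partial>?M)"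
    proof (rule integral_mono_AE)
      show "integrable ?M (\<lambda>s. norm (Pn n (semigr (t - s) (G s))))" using iS by simp
      show "integrable ?M (\<lambda>s. \<delta> * (LF * exp (LF * s)))"
        by (intro integrable_continuous_Icc continuous_intros)
      have "AE s in ?M. s \<in> {0..t}" by (rule AE_I2) simp
      then show "AE s in ?M. norm (Pn n (semigr (t - s) (G s))) \<le> \<delta> * (LF * exp (LF * s))"
        \<comment> \<open>The hypothesis covers only times before \<open>t\<close>. If
          \<open>t\<close> is itself a grid point, the time s = t would lead back to
          \<open>d t\<close>, so this single point is removed.\<close>
        using AE_lebesgue_on_neq[of t t]
      proof eventually_elim
        case (elim s)
        then have s: "s \<in> {0..<t}" "s \<in> {0..T}" using t by auto
        define g where "g = \<tau> * of_int \<lfloor>s / \<tau>\<rfloor>"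
        have g: "0 \<le> g" "g \<le> s" unfolding g_def using floor_grid[OF \<tau>, of s] s by auto
        have \<delta>0: "0 \<le> \<delta>" using \<delta>[OF s(2)] norm_ge_zero order_trans by blast
        have "norm (Pn n (semigr (t - s) (G s))) \<le> norm (G s)"
          using norm_Pn_le norm_semigr_le[of "t - s" "G s"] elim by (auto intro: order_trans)
        also have "\<dots> \<le> LF * norm (z s - z' g)"
          unfolding G_def g_def by (rule LF(2))
        also have "\<dots> \<le> LF * (\<delta> * exp (LF * s))"
        proof (rule mult_left_mono)
          have "norm (z s - z' g) \<le> norm (z s - Pn n (z g)) + norm (Pn n (z g) - z' g)"
            using norm_triangle_ineq[of "z s - Pn n (z g)" "Pn n (z g) - z' g"] by simp
          also have "\<dots> \<le> \<delta> + \<delta> * (exp (LF * g) - 1)"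
            using \<delta>[OF s(2)] IH[OF s(1)] unfolding g_def d_def by (rule add_mono)
          also have "\<dots> = \<delta> * exp (LF * g)" by (simp add: algebra_simps)
          also have "\<dots> \<le> \<delta> * exp (LF * s)"
            using g LF(1) \<delta>0 by (intro mult_left_mono) auto
          finally show "norm (z s - z' g) \<le> \<delta> * exp (LF * s)" .
        qed (use LF in simp)
        finally show ?case by (simp add: mult_ac)
      qed
    qed
    also have "\<dots> = integral {0..t} (\<lambda>s. \<delta> * (LF * exp (LF * s)))"
      by (intro integral_Icc_HK(2) integrable_continuous_Icc continuous_intros)
    also have "integral {0..t} (\<lambda>s. \<delta> * (LF * exp (LF * s))) = \<delta> * exp (LF * t) - \<delta> * exp (LF * 0)"
    proof (rule integral_unique, rule fundamental_theorem_of_calculus)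
      show "0 \<le> t" using t by simp
    qed (auto intro!: derivative_eq_intros simp: has_real_derivative_iff_has_vector_derivative[symmetric])
    also have "\<dots> = \<delta> * (exp (LF * t) - 1)" by (simp add: right_diff_distrib)
    finally show ?thesis .
  qed
  have grid: "d (\<tau> * real m) \<le> \<delta> * (exp (LF * (\<tau> * real m)) - 1)" if "\<tau> * real m \<le> T" for m
    using that
  proof (induction m rule: less_induct)
    case (less m)
    show ?case
    proof (rule step)
      show "\<tau> * real m \<in> {0..T}" using less.prems \<tau> by simp
      fix s assume s: "s \<in> {0..<\<tau> * real m}"
      then have "s / \<tau> < of_int (int m)" using \<tau> by (simp add: divide_less_eq mult.commute)
      then have "\<lfloor>s / \<tau>\<rfloor> < int m" by (simp only: floor_less_iff)
      moreover have "0 \<le> \<lfloor>s / \<tau>\<rfloor>" "\<tau> * of_int \<lfloor>s / \<tau>\<rfloor> \<le> s" using floor_grid[OF \<tau>, of s] s by auto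
      ultimately show "d (\<tau> * of_int \<lfloor>s / \<tau>\<rfloor>) \<le> \<delta> * (exp (LF * (\<tau> * of_int \<lfloor>s / \<tau>\<rfloor>)) - 1)"
        using less.IH[of "nat \<lfloor>s / \<tau>\<rfloor>"] s less.prems by (simp add: nat_less_iff)
    qed
  qed
  have "d t \<le> \<delta> * (exp (LF * t) - 1)"
  proof (rule step[OF t])
    fix s assume s: "s \<in> {0..<t}"
    have "0 \<le> \<lfloor>s / \<tau>\<rfloor>" "\<tau> * of_int \<lfloor>s / \<tau>\<rfloor> \<le> s" using floor_grid[OF \<tau>, of s] s by auto
    then show "d (\<tau> * of_int \<lfloor>s / \<tau>\<rfloor>) \<le> \<delta> * (exp (LF * (\<tau> * of_int \<lfloor>s / \<tau>\<rfloor>)) - 1)"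
      using grid[of "nat \<lfloor>s / \<tau>\<rfloor>"] s t by simp
  qed
  then show ?thesis by (simp add: d_def)
qed

text \<open>A finite net of radius e/3 suffices because every \<open>Pn n\<close> is a
  contraction.\<close>

lemma Pn_uniform_on_compact:
  assumes K: "compact K" and e: "e > 0"
  shows "\<forall>\<^sub>F n in sequentially. \<forall>u\<in>K. norm (u - Pn n u) < e"
proof -
  obtain C where C: "finite C" "K \<subseteq> (\<Union>c\<in>C. ball c (e / 3))"
    using compactE_image[OF K, of UNIV "\<lambda>c. ball c (e / 3)"] e by (metis UNIV_I UN_I centre_in_ball divide_pos_pos open_ball subsetI zero_less_numeral)
  have "\<forall>\<^sub>F n in sequentially. norm (c - Pn n c) < e / 3" for c
    using tendstoD[OF Pn_tendsto, of "e / 3" c] e by (simp add: dist_norm norm_minus_commute)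
  then have "\<forall>\<^sub>F n in sequentially. \<forall>c\<in>C. norm (c - Pn n c) < e / 3"
    using C(1) by (simp add: eventually_ball_finite)
  then show ?thesis
  proof eventually_elim
    case (elim n)
    interpret P: bounded_linear "Pn n" by (rule bounded_linear_Pn)
    show ?case
    proof
      fix u assume "u \<in> K"
      then obtain c where c: "c \<in> C" "norm (c - u) < e / 3" using C(2) by (auto simp: dist_norm)
      have "u - Pn n u = (u - c) + (c - Pn n c) + Pn n (c - u)" by (simp add: P.diff)
      then have "norm (u - Pn n u) \<le> norm ((u - c) + (c - Pn n c)) + norm (Pn n (c - u))"
        by (simp only: norm_triangle_ineq)
      also have "\<dots> \<le> norm (u - c) + norm (c - Pn n c) + norm (Pn n (c - u))"
        by (intro add_right_mono norm_triangle_ineq)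
      finally show "norm (u - Pn n u) < e"
        using c elim norm_Pn_le[of n "c - u"] norm_minus_commute[of u c] by fastforce
    qed
  qed
qed

text \<open>Dominated convergence; the contraction property of \<open>Pn n\<close> makes the squared
  norm of \<phi> itself the majorant.\<close>

lemma L2_path_sqnorm_Pn_tendsto:
  assumes \<phi>: "\<phi> \<in> L2_path T UNIV"
  shows "(\<lambda>n. L2_path_sqnorm T (\<lambda>s. Pn n (\<phi> s))) \<longlonglongrightarrow> L2_path_sqnorm T \<phi>"
  unfolding L2_path_sqnorm_def
proof (rule integral_dominated_convergence)
  show "integrable (lebesgue_on {0..T}) (\<lambda>s. (norm (\<phi> s))\<^sup>2)"
    using \<phi> by (simp add: L2_path_iff)
  show "(\<lambda>s. (norm (\<phi> s))\<^sup>2) \<in> borel_measurable (lebesgue_on {0..T})"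
    using \<phi> by (auto simp: L2_path_iff)
  show "(\<lambda>s. (norm (Pn n (\<phi> s)))\<^sup>2) \<in> borel_measurable (lebesgue_on {0..T})" for n
    using L2_path_bounded_linear[OF bounded_linear_Pn[of n] \<phi>] by (auto simp: L2_path_iff)
  show "AE s in lebesgue_on {0..T}. (\<lambda>n. (norm (Pn n (\<phi> s)))\<^sup>2) \<longlonglongrightarrow> (norm (\<phi> s))\<^sup>2"
    by (intro AE_I2 tendsto_intros Pn_tendsto)
  show "AE s in lebesgue_on {0..T}. norm ((norm (Pn n (\<phi> s)))\<^sup>2) \<le> (norm (\<phi> s))\<^sup>2" for n
    by (intro AE_I2) (simp add: power_mono norm_Pn_le)
qed

theorem theorem4p3:
  fixes Q F :: "L2 \<Rightarrow> L2" and F' :: "L2 \<Rightarrow> L2 \<Rightarrow> L2"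
    and q :: "nat \<Rightarrow> real" and LF L T :: real and x :: L2
  assumes Q: "bounded_linear Q" "self_adjoint Q" "positive_definite Q"
    and q: "\<And>i. i \<ge> 1 \<Longrightarrow> q i > 0" "\<And>i. i \<ge> 1 \<Longrightarrow> Q (eb i) = q i *\<^sub>R eb i"
    and dom: "dom_A \<subseteq> range (op_sqrt Q)"
    and AQ: "range (op_sqrt Q) \<subseteq> dom_neg_A_pow (1 / 2)"
      "hilbert_schmidt (\<lambda>u. neg_A_pow (1 / 2) (op_sqrt Q u))"
    and QA: "bounded_linear (\<lambda>u. op_inv_sqrt Q (neg_A_pow (- 1) u))"
    and F': "\<And>u. (F has_derivative F' u) (at u)"
    and LF: "LF > 0" "\<And>u v. norm (F u - F v) \<le> LF * norm (u - v)"
    and L: "L > 0"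
    and F_H1: "\<And>u. u \<in> Hdot 1 \<Longrightarrow> F u \<in> Hdot 1 \<and> Hdot_norm 1 (F u) \<le> L * (1 + Hdot_norm 1 u)"
    and F'_H2: "\<And>u v. u \<in> Hdot 2 \<Longrightarrow> v \<in> Hdot 2 \<Longrightarrow>
      F' u v \<in> Hdot 2 \<and> Hdot_norm 2 (F' u v) \<le> L * (1 + (Hdot_norm 2 u)\<^sup>2) * Hdot_norm 2 v"
    and T: "T > 0"
  shows "\<forall>\<kappa>>0. \<forall>z\<in>W12_Q F Q T. z 0 = x \<longrightarrow>
    (\<exists>n\<ge>1. \<exists>\<tau>>0. \<exists>z'\<in>eff_dom_n T n (Pn n x).
       (SUP t\<in>{0..T}. norm (z t - z' t)) < \<kappa> \<and>
       \<bar>rate F Q T x z - rate_n F Q T n \<tau> (Pn n x) z'\<bar> < ereal \<kappa>)"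
proof (intro allI ballI impI)
  fix \<kappa> :: real and z assume \<kappa>: "\<kappa> > 0" and z: "z \<in> W12_Q F Q T" and z0: "z 0 = x"
  note R = op_sqrt_props(1)[OF Q(1) q]
  note r = op_sqrt_props(2)[OF Q(1) q]
  have r0: "sqrt (q i) \<noteq> 0" if "i \<ge> 1" for i using q(1)[OF that] by simp
  have F: "continuous_on UNIV F"
    using F' by (intro has_derivative_continuous_on) auto
  obtain \<phi> where \<phi>: "\<phi> \<in> L2_path T UNIV" and mild: "mild_sol F Q T x \<phi> z"
    using W12_Q_mild_sol[OF R F T z] unfolding z0 by blast
  have cz: "continuous_on {0..T} z"
    using mild by (simp add: mild_sol_def C_path_def)
  have Fz: "integrable (lebesgue_on {0..T}) (\<lambda>s. F (z s))"
    by (intro integrable_continuous_Icc continuous_on_compose2[OF F cz]) auto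
  \<comment> \<open>Projecting \<open>z\<close> costs at most \<delta> and the discrete error at
    most \<open>\<delta> * (exp (LF * T) - 1)\<close>; the total
    \<open>\<delta> * exp (LF * T)\<close> is half of \<kappa>.\<close>
  define \<delta> where "\<delta> = \<kappa> / (2 * exp (LF * T))"
  have \<delta>: "\<delta> > 0" using \<kappa> by (simp add: \<delta>_def)
  have "\<forall>\<^sub>F n in sequentially. n \<ge> 1 \<and> (\<forall>u\<in>z ` {0..T}. norm (u - Pn n u) < \<delta> / 2) \<and>
      dist (L2_path_sqnorm T (\<lambda>s. Pn n (\<phi> s))) (L2_path_sqnorm T \<phi>) < \<kappa>"
    using \<delta> \<kappa> by (intro eventually_conj eventually_ge_at_top Pn_uniform_on_compact
        compact_continuous_image[OF cz] tendstoD[OF L2_path_sqnorm_Pn_tendsto[OF \<phi>]]) auto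
  then obtain n where n: "n \<ge> 1" "\<And>t. t \<in> {0..T} \<Longrightarrow> norm (z t - Pn n (z t)) < \<delta> / 2"
    "\<bar>L2_path_sqnorm T (\<lambda>s. Pn n (\<phi> s)) - L2_path_sqnorm T \<phi>\<bar> < \<kappa>"
    using eventually_happens'[OF sequentially_bot] by (fastforce simp: dist_real_def)
  have "uniformly_continuous_on {0..T} z"
    by (rule compact_uniformly_continuous[OF cz]) simp
  then obtain \<tau> where \<tau>: "\<tau> > 0" "\<And>s t. s \<in> {0..T} \<Longrightarrow> t \<in> {0..T} \<Longrightarrow> dist s t < \<tau> \<Longrightarrow> dist (z s) (z t) < \<delta> / 2"
    unfolding uniformly_continuous_on_def using \<delta> by (metis half_gt_zero)
  \<comment> \<open>One half of \<delta> pays for the shift in time to the grid point, the other for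
    the projection there.\<close>
  have near: "norm (z s - Pn n (z (\<tau> * of_int \<lfloor>s / \<tau>\<rfloor>))) \<le> \<delta>" if s: "s \<in> {0..T}" for s
  proof -
    define g where "g = \<tau> * of_int \<lfloor>s / \<tau>\<rfloor>"
    have g: "0 \<le> g" "g \<le> s" "s - g < \<tau>" using floor_grid[OF \<tau>(1), of s] s by (auto simp: g_def)
    have "norm (z s - z g) < \<delta> / 2" "norm (z g - Pn n (z g)) < \<delta> / 2"
      using \<tau>(2)[of s g] n(2)[of g] g s by (auto simp: dist_norm)
    then show ?thesis
      using norm_triangle_ineq[of "z s - z g" "z g - Pn n (z g)"] by (simp add: g_def)
  qed
  have P\<phi>: "(\<lambda>s. Pn n (\<phi> s)) \<in> L2_path T (Hn n)"
    using L2_path_bounded_linear[OF bounded_linear_Pn \<phi>] Pn_in_Hn by (simp add: L2_path_def)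
  obtain z' where z': "z' \<in> eff_dom_n T n (Pn n x)" "mild_sol_n F Q T n \<tau> (Pn n x) (\<lambda>s. Pn n (\<phi> s)) z'"
    and Fz': "(\<lambda>s. F (z' (\<tau> * of_int \<lfloor>s / \<tau>\<rfloor>))) \<in> L2_path T UNIV"
    by (rule discrete_mild_solution_exists[OF R L2_path_subset[OF P\<phi>] \<tau>(1)])
  note iFz' = L2_path_integrable[OF Fz']
  have "norm (z t - z' t) \<le> \<kappa> / 2" if t: "t \<in> {0..T}" for t
  proof -
    have "norm (z t - z' t) \<le> norm (z t - Pn n (z t)) + norm (Pn n (z t) - z' t)"
      using norm_triangle_ineq[of "z t - Pn n (z t)" "Pn n (z t) - z' t"] by simp
    also have "\<dots> \<le> \<delta> + \<delta> * (exp (LF * t) - 1)"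
      using n(2)[OF t] \<delta> discrete_error[OF R r LF \<phi> mild Fz z'(2) iFz' \<tau>(1) near t] by (intro add_mono) auto
    also have "\<dots> = \<delta> * exp (LF * t)" by (simp add: algebra_simps)
    also have "\<dots> \<le> \<delta> * exp (LF * T)"
      using t LF(1) \<delta> by (intro mult_left_mono) auto
    also have "\<dots> = \<kappa> / 2" by (simp add: \<delta>_def)
    finally show ?thesis .
  qed
  \<comment> \<open>The pointwise bound was aimed at half of \<kappa> because a supremum preserves
    only the weak inequality.\<close>
  then have "(SUP t\<in>{0..T}. norm (z t - z' t)) \<le> \<kappa> / 2"
    using T by (intro cSUP_least) auto
  then have "(SUP t\<in>{0..T}. norm (z t - z' t)) < \<kappa>" using \<kappa> by linarith
  moreover have "\<bar>rate F Q T x z - rate_n F Q T n \<tau> (Pn n x) z'\<bar> < ereal \<kappa>"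
  proof -
    have "rate F Q T x z = ereal (1 / 2 * L2_path_sqnorm T \<phi>)"
      by (rule rate_eq[OF R r r0 Fz \<phi> mild])
    moreover have "rate_n F Q T n \<tau> (Pn n x) z' = ereal (1 / 2 * L2_path_sqnorm T (\<lambda>s. Pn n (\<phi> s)))"
      by (rule rate_n_eq[OF R r r0 iFz' P\<phi> z'(2)])
    ultimately show ?thesis using n(3) by (simp add: abs_less_iff)
  qed
  ultimately show "\<exists>n\<ge>1. \<exists>\<tau>>0. \<exists>z'\<in>eff_dom_n T n (Pn n x).
       (SUP t\<in>{0..T}. norm (z t - z' t)) < \<kappa> \<and>
       \<bar>rate F Q T x z - rate_n F Q T n \<tau> (Pn n x) z'\<bar> < ereal \<kappa>"
    using n(1) \<tau>(1) z'(1) by blast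
qed

end
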